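(* Let $(\mathfrak n_i,\varphi_i)$, $i=1,\dots,7$, be the nilpotent Lie algebras with closed Laplacian solitons given in the context, and let $N_i$ be the simply connected nilpotent Lie group with Lie algebra $\mathfrak n_i$ and left-invariant $G_2$-structure $\varphi_i$. For $i=2,3,4,5,6,7$, the closed Laplacian soliton $\varphi_i$ on $N_i$ is not gradient up to homothetic $G_2$-structures: if $\psi$ is a left-invariant $G_2$-structure on $N_i$ homothetic to $\varphi_i$, then there are no smooth $f:N_i\to\mathbb R$ and $\lambda\in\mathbb R$ such that $(\psi,\nabla f,\lambda)$ is a gradient Laplacian soliton. If $N_1$ admits a (non-trivial) gradient Laplacian soliton $(\varphi_1,\nabla f,\lambda)$, then it must be a Gaussian.
   Context: A $G_2$-structure on a $7$-manifold is a $3$-form $\varphi$ such that at each point there is a basis $(e_i)$ of the tangent space with $\varphi=e^{127}+e^{347}+e^{567}+e^{135}-e^{146}-e^{236}-e^{245}$. It induces a metric $g_\varphi$ and orientation by $g_\varphi(X,Y)\,\mathrm{vol}_\varphi=\frac16\,\iota_X\varphi\wedge\iota_Y\varphi\wedge\varphi$, hence a Hodge star $*$. The Hodge Laplacian on $3$-forms is $\Delta_\varphi=*d*d-d*d*$. $(\varphi,\nabla f,\lambda)$ is a gradient Laplacian soliton if $\lambda\in\mathbb R$, $f$ is smooth, $\nabla f$ is complete and $\Delta_\varphi\varphi=\lambda\varphi+\mathcal L_{\nabla f}\varphi$. For closed $\varphi$ this gives $\mathrm{Hess} f=-g_\varphi(Q_\varphi\cdot,\cdot)-\frac13\lambda g_\varphi$,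 where $Q_\varphi=\mathrm{Ric}_\varphi-\frac1{12}\mathrm{tr}(\tau_\varphi^2)I+\frac12\tau_\varphi^2$ and $\tau_\varphi=-*d*\varphi$ is identified with a skew endomorphism by $\tau_\varphi(X,Y)=g_\varphi(\tau_\varphi X,Y)$. It is non-trivial if $f$ is non-constant. $G_2$-structures $\psi_1,\psi_2$ on Lie algebras $\mathfrak g_1,\mathfrak g_2$ (identified with left-invariant ones on the simply connected groups) are equivalent if there is a Lie algebra isomorphism $h:\mathfrak g_1\to\mathfrak g_2$ with $h\cdot\psi_1:=\psi_1(h^{-1}\cdot,h^{-1}\cdot,h^{-1}\cdot)=\psi_2$, and homothetic if $\psi_1$ is equivalent to $c\psi_2$ for some $c\in\mathbb R\setminus\{0\}$. Gaussian: on $N_1\cong\mathbb R^7$ with Euclidean coordinates $x$ adapted to an orthonormal basis, $f(x)=-\frac{\lambda}{6}|x|^2-\sum_i\alpha_ix_i-\beta$ with constants $\alpha_i,\beta$. The Lie algebras (basis $(e_i)$, orthonormal for $g_{\varphi_i}$; brackets not listed and not determined by skew-symmetry vanish): - $\mathfrak n_1$: abelian, $\varphi_1$ any $G_2$-structure on $\mathfrak n_1$ (the brackets being trivial, it is closed and torsion-free). - $\mathfrak n_2$: $[e_1,e_2]=-e_5$, $[e_1,e_3]=-e_6$; $\varphi_2=e^{147}+e^{267}+e^{357}+e^{123}+e^{156}+e^{245}-e^{346}$. - $\mathfrak n_3$ ($0<c<1/2$): $[e_1,e_2]=-e_4$, $[e_1,e_3]=-(1-c)e_5$, $[e_2,e_3]=-c\,e_6$;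 $\varphi_3=e^{123}+e^{145}+e^{167}+e^{246}-e^{257}-e^{347}-e^{356}$. - $\mathfrak n_4$: $[e_1,e_2]=-\sqrt2e_3$, $[e_1,e_3]=-e_6$, $[e_2,e_4]=-\sqrt2e_6$, $[e_1,e_5]=-e_7$; $\varphi_4=-e^{124}-e^{456}+e^{347}+e^{135}+e^{167}+e^{257}-e^{236}$. - $\mathfrak n_5$: $[e_1,e_2]=-\sqrt2e_3$, $[e_1,e_3]=-e_6$, $[e_1,e_4]=-e_7$, $[e_2,e_5]=-\sqrt2e_7$; $\varphi_5=-e^{125}+e^{134}+e^{167}-e^{237}-e^{246}-e^{356}+e^{457}$. - $\mathfrak n_6$: $[e_1,e_2]=-\sqrt2e_4$, $[e_1,e_3]=-\sqrt2e_5$, $[e_1,e_4]=-e_6$, $[e_1,e_5]=-e_7$; $\varphi_6=e^{123}+e^{145}+e^{167}+e^{257}-e^{246}+e^{347}+e^{356}$. - $\mathfrak n_7$: $[e_1,e_2]=4e_4$, $[e_2,e_7]=-2e_5$, $[e_1,e_7]=-2e_6$, $[e_5,e_7]=-\sqrt6e_3$, $[e_6,e_7]=-\sqrt6e_4$; $\varphi_7=e^{127}+e^{347}+e^{567}+e^{135}-e^{146}-e^{236}-e^{245}$. *)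

theory Defs
  imports "HOL-Analysis.Analysis" "HOL-Combinatorics.Combinatorics"
begin

section \<open>Exterior forms and differential calculus on \<open>\<real>\<^sup>7\<close>\<close>

text \<open>
  In the index type \<open>7\<close> the numerals \<open>1, \<dots>, 7\<close> are exactly its seven elements (\<open>7 = 0\<close> there),
  so \<open>x $ 1, \<dots>, x $ 7\<close> are the coordinates of \<open>x\<close>.
  A \<open>k\<close>-form at a point is a function on lists of vectors that is multilinear and alternating on
  lists of length \<open>k\<close> and vanishes on all other lists, so that equality of forms is equality of
  functions. All manifolds below are \<open>\<real>\<^sup>7\<close> with its global chart, so a \<open>k\<close>-form on the manifold is a
  function \<open>real^7 \<Rightarrow> form\<close>.
\<close>

type_synonym form = "(real^7) list \<Rightarrow> real"

definition is_form :: "nat \<Rightarrow> form \<Rightarrow> bool" where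
  "is_form k \<alpha> \<longleftrightarrow>
     (\<forall>vs. length vs \<noteq> k \<longrightarrow> \<alpha> vs = 0) \<and>
     (\<forall>us ws. length us + length ws + 1 = k \<longrightarrow> linear (\<lambda>v. \<alpha> (us @ v # ws))) \<and>
     (\<forall>us v ws xs. \<alpha> (us @ v # ws @ v # xs) = 0)"

text \<open>\<open>e [i\<^sub>1, \<dots>, i\<^sub>k]\<close> is \<open>e\<^sup>i\<^sup>1 \<and> \<dots> \<and> e\<^sup>i\<^sup>k\<close>, where \<open>(e\<^sup>i)\<close> is dual to the standard basis.\<close>

definition e :: "7 list \<Rightarrow> form" where
  "e is' = (\<lambda>vs. if length vs = length is'
     then \<Sum>\<sigma> | \<sigma> permutes {..<length is'}.
            of_int (sign \<sigma>) * (\<Prod>m<length is'. vs ! \<sigma> m $ (is' ! m))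
     else 0)"

definition wedge :: "nat \<Rightarrow> nat \<Rightarrow> form \<Rightarrow> form \<Rightarrow> form" where
  "wedge k l \<alpha> \<beta> = (\<lambda>vs. if length vs = k + l
     then (\<Sum>\<sigma> | \<sigma> permutes {..<k + l}. of_int (sign \<sigma>) *
             \<alpha> (take k (permute_list \<sigma> vs)) * \<beta> (drop k (permute_list \<sigma> vs))) / (fact k * fact l)
     else 0)"

definition interior_product :: "real^7 \<Rightarrow> form \<Rightarrow> form" where
  "interior_product v \<alpha> = (\<lambda>vs. \<alpha> (v # vs))"

definition ext_deriv :: "(real^7 \<Rightarrow> form) \<Rightarrow> real^7 \<Rightarrow> form" where
  "ext_deriv \<omega> = (\<lambda>p vs. \<Sum>i<length vs. (-1)^i *
     frechet_derivative (\<lambda>q. \<omega> q (take i vs @ drop (Suc i) vs)) (at p) (vs ! i))"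

text \<open>
  The Leibniz formula for \<open>L\<^sub>X\<close>, evaluated on constant vector fields \<open>v\<close>; these satisfy
  \<open>[X, v] = - D\<^sub>v X\<close>.
\<close>

definition lie_deriv :: "(real^7 \<Rightarrow> real^7) \<Rightarrow> (real^7 \<Rightarrow> form) \<Rightarrow> real^7 \<Rightarrow> form" where
  "lie_deriv X \<omega> = (\<lambda>p vs. frechet_derivative (\<lambda>q. \<omega> q vs) (at p) (X p) +
     (\<Sum>i<length vs. \<omega> p (vs[i := frechet_derivative X (at p) (vs ! i)])))"

primrec C_k :: "nat \<Rightarrow> (real^7 \<Rightarrow> real) \<Rightarrow> bool" where
  "C_k 0 f \<longleftrightarrow> continuous_on UNIV f"
| "C_k (Suc k) f \<longleftrightarrow> f differentiable_on UNIV \<and>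
     (\<forall>i. C_k k (\<lambda>p. frechet_derivative f (at p) (axis i 1)))"

definition smooth_fun :: "(real^7 \<Rightarrow> real) \<Rightarrow> bool" where
  "smooth_fun f \<longleftrightarrow> (\<forall>k. C_k k f)"

definition complete_field :: "(real^7 \<Rightarrow> real^7) \<Rightarrow> bool" where
  "complete_field X \<longleftrightarrow>
     (\<forall>p. \<exists>\<gamma>::real \<Rightarrow> real^7. \<gamma> 0 = p \<and> (\<forall>t. (\<gamma> has_vector_derivative X (\<gamma> t)) (at t)))"


section \<open>\<open>G\<^sub>2\<close>-structures and gradient Laplacian solitons\<close>

definition act :: "(real^7 \<Rightarrow> real^7) \<Rightarrow> form \<Rightarrow> form" where
  "act h \<psi> = (\<lambda>vs. \<psi> (map (inv h) vs))"

definition g2_model :: form where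
  "g2_model = (\<lambda>vs. e [1,2,7] vs + e [3,4,7] vs + e [5,6,7] vs + e [1,3,5] vs
     - e [1,4,6] vs - e [2,3,6] vs - e [2,4,5] vs)"

text \<open>Here the adapted basis is the image under \<open>h\<close> of the standard one.\<close>

definition is_g2_form :: "form \<Rightarrow> bool" where
  "is_g2_form \<phi> \<longleftrightarrow> (\<exists>h. linear h \<and> bij h \<and> \<phi> = act h g2_model)"

definition inner_product :: "(real^7 \<Rightarrow> real^7 \<Rightarrow> real) \<Rightarrow> bool" where
  "inner_product g \<longleftrightarrow> bilinear g \<and> (\<forall>x y. g x y = g y x) \<and> (\<forall>x. x \<noteq> 0 \<longrightarrow> g x x > 0)"

definition orthonormal_basis :: "(real^7 \<Rightarrow> real^7 \<Rightarrow> real) \<Rightarrow> (7 \<Rightarrow> real^7) \<Rightarrow> bool" where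
  "orthonormal_basis g b \<longleftrightarrow> (\<forall>i j. g (b i) (b j) = (if i = j then 1 else 0))"

definition volume_form :: "(real^7 \<Rightarrow> real^7 \<Rightarrow> real) \<Rightarrow> form \<Rightarrow> bool" where
  "volume_form g vol \<longleftrightarrow> is_form 7 vol \<and>
     (\<forall>b. orthonormal_basis g b \<longrightarrow> \<bar>vol (map b [1,2,3,4,5,6,7])\<bar> = 1)"

text \<open>
  \<open>\<phi>\<close> determines \<open>g\<close> and \<open>vol\<close> uniquely: the equation leaves only the freedom
  \<open>(g, vol) \<leadsto> (g / t, t vol)\<close>, and then \<open>t = 1\<close> because both pairs consist of an inner product and
  one of its two volume forms.
\<close>

definition g2_induces :: "form \<Rightarrow> (real^7 \<Rightarrow> real^7 \<Rightarrow> real) \<Rightarrow> form \<Rightarrow> bool" where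
  "g2_induces \<phi> g vol \<longleftrightarrow> inner_product g \<and> volume_form g vol \<and>
     (\<forall>X Y vs. g X Y * vol vs = 1/6 *
        wedge 4 3 (wedge 2 2 (interior_product X \<phi>) (interior_product Y \<phi>)) \<phi> vs)"

definition g2_metric :: "form \<Rightarrow> real^7 \<Rightarrow> real^7 \<Rightarrow> real" where
  "g2_metric \<phi> = (THE g. \<exists>vol. g2_induces \<phi> g vol)"

definition g2_vol :: "form \<Rightarrow> form" where
  "g2_vol \<phi> = (THE vol. \<exists>g. g2_induces \<phi> g vol)"

text \<open>
  Hodge star on \<open>k\<close>-forms, normalised by \<open>\<alpha> \<and> *\<beta> = \<langle>\<alpha>,\<beta>\<rangle> vol\<close>: for an oriented orthonormal basis,
  \<open>*(b\<^sup>1 \<and> \<dots> \<and> b\<^sup>k) = b\<^sup>k\<^sup>+\<^sup>1 \<and> \<dots> \<and> b\<^sup>7\<close>. The contraction does not depend on the chosen orthonormal basis.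
\<close>

definition hodge :: "(real^7 \<Rightarrow> real^7 \<Rightarrow> real) \<Rightarrow> form \<Rightarrow> nat \<Rightarrow> form \<Rightarrow> form" where
  "hodge g vol k \<alpha> = (\<lambda>vs. let b = (SOME b. orthonormal_basis g b) in
     (\<Sum>I | length I = k. \<alpha> (map b I) * vol (map b I @ vs)) / fact k)"

definition g2_structure :: "(real^7 \<Rightarrow> form) \<Rightarrow> bool" where
  "g2_structure \<phi> \<longleftrightarrow> (\<forall>p. is_g2_form (\<phi> p)) \<and> (\<forall>vs. smooth_fun (\<lambda>p. \<phi> p vs))"

definition star :: "(real^7 \<Rightarrow> form) \<Rightarrow> nat \<Rightarrow> (real^7 \<Rightarrow> form) \<Rightarrow> real^7 \<Rightarrow> form" where
  "star \<phi> k \<omega> = (\<lambda>p. hodge (g2_metric (\<phi> p)) (g2_vol (\<phi> p)) k (\<omega> p))"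

definition hodge_laplacian :: "(real^7 \<Rightarrow> form) \<Rightarrow> (real^7 \<Rightarrow> form) \<Rightarrow> real^7 \<Rightarrow> form" where
  "hodge_laplacian \<phi> \<omega> = (\<lambda>p vs.
     star \<phi> 4 (ext_deriv (star \<phi> 4 (ext_deriv \<omega>))) p vs -
     ext_deriv (star \<phi> 5 (ext_deriv (star \<phi> 3 \<omega>))) p vs)"

definition gradient :: "(real^7 \<Rightarrow> form) \<Rightarrow> (real^7 \<Rightarrow> real) \<Rightarrow> real^7 \<Rightarrow> real^7" where
  "gradient \<phi> f = (\<lambda>p. THE u. \<forall>v. g2_metric (\<phi> p) u v = frechet_derivative f (at p) v)"

definition gradient_laplacian_soliton ::
    "(real^7 \<Rightarrow> form) \<Rightarrow> (real^7 \<Rightarrow> real) \<Rightarrow> real \<Rightarrow> bool" where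
  "gradient_laplacian_soliton \<phi> f lam \<longleftrightarrow>
     g2_structure \<phi> \<and> smooth_fun f \<and> complete_field (gradient \<phi> f) \<and>
     (\<forall>p vs. hodge_laplacian \<phi> \<phi> p vs = lam * \<phi> p vs + lie_deriv (gradient \<phi> f) \<phi> p vs)"


section \<open>Nilpotent Lie algebras and their simply connected groups\<close>

type_synonym bracket = "real^7 \<Rightarrow> real^7 \<Rightarrow> real^7"

text \<open>An entry \<open>(i, j, k, a)\<close> stands for \<open>[e\<^sub>i, e\<^sub>j] = a e\<^sub>k\<close> and \<open>[e\<^sub>j, e\<^sub>i] = - a e\<^sub>k\<close>.\<close>

definition bracket_of :: "(7 \<times> 7 \<times> 7 \<times> real) list \<Rightarrow> bracket" where
  "bracket_of cs x y =
     (\<Sum>(i, j, k, a)\<leftarrow>cs. (a * (x $ i * y $ j - x $ j * y $ i)) *\<^sub>R axis k 1)"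

definition equivalent :: "bracket \<Rightarrow> form \<Rightarrow> bracket \<Rightarrow> form \<Rightarrow> bool" where
  "equivalent \<mu>\<^sub>1 \<psi>\<^sub>1 \<mu>\<^sub>2 \<psi>\<^sub>2 \<longleftrightarrow>
     (\<exists>h. linear h \<and> bij h \<and> (\<forall>x y. h (\<mu>\<^sub>1 x y) = \<mu>\<^sub>2 (h x) (h y)) \<and> act h \<psi>\<^sub>1 = \<psi>\<^sub>2)"

definition homothetic :: "bracket \<Rightarrow> form \<Rightarrow> bracket \<Rightarrow> form \<Rightarrow> bool" where
  "homothetic \<mu>\<^sub>1 \<psi>\<^sub>1 \<mu>\<^sub>2 \<psi>\<^sub>2 \<longleftrightarrow> (\<exists>c. c \<noteq> 0 \<and> equivalent \<mu>\<^sub>1 \<psi>\<^sub>1 \<mu>\<^sub>2 (\<lambda>vs. c * \<psi>\<^sub>2 vs))"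

text \<open>
  For a nilpotent Lie algebra, \<open>exp\<close> is a diffeomorphism onto the simply connected group, which is
  therefore \<open>\<real>\<^sup>7\<close> with the Baker--Campbell--Hausdorff product. All algebras below are at most 3-step
  nilpotent, so that the series stops at the terms of degree 3.
\<close>

definition bch :: "bracket \<Rightarrow> real^7 \<Rightarrow> real^7 \<Rightarrow> real^7" where
  "bch \<mu> x y = x + y + (1/2) *\<^sub>R \<mu> x y + (1/12) *\<^sub>R (\<mu> x (\<mu> x y) + \<mu> y (\<mu> y x))"

text \<open>
  The left-invariant form with value \<open>\<psi>\<close> at the identity \<open>0\<close>, that is, the pullback of \<open>\<psi>\<close> at \<open>p\<close>
  along left translation by the inverse \<open>- p\<close> of \<open>p\<close>.
\<close>

definition left_invariant :: "bracket \<Rightarrow> form \<Rightarrow> real^7 \<Rightarrow> form" where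
  "left_invariant \<mu> \<psi> = (\<lambda>p vs. \<psi> (map (frechet_derivative (bch \<mu> (- p)) (at p)) vs))"

definition n1 :: bracket where "n1 = bracket_of []"

definition n2 :: bracket where "n2 = bracket_of [(1,2,5,-1), (1,3,6,-1)]"

definition n3 :: "real \<Rightarrow> bracket" where
  "n3 c = bracket_of [(1,2,4,-1), (1,3,5,-(1-c)), (2,3,6,-c)]"

definition n4 :: bracket where
  "n4 = bracket_of [(1,2,3,-sqrt 2), (1,3,6,-1), (2,4,6,-sqrt 2), (1,5,7,-1)]"

definition n5 :: bracket where
  "n5 = bracket_of [(1,2,3,-sqrt 2), (1,3,6,-1), (1,4,7,-1), (2,5,7,-sqrt 2)]"

definition n6 :: bracket where
  "n6 = bracket_of [(1,2,4,-sqrt 2), (1,3,5,-sqrt 2), (1,4,6,-1), (1,5,7,-1)]"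

definition n7 :: bracket where
  "n7 = bracket_of [(1,2,4,4), (2,7,5,-2), (1,7,6,-2), (5,7,3,-sqrt 6), (6,7,4,-sqrt 6)]"

definition phi2 :: form where
  "phi2 = (\<lambda>vs. e [1,4,7] vs + e [2,6,7] vs + e [3,5,7] vs + e [1,2,3] vs
     + e [1,5,6] vs + e [2,4,5] vs - e [3,4,6] vs)"

definition phi3 :: form where
  "phi3 = (\<lambda>vs. e [1,2,3] vs + e [1,4,5] vs + e [1,6,7] vs + e [2,4,6] vs
     - e [2,5,7] vs - e [3,4,7] vs - e [3,5,6] vs)"

definition phi4 :: form where
  "phi4 = (\<lambda>vs. - e [1,2,4] vs - e [4,5,6] vs + e [3,4,7] vs + e [1,3,5] vs
     + e [1,6,7] vs + e [2,5,7] vs - e [2,3,6] vs)"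

definition phi5 :: form where
  "phi5 = (\<lambda>vs. - e [1,2,5] vs + e [1,3,4] vs + e [1,6,7] vs - e [2,3,7] vs
     - e [2,4,6] vs - e [3,5,6] vs + e [4,5,7] vs)"

definition phi6 :: form where
  "phi6 = (\<lambda>vs. e [1,2,3] vs + e [1,4,5] vs + e [1,6,7] vs + e [2,5,7] vs
     - e [2,4,6] vs + e [3,4,7] vs + e [3,5,6] vs)"

definition phi7 :: form where
  "phi7 = (\<lambda>vs. e [1,2,7] vs + e [3,4,7] vs + e [5,6,7] vs + e [1,3,5] vs
     - e [1,4,6] vs - e [2,3,6] vs - e [2,4,5] vs)"

definition gaussian ::
    "(real^7 \<Rightarrow> real^7 \<Rightarrow> real) \<Rightarrow> (real^7 \<Rightarrow> real) \<Rightarrow> real \<Rightarrow> bool" where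
  "gaussian g f lam \<longleftrightarrow> (\<exists>b. orthonormal_basis g b \<and> (\<exists>\<alpha> \<beta>. \<forall>x::real^7.
     f (\<Sum>i\<in>UNIV. x $ i *\<^sub>R b i) = - (lam/6) * (norm x)\<^sup>2 - (\<Sum>i\<in>UNIV. \<alpha> i * x $ i) - \<beta>))"


section \<open>The Baker--Campbell--Hausdorff product is a group with the given Lie algebra\<close>

text \<open>
  These facts justify \<open>bch\<close> and \<open>left_invariant\<close>: the product is a group law, the left-invariant
  vector fields bracket like \<open>\<mu>\<close>, and \<open>left_invariant \<mu> \<psi>\<close> has constant coefficients on them.
\<close>

locale three_step =
  fixes \<mu> :: bracket
  assumes bil: "bilinear \<mu>"
    and alt: "\<mu> x x = 0"
    and jacobi: "\<mu> x (\<mu> y z) + \<mu> y (\<mu> z x) + \<mu> z (\<mu> x y) = 0"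
    and nil: "\<mu> w (\<mu> x (\<mu> y z)) = 0"
begin

lemmas bil_simps =
  bilinear_ladd[OF bil] bilinear_radd[OF bil] bilinear_lmul[OF bil] bilinear_rmul[OF bil]
  bilinear_lneg[OF bil] bilinear_rneg[OF bil] bilinear_lsub[OF bil] bilinear_rsub[OF bil]
  bilinear_lzero[OF bil] bilinear_rzero[OF bil]

lemma anti: "\<mu> x y = - \<mu> y x"
proof -
  have "\<mu> (x + y) (x + y) = \<mu> x y + \<mu> y x"
    unfolding bil_simps by (simp add: alt)
  then show ?thesis by (simp add: alt eq_neg_iff_add_eq_0)
qed

lemma nil2: "\<mu> (\<mu> a b) (\<mu> c d) = 0"
proof -
  have "\<mu> c (\<mu> d (\<mu> a b)) = 0" "\<mu> d (\<mu> (\<mu> a b) c) = 0"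
    using nil anti[of "\<mu> a b" c] by (simp_all add: bilinear_rneg[OF bil])
  then show ?thesis using jacobi[of "\<mu> a b" c d] by simp
qed

lemma bch_assoc: "bch \<mu> (bch \<mu> x y) z = bch \<mu> x (bch \<mu> y z)"
proof -
  have L: "\<mu> (\<mu> a b) x = - \<mu> x (\<mu> a b)" "\<mu> (\<mu> a b) y = - \<mu> y (\<mu> a b)"
    "\<mu> (\<mu> a b) z = - \<mu> z (\<mu> a b)" for a b by (rule anti)+
  have nil3: "\<mu> (\<mu> a (\<mu> b c)) d = 0" for a b c d
    using anti[of "\<mu> a (\<mu> b c)" d] nil by simp
  have J: "\<mu> z (\<mu> x y) = \<mu> y (\<mu> x z) - \<mu> x (\<mu> y z)"
    using jacobi[of x y z] anti[of z x]
    by (simp add: bilinear_rneg[OF bil] add_eq_0_iff algebra_simps)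
  have "bch \<mu> (bch \<mu> x y) z $ i = bch \<mu> x (bch \<mu> y z) $ i" for i
    unfolding bch_def
    by (simp add: bil_simps nil nil2 nil3 L J alt anti[of y x] anti[of z x] anti[of z y]
        field_simps)
  then show ?thesis by (simp add: vec_eq_iff)
qed

lemma bch_unit: "bch \<mu> 0 x = x" "bch \<mu> x 0 = x"
  by (simp_all add: bch_def bil_simps)

lemma bch_inverse: "bch \<mu> (- x) x = 0" "bch \<mu> x (- x) = 0"
  by (simp_all add: bch_def bil_simps alt)

lemma has_derivative_mu [derivative_intros]:
  assumes "(f has_derivative f') (at p)" "(g has_derivative g') (at p)"
  shows "((\<lambda>q. \<mu> (f q) (g q)) has_derivative (\<lambda>v. \<mu> (f p) (g' v) + \<mu> (f' v) (g p))) (at p)"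
  using bounded_bilinear.FDERIV[OF _ assms] bil bilinear_conv_bounded_bilinear by blast

definition left_field :: "real^7 \<Rightarrow> real^7 \<Rightarrow> real^7" where
  "left_field x p = frechet_derivative (bch \<mu> p) (at 0) x"

lemma left_field: "left_field x p = x + (1/2) *\<^sub>R \<mu> p x + (1/12) *\<^sub>R \<mu> p (\<mu> p x)"
proof -
  have "(bch \<mu> p has_derivative
      (\<lambda>v. v + (1/2) *\<^sub>R \<mu> p v + (1/12) *\<^sub>R \<mu> p (\<mu> p v))) (at 0)"
    unfolding bch_def by (auto intro!: derivative_eq_intros simp: bil_simps)
  then show ?thesis
    unfolding left_field_def by (simp add: frechet_derivative_at[symmetric])
qed

lemma left_invariant_left_field: "left_invariant \<mu> \<psi> p (map (\<lambda>x. left_field x p) xs) = \<psi> xs"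
proof -
  have "(bch \<mu> (- p) has_derivative
      (\<lambda>v. v - (1/2) *\<^sub>R \<mu> p v + (1/6) *\<^sub>R \<mu> p (\<mu> p v))) (at p)"
    unfolding bch_def
    by (auto intro!: derivative_eq_intros simp: bil_simps alt anti[of _ p] scaleR_add_left[symmetric])
  then have D: "frechet_derivative (bch \<mu> (- p)) (at p) =
      (\<lambda>v. v - (1/2) *\<^sub>R \<mu> p v + (1/6) *\<^sub>R \<mu> p (\<mu> p v))"
    by (simp add: frechet_derivative_at[symmetric])
  have "frechet_derivative (bch \<mu> (- p)) (at p) (left_field x p) = x" for x
    unfolding D left_field by (simp add: bil_simps nil vec_eq_iff field_simps)
  then show ?thesis by (simp add: left_invariant_def comp_def)
qed

lemma left_field_commutator:
  "frechet_derivative (left_field y) (at p) (left_field x p) -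
   frechet_derivative (left_field x) (at p) (left_field y p) = left_field (\<mu> x y) p"
proof -
  have "(left_field x has_derivative
      (\<lambda>v. (1/2) *\<^sub>R \<mu> v x + (1/12) *\<^sub>R (\<mu> p (\<mu> v x) + \<mu> v (\<mu> p x)))) (at p)" for x
    unfolding left_field[abs_def] by (auto intro!: derivative_eq_intros simp: bil_simps)
  then have D: "frechet_derivative (left_field x) (at p) =
      (\<lambda>v. (1/2) *\<^sub>R \<mu> v x + (1/12) *\<^sub>R (\<mu> p (\<mu> v x) + \<mu> v (\<mu> p x)))" for x
    by (simp add: frechet_derivative_at[symmetric])
  have L: "\<mu> (\<mu> a b) x = - \<mu> x (\<mu> a b)" "\<mu> (\<mu> a b) y = - \<mu> y (\<mu> a b)" for a b
    by (rule anti)+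
  have nil3: "\<mu> (\<mu> a (\<mu> b c)) d = 0" for a b c d
    using anti[of "\<mu> a (\<mu> b c)" d] nil by simp
  have J: "\<mu> y (\<mu> p x) = \<mu> x (\<mu> p y) - \<mu> p (\<mu> x y)"
    using jacobi[of y p x] anti[of x y] anti[of y p]
    by (simp add: bilinear_rneg[OF bil] add_eq_0_iff algebra_simps)
  show ?thesis
    unfolding D left_field
    by (simp add: vec_eq_iff bil_simps nil nil2 nil3 L J alt anti[of y x] field_simps)
qed

end

lemma exhaust_7: fixes x :: 7 shows "x = 1 \<or> x = 2 \<or> x = 3 \<or> x = 4 \<or> x = 5 \<or> x = 6 \<or> x = 7"
proof (induct x)
  case (of_int z)
  then have "z = 0 \<or> z = 1 \<or> z = 2 \<or> z = 3 \<or> z = 4 \<or> z = 5 \<or> z = 6" by simp arith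
  then show ?case by auto
qed

lemma forall_7: "(\<forall>i::7. P i) \<longleftrightarrow> P 1 \<and> P 2 \<and> P 3 \<and> P 4 \<and> P 5 \<and> P 6 \<and> P 7"
  by (metis exhaust_7)

lemma bilinear_bracket_of: "bilinear (bracket_of cs)"
proof -
  have "bounded_linear (\<lambda>x::real^7. (a * (x $ i * y $ j - x $ j * y $ i)) *\<^sub>R (axis k 1 :: real^7))"
    "bounded_linear (\<lambda>y::real^7. (a * (x $ i * y $ j - x $ j * y $ i)) *\<^sub>R (axis k 1 :: real^7))" for a i j k x y
    by (auto intro!: bounded_linear_intros)
  then have "linear (\<lambda>x. bracket_of cs x y)" "linear (\<lambda>y. bracket_of cs x y)" for x y
    unfolding bracket_of_def
    by (induction cs; force intro!: linear_compose_add module_hom_zero simp: bounded_linear.linear)+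
  then show ?thesis by (simp add: bilinear_def)
qed

lemma three_step_algebras:
  "three_step n1" "three_step n2" "three_step (n3 c)" "three_step n4" "three_step n5"
  "three_step n6" "three_step n7"
  by (simp_all add: three_step_def bilinear_bracket_of vec_eq_iff forall_7 bracket_of_def axis_def
      n1_def n2_def n3_def n4_def n5_def n6_def n7_def field_simps)

end

theory Submission
  imports Defs
begin

text \<open>
  The left-invariant structure \<open>\<psi>\<close> is written in a left-invariant coframe \<open>\<Phi>\<close> adapted to it, so that
  \<open>\<psi>\<close> has the coefficients of the model form \<open>g2_model\<close> at every point, and only the bracket \<open>\<nu>\<close> in this
  coframe distinguishes the groups (locale \<open>coframe\<close>). Metric, Hodge star, exterior derivative and
  Laplacian of invariant forms then become algebra on one vector space: the metric is the standard
  one (\<open>g2_metric_pullback\<close>), the exterior derivative is the Chevalley--Eilenberg differential \<open>ce \<nu>\<close>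
  (\<open>ext_deriv_invariant\<close>), and \<open>\<Delta>\<psi>\<close> has constant coefficients (\<open>hodge_laplacian_invariant\<close>). The Lie
  derivative along \<open>\<nabla>f\<close> acts on the coefficients of \<open>\<psi>\<close> through an endomorphism \<open>deformation f p\<close>
  whose symmetric part is the Hessian of \<open>f\<close> (\<open>lie_deriv_invariant\<close>).

  The soliton equation therefore prescribes the action of \<open>deformation f p\<close> on the model form
  independently of \<open>p\<close>. Endomorphisms annihilating the model form are skew
  (\<open>g2_stabilizer_skew\<close>), so the Hessian of \<open>f\<close> has constant coefficients in the frame. If \<open>e\<^sub>z\<close> is
  central and \<open>[e\<^sub>x, e\<^sub>y]\<close> has a component along \<open>e\<^sub>z\<close>, commuting third derivatives of \<open>f\<close> forces the
  frame derivatives of \<open>f\<close> along \<open>e\<^sub>x\<close> and \<open>e\<^sub>y\<close> to be constant (\<open>frame_gradient_constant\<close>); then the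
  derivative along \<open>[e\<^sub>x, e\<^sub>y]\<close> vanishes. This covers all directions used below.

  The seven monomials of the model form are the lines of a Fano plane. Two lines meet in one point,
  so the coefficient of \<open>L\<^bsub>\<nabla>f\<^esub> \<psi>\<close> on a line involves only diagonal entries of the deformation,
  which vanish along directions where the frame derivative of \<open>f\<close> is constant. On such a line the
  soliton equation reads \<open>\<Delta>\<psi> = \<lambda> \<psi>\<close> (\<open>laplacian_on_line\<close>). Each of the non-abelian algebras has two
  such lines: one spanned by commuting vectors, where \<open>\<Delta>\<psi> = 0\<close> and hence \<open>\<lambda> = 0\<close>, and one where
  \<open>\<Delta>\<psi> \<noteq> 0\<close>, a contradiction. A homothety only rescales the bracket, which does not affect this.

  On the abelian algebra \<open>\<Delta>\<psi> = 0\<close>, and the same linear algebra gives \<open>Hess f = - \<lambda>/3 g\<close>;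
  integrating twice shows that \<open>f\<close> is a Gaussian.
\<close>

section \<open>Alternating functions of lists\<close>

text \<open>
  Antisymmetry is imposed on adjacent entries only: these transpositions generate all permutations,
  and they are visible in a concrete list.
\<close>

definition alternating :: "('a list \<Rightarrow> real) \<Rightarrow> bool" where
  "alternating F \<longleftrightarrow> (\<forall>us x y ws. F (us @ x # y # ws) = - F (us @ y # x # ws))"

lemma alternatingD: "alternating F \<Longrightarrow> F (us @ x # y # ws) = - F (us @ y # x # ws)"
  unfolding alternating_def by blast

lemma alternating_Cons: "alternating F \<Longrightarrow> alternating (\<lambda>xs. F (x # xs))"
  unfolding alternating_def by (metis append_Cons)

lemma alternating_append: "alternating F \<Longrightarrow> alternating (\<lambda>xs. F (us @ xs))"
  unfolding alternating_def by (metis append_assoc)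

lemma alternating_map_append: "alternating F \<Longrightarrow> alternating (\<lambda>xs. F (map b xs @ ws))"
  unfolding alternating_def map_append list.map append_assoc append_Cons by blast

lemma alternating_map: "alternating F \<Longrightarrow> alternating (\<lambda>xs. F (map b xs))"
  unfolding alternating_def map_append list.map by blast

lemma alternating_move:
  assumes "alternating F"
  shows "F (us @ x # ws) = (-1) ^ length us * F (x # us @ ws)"
proof (induction us arbitrary: ws rule: rev_induct)
  case (snoc a us)
  then show ?case using alternatingD[OF assms, of us a x ws] by simp
qed simp

lemma alternating_repeat:
  assumes "alternating F"
  shows "F (us @ v # ws @ v # xs) = 0"
proof -
  have "alternating (\<lambda>l. F ((us @ [v]) @ l))" by (rule alternating_append[OF assms])
  from alternating_move[OF this, of ws v xs] alternatingD[OF assms, of us v v "ws @ xs"]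
  show ?thesis by simp
qed

lemma alternating_not_distinct: "alternating F \<Longrightarrow> \<not> distinct xs \<Longrightarrow> F xs = 0"
  by (metis alternating_repeat append.assoc append_Cons append_Nil not_distinct_decomp)

text \<open>
  A permutation of the arguments multiplies both factors by the same sign. This identifies the equal
  terms in a contraction of two forms.
\<close>

lemma alternating_mset_product:
  assumes "alternating F" "alternating G" "mset xs = mset ys"
  shows "F xs * G xs = F ys * G ys"
  using assms
proof (induction xs arbitrary: F G ys)
  case (Cons x xs)
  then have "x \<in> set ys" by (metis list.set_intros(1) mset_eq_setD)
  then obtain us ws where ys: "ys = us @ x # ws" by (meson split_list)
  then have m: "mset xs = mset (us @ ws)" using Cons.prems by simp
  have "F ys * G ys = ((-1) ^ length us * (-1) ^ length us) * (F (x # us @ ws) * G (x # us @ ws))"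
    unfolding ys alternating_move[OF Cons.prems(1), of us] alternating_move[OF Cons.prems(2), of us]
    by (simp only: ac_simps)
  also have "((-1) ^ length us * (-1) ^ length us) = (1::real)"
    by (simp flip: power_add)
  finally show ?case
    using Cons.IH[OF alternating_Cons[OF Cons.prems(1)] alternating_Cons[OF Cons.prems(2)] m] by simp
qed simp

fun inversions :: "'a::linorder list \<Rightarrow> nat" where
  "inversions [] = 0"
| "inversions (x # xs) = length (filter (\<lambda>y. y < x) xs) + inversions xs"

lemma alternating_insort:
  fixes x :: "'a::linorder"
  assumes "alternating F" "sorted ys"
  shows "F (x # ys) = (-1) ^ length (filter (\<lambda>y. y < x) ys) * F (insort x ys)"
  using assms
proof (induction ys arbitrary: F)
  case (Cons y ys)
  show ?case
  proof (cases "x \<le> y")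
    case True
    then have "filter (\<lambda>z. z < x) (y # ys) = []"
      using Cons.prems(2) by (force simp: filter_empty_conv)
    then have "length (filter (\<lambda>z. z < x) (y # ys)) = 0" by simp
    then show ?thesis using True by (simp del: filter.simps)
  next
    case False
    have "F (x # y # ys) = - F (y # x # ys)"
      using alternatingD[OF Cons.prems(1), of "[]" x y ys] by simp
    also have "F (y # x # ys) = (-1) ^ length (filter (\<lambda>z. z < x) ys) * F (y # insort x ys)"
      using Cons.IH[OF alternating_Cons[OF Cons.prems(1), of y]] Cons.prems(2) by simp
    finally show ?thesis using False by simp
  qed
qed simp

text \<open>
  Insertion sort: an entry passes the smaller entries behind it, at the cost of one sign each. With
  this rule the value of a form on basis vectors in any order is found by computation.
\<close>

lemma alternating_sort:
  fixes xs :: "'a::linorder list"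
  assumes "alternating F"
  shows "F xs = (-1) ^ inversions xs * F (sort xs)"
  using assms
proof (induction xs arbitrary: F)
  case (Cons x xs)
  have "length (filter (\<lambda>y. y < x) (sort xs)) = length (filter (\<lambda>y. y < x) xs)"
    by (simp add: filter_sort)
  then show ?case
    using Cons.IH[OF alternating_Cons[OF Cons.prems, of x]]
      alternating_insort[OF Cons.prems, of "sort xs" x]
    by (simp add: power_add)
qed simp

section \<open>Exterior forms\<close>

lemma is_form_linear:
  "is_form k \<alpha> \<Longrightarrow> length us + length ws + 1 = k \<Longrightarrow> linear (\<lambda>v. \<alpha> (us @ v # ws))"
  by (simp add: is_form_def)

lemma is_form_length: "is_form k \<alpha> \<Longrightarrow> length vs \<noteq> k \<Longrightarrow> \<alpha> vs = 0"
  by (simp add: is_form_def)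

lemma is_form_alternating:
  assumes "is_form k \<alpha>"
  shows "alternating \<alpha>"
  unfolding alternating_def
proof (intro allI)
  fix us x y ws
  show "\<alpha> (us @ x # y # ws) = - \<alpha> (us @ y # x # ws)"
  proof (cases "length us + length ws + 2 = k")
    case True
    have rep: "\<alpha> (us @ v # v # ws) = 0" for v
      using assms append_Nil[of "v # ws"] unfolding is_form_def by metis
    have l1: "linear (\<lambda>v. \<alpha> (us @ v # w # ws))" for w
      using assms True is_form_linear[of k \<alpha> us "w # ws"] by simp
    have l2: "linear (\<lambda>v. \<alpha> (us @ w # v # ws))" for w
      using assms True is_form_linear[of k \<alpha> "us @ [w]" ws] by simp
    show ?thesis
      using rep[of "x + y"] rep[of x] rep[of y]
      by (simp add: linear_add[OF l1] linear_add[OF l2])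
  qed (use assms in \<open>simp add: is_form_def\<close>)
qed

lemma is_formI:
  assumes "\<And>vs. length vs \<noteq> k \<Longrightarrow> \<alpha> vs = 0" "alternating \<alpha>"
    "\<And>us ws. length us + length ws + 1 = k \<Longrightarrow> linear (\<lambda>v. \<alpha> (us @ v # ws))"
  shows "is_form k \<alpha>"
  using assms alternating_repeat[OF assms(2)] by (simp add: is_form_def)

lemma is_form_Cons: "is_form (Suc k) \<alpha> \<Longrightarrow> is_form k (\<lambda>vs. \<alpha> (x # vs))"
  by (intro is_formI)
    (use is_form_linear[of "Suc k" \<alpha> "x # _"] in
      \<open>auto simp: is_form_length intro: alternating_Cons is_form_alternating\<close>)

lemma is_form_zero: "is_form k (\<lambda>vs. 0)"
  by (auto simp: is_form_def linear_iff)

lemma is_form_add: "is_form k \<alpha> \<Longrightarrow> is_form k \<beta> \<Longrightarrow> is_form k (\<lambda>vs. \<alpha> vs + \<beta> vs)"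
  by (auto simp: is_form_def intro!: linear_compose_add)

lemma is_form_minus: "is_form k \<alpha> \<Longrightarrow> is_form k (\<lambda>vs. - \<alpha> vs)"
  by (auto simp: is_form_def intro!: linear_compose_neg)

lemma is_form_diff: "is_form k \<alpha> \<Longrightarrow> is_form k \<beta> \<Longrightarrow> is_form k (\<lambda>vs. \<alpha> vs - \<beta> vs)"
  by (auto simp: is_form_def intro!: linear_compose_sub)

lemma sum_axis: "(\<Sum>i\<in>UNIV. x $ i *\<^sub>R axis i 1) = (x :: real^'n)"
  by (simp add: vec_eq_iff axis_def if_distrib[of "\<lambda>t. _ * t"] cong: if_cong)

lemma linear_vec_expand:
  fixes f :: "real^'n \<Rightarrow> 'a::real_vector"
  assumes "linear f"
  shows "f v = (\<Sum>i\<in>UNIV. v $ i *\<^sub>R f (axis i 1))"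
proof -
  have "f (\<Sum>i\<in>UNIV. v $ i *\<^sub>R axis i 1) = (\<Sum>i\<in>UNIV. v $ i *\<^sub>R f (axis i 1))"
    unfolding linear_sum[OF assms] linear_cmul[OF assms] by simp
  then show ?thesis by (simp only: sum_axis)
qed

lemma linear_axis_expand:
  fixes f :: "real^'n \<Rightarrow> real"
  assumes "linear f"
  shows "f v = (\<Sum>i\<in>UNIV. v $ i * f (axis i 1))"
  using linear_vec_expand[OF assms, of v] by simp

lemma is_form_interior:
  assumes "is_form k \<alpha>"
  shows "is_form (k - 1) (\<lambda>vs. \<alpha> (v # vs))"
proof (cases k)
  case 0
  then have "(\<lambda>vs. \<alpha> (v # vs)) = (\<lambda>vs. 0)" using is_form_length[OF assms] by auto
  then show ?thesis using is_form_zero by simp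
qed (use is_form_Cons assms in auto)

text \<open>
  On lists of the wrong length a form vanishes, so it is linear there as well; this removes length
  conditions from everything that follows.
\<close>

lemma is_form_linear_weak:
  assumes "is_form k \<alpha>"
  shows "linear (\<lambda>v. \<alpha> (us @ v # ws))"
proof (cases "length us + length ws + 1 = k")
  case False
  then have "(\<lambda>v. \<alpha> (us @ v # ws)) = (\<lambda>v. 0)" using is_form_length[OF assms] by auto
  then show ?thesis by (simp add: linear_zero)
qed (rule is_form_linear[OF assms])

lemma is_form_linear_hd: "is_form k \<alpha> \<Longrightarrow> linear (\<lambda>v. \<alpha> (v # ws))"
  using is_form_linear_weak[of k \<alpha> "[]"] by simp

lemma form_homogeneous:
  assumes "is_form k \<alpha>"
  shows "\<alpha> (map (\<lambda>v. r *\<^sub>R v) vs) = r ^ length vs * \<alpha> vs"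
  using assms
proof (induction vs arbitrary: \<alpha> k)
  case (Cons v vs)
  have "\<alpha> (r *\<^sub>R v # ws) = r * \<alpha> (v # ws)" for ws
    using linear_cmul[OF is_form_linear_hd[OF Cons.prems]] by simp
  then show ?case using Cons.IH[OF is_form_interior[OF Cons.prems, of v]] by simp
qed simp

lemma form_eqI_axis:
  assumes "is_form k \<alpha>" "is_form k \<beta>"
    and "\<And>I. length I = k \<Longrightarrow> \<alpha> (map (\<lambda>i. axis i 1) I) = \<beta> (map (\<lambda>i. axis i 1) I)"
  shows "\<alpha> = \<beta>"
  using assms
proof (induction k arbitrary: \<alpha> \<beta>)
  case 0
  have "\<alpha> vs = \<beta> vs" for vs
    using 0(3)[of "[]"] is_form_length[OF 0(1)] is_form_length[OF 0(2)] by (cases vs) auto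
  then show ?case by blast
next
  case (Suc k)
  have ax: "(\<lambda>vs. \<alpha> (axis i 1 # vs)) = (\<lambda>vs. \<beta> (axis i 1 # vs))" for i
    using Suc.prems(3)[of "i # _"]
    by (intro Suc.IH is_form_Cons Suc.prems) auto
  have "\<alpha> (v # vs) = \<beta> (v # vs)" for v vs
  proof (cases "length vs = k")
    case True
    have "\<alpha> (v # vs) = (\<Sum>i\<in>UNIV. v $ i * \<alpha> (axis i 1 # vs))"
      using linear_axis_expand[OF is_form_linear[OF Suc.prems(1), of "[]" vs], of v] True by simp
    also have "\<dots> = (\<Sum>i\<in>UNIV. v $ i * \<beta> (axis i 1 # vs))" using ax by metis
    also have "\<dots> = \<beta> (v # vs)"
      using linear_axis_expand[OF is_form_linear[OF Suc.prems(2), of "[]" vs], of v] True by simp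
    finally show ?thesis .
  qed (use is_form_length[OF Suc.prems(1)] is_form_length[OF Suc.prems(2)] in auto)
  moreover have "\<alpha> [] = \<beta> []"
    using is_form_length[OF Suc.prems(1)] is_form_length[OF Suc.prems(2)] by simp
  ultimately show ?case by (intro ext) (metis neq_Nil_conv)
qed

section \<open>Monomials\<close>

lemma e_permute_vectors:
  assumes "length vs = length I" "\<tau> permutes {..<length I}"
  shows "e I (permute_list \<tau> vs) = of_int (sign \<tau>) * e I vs"
proof -
  let ?S = "{\<sigma>. \<sigma> permutes {..<length I}}"
  let ?P = "\<lambda>\<sigma> ws. \<Prod>m<length I. ws ! \<sigma> m $ (I ! m)"
  have p: "permutation \<sigma>" if "\<sigma> \<in> ?S" for \<sigma>
    using that permutation_permutes by blast
  have "e I vs = (\<Sum>\<sigma>\<in>?S. of_int (sign (\<tau> \<circ> \<sigma>)) * ?P (\<tau> \<circ> \<sigma>) vs)"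
    using assms(1) sum.reindex_bij_witness[of ?S "\<lambda>\<sigma>. \<tau> \<circ> \<sigma>" "\<lambda>\<sigma>. inv \<tau> \<circ> \<sigma>" ?S
        "\<lambda>\<sigma>. of_int (sign (\<tau> \<circ> \<sigma>)) * ?P (\<tau> \<circ> \<sigma>) vs" "\<lambda>\<sigma>. of_int (sign \<sigma>) * ?P \<sigma> vs"]
    by (force simp: e_def o_assoc permutes_inv_o[OF assms(2)]
        intro: permutes_compose assms(2) permutes_inv)
  also have "\<dots> = (\<Sum>\<sigma>\<in>?S. of_int (sign \<tau>) * (of_int (sign \<sigma>) * ?P \<sigma> (permute_list \<tau> vs)))"
  proof (intro sum.cong refl)
    fix \<sigma> assume s: "\<sigma> \<in> ?S"
    have "?P (\<tau> \<circ> \<sigma>) vs = ?P \<sigma> (permute_list \<tau> vs)"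
      using s assms permutes_in_image[of \<sigma> "{..<length I}"]
      by (intro prod.cong refl) (simp add: permute_list_nth)
    then show "of_int (sign (\<tau> \<circ> \<sigma>)) * ?P (\<tau> \<circ> \<sigma>) vs =
        of_int (sign \<tau>) * (of_int (sign \<sigma>) * ?P \<sigma> (permute_list \<tau> vs))"
      using sign_compose[OF p p, of \<tau> \<sigma>] s assms(2) by simp
  qed
  also have "\<dots> = of_int (sign \<tau>) * e I (permute_list \<tau> vs)"
    using assms(1) by (simp add: e_def sum_distrib_left)
  finally show ?thesis
    by (simp add: mult.assoc[symmetric] of_int_mult[symmetric] del: of_int_mult)
qed

lemma e_permute_indices:
  assumes "length vs = length I" "\<tau> permutes {..<length I}"
  shows "e (permute_list \<tau> I) vs = of_int (sign \<tau>) * e I vs"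
proof -
  let ?S = "{\<sigma>. \<sigma> permutes {..<length I}}"
  let ?P = "\<lambda>\<sigma> J. \<Prod>m<length I. vs ! \<sigma> m $ (J ! m)"
  have p: "permutation \<sigma>" if "\<sigma> \<in> ?S" for \<sigma>
    using that permutation_permutes by blast
  have "e (permute_list \<tau> I) vs = (\<Sum>\<sigma>\<in>?S. of_int (sign (\<sigma> \<circ> \<tau>)) * ?P (\<sigma> \<circ> \<tau>) (permute_list \<tau> I))"
    using assms(1) sum.reindex_bij_witness[of ?S "\<lambda>\<sigma>. \<sigma> \<circ> \<tau>" "\<lambda>\<sigma>. \<sigma> \<circ> inv \<tau>" ?S
        "\<lambda>\<sigma>. of_int (sign (\<sigma> \<circ> \<tau>)) * ?P (\<sigma> \<circ> \<tau>) (permute_list \<tau> I)"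
        "\<lambda>\<sigma>. of_int (sign \<sigma>) * ?P \<sigma> (permute_list \<tau> I)"]
    by (force simp: e_def o_assoc[symmetric] permutes_inv_o[OF assms(2)]
        intro: permutes_compose assms(2) permutes_inv)
  also have "\<dots> = (\<Sum>\<sigma>\<in>?S. of_int (sign \<tau>) * (of_int (sign \<sigma>) * ?P \<sigma> I))"
  proof (intro sum.cong refl)
    fix \<sigma> assume s: "\<sigma> \<in> ?S"
    have "?P \<sigma> I = ?P (\<sigma> \<circ> \<tau>) (permute_list \<tau> I)"
      using prod.permute[OF assms(2), of "\<lambda>m. vs ! \<sigma> m $ (I ! m)"] assms
      by (simp add: permute_list_nth comp_def)
    then show "of_int (sign (\<sigma> \<circ> \<tau>)) * ?P (\<sigma> \<circ> \<tau>) (permute_list \<tau> I) =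
        of_int (sign \<tau>) * (of_int (sign \<sigma>) * ?P \<sigma> I)"
      using sign_compose[OF p p, of \<sigma> \<tau>] s assms(2) by simp
  qed
  also have "\<dots> = of_int (sign \<tau>) * e I vs"
    using assms(1) by (simp add: e_def sum_distrib_left)
  finally show ?thesis .
qed

lemma transpose_adjacent_permutes:
  "Transposition.transpose (length us) (Suc (length us)) permutes {..<length (us @ x # y # ws)}"
  by (rule permutes_swap_id) auto

lemma permute_list_transpose_adjacent:
  "permute_list (Transposition.transpose (length us) (Suc (length us))) (us @ x # y # ws) = us @ y # x # ws"
proof (rule nth_equalityI)
  fix i assume "i < length (permute_list (Transposition.transpose (length us) (Suc (length us))) (us @ x # y # ws))"
  then have i: "i < length (us @ x # y # ws)" by simp
  note p = permute_list_nth[OF transpose_adjacent_permutes i]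
  show "permute_list (Transposition.transpose (length us) (Suc (length us))) (us @ x # y # ws) ! i
      = (us @ y # x # ws) ! i"
  proof (cases "Suc (Suc (length us)) \<le> i")
    case True
    then obtain d where "i = Suc (Suc (length us)) + d" using le_Suc_ex by blast
    then show ?thesis using i unfolding p by (simp add: nth_append Transposition.transpose_def)
  next
    case False
    then consider "i < length us" | "i = length us" | "i = Suc (length us)" by linarith
    then show ?thesis
      using i unfolding p by cases (simp_all add: nth_append Transposition.transpose_def)
  qed
qed simp

lemma e_alternating: "alternating (e I)"
  unfolding alternating_def
proof (intro allI)
  fix us ws :: "(real^7) list" and x y
  let ?\<tau> = "Transposition.transpose (length us) (Suc (length us))"
  show "e I (us @ x # y # ws) = - e I (us @ y # x # ws)"
  proof (cases "length (us @ x # y # ws) = length I")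
    case True
    show ?thesis
      using e_permute_vectors[OF True, of ?\<tau>] True transpose_adjacent_permutes[of us y x ws]
      by (simp add: permute_list_transpose_adjacent sign_swap_id)
  qed (simp add: e_def)
qed

lemma e_alternating_indices: "alternating (\<lambda>I. e I vs)"
  unfolding alternating_def
proof (intro allI)
  fix us ws :: "7 list" and x y
  let ?\<tau> = "Transposition.transpose (length us) (Suc (length us))"
  show "e (us @ x # y # ws) vs = - e (us @ y # x # ws) vs"
  proof (cases "length vs = length (us @ x # y # ws)")
    case True
    show ?thesis
      using e_permute_indices[OF True, of ?\<tau>] transpose_adjacent_permutes[of us y x ws]
      by (simp add: permute_list_transpose_adjacent sign_swap_id)
  qed (simp add: e_def)
qed

lemma is_form_e: "length I = k \<Longrightarrow> is_form k (e I)"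
proof (rule is_formI)
  fix us ws :: "(real^7) list"
  assume I: "length I = k" and l: "length us + length ws + 1 = k"
  have "linear (\<lambda>v. of_int (sign \<sigma>) * (\<Prod>m<length I. (us @ v # ws) ! \<sigma> m $ (I ! m)))"
    if "\<sigma> permutes {..<length I}" for \<sigma>
  proof -
    let ?n = "inv \<sigma> (length us)"
    have n: "?n < length I" "\<sigma> ?n = length us"
      using permutes_in_image[OF permutes_inv[OF that], of "length us"] permutes_inverses[OF that] l I
      by auto
    \<comment> \<open>The factor in which \<open>v\<close> occurs is split off; the others do not depend on \<open>v\<close>.\<close>
    define c where "c = (\<Prod>m\<in>{..<length I} - {?n}. (us @ 0 # ws) ! \<sigma> m $ (I ! m))"
    have "(\<Prod>m<length I. (us @ v # ws) ! \<sigma> m $ (I ! m)) = v $ (I ! ?n) * c" for v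
    proof -
      have "(us @ v # ws) ! \<sigma> m = (us @ 0 # ws) ! \<sigma> m" if "m \<in> {..<length I} - {?n}" for m
      proof -
        have "\<sigma> m \<noteq> length us" using that permutes_inverses(2)[OF \<open>\<sigma> permutes _\<close>, of m] by auto
        then show ?thesis
          by (cases "\<sigma> m < length us") (auto simp: nth_append nth_Cons split: nat.split)
      qed
      then show ?thesis
        unfolding c_def using n by (subst prod.remove[of _ ?n]) (auto intro!: prod.cong)
    qed
    then show ?thesis by (simp add: linear_iff algebra_simps)
  qed
  then show "linear (\<lambda>v. e I (us @ v # ws))"
    using l I by (simp add: e_def linear_compose_sum)
next
  show "alternating (e I)" by (rule e_alternating)
qed (simp add: e_def)

lemma e_dual_basis:
  assumes "distinct I"
  shows "e I (map (\<lambda>i. axis i 1) I) = 1"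
proof -
  let ?S = "{\<sigma>. \<sigma> permutes {..<length I}}"
  let ?t = "\<lambda>\<sigma>. of_int (sign \<sigma>) * (\<Prod>m<length I. map (\<lambda>i. axis i 1) I ! \<sigma> m $ (I ! m) :: real)"
  have "?t \<sigma> = 0" if s: "\<sigma> \<in> ?S - {id}" for \<sigma>
  proof -
    obtain m where m: "m < length I" "\<sigma> m \<noteq> m"
      using s by (metis (mono_tags) DiffE eq_id_iff insertI1 lessThan_iff mem_Collect_eq permutes_not_in)
    have "\<sigma> m < length I" using s m permutes_in_image[of \<sigma> "{..<length I}" m] by auto
    then have "map (\<lambda>i. axis i (1::real)) I ! \<sigma> m $ (I ! m) = 0"
      using m assms by (simp add: axis_def nth_eq_iff_index_eq)
    then have "(\<Prod>m<length I. map (\<lambda>i. axis i 1) I ! \<sigma> m $ (I ! m) :: real) = 0"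
      using m by (intro prod_zero) auto
    then show ?thesis by simp
  qed
  then have "sum ?t (?S - {id}) = 0" by (rule sum.neutral[OF ballI])
  then have "sum ?t ?S = ?t id"
    by (subst sum.remove[of _ id]) (simp_all add: permutes_id finite_permutations)
  then show ?thesis by (simp add: e_def axis_def)
qed

section \<open>Wedge products of monomials\<close>

text \<open>
  Right translation by \<open>r \<pi>\<close> permutes the summation range and multiplies the sign by \<open>sign \<pi>\<close>, so all
  elements of \<open>R\<close> contribute equally.
\<close>

lemma sum_permutations_absorb:
  fixes G :: "(nat \<Rightarrow> nat) \<Rightarrow> real"
  assumes "\<And>\<pi>. \<pi> \<in> R \<Longrightarrow> r \<pi> permutes {..<n}" "\<And>\<pi>. \<pi> \<in> R \<Longrightarrow> sign (r \<pi>) = sign \<pi>"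
  shows "(\<Sum>\<sigma> | \<sigma> permutes {..<n}. of_int (sign \<sigma>) * (\<Sum>\<pi>\<in>R. of_int (sign \<pi>) * G (\<sigma> \<circ> r \<pi>))) =
    of_nat (card R) * (\<Sum>\<sigma> | \<sigma> permutes {..<n}. of_int (sign \<sigma>) * G \<sigma>)"
proof -
  let ?S = "{\<sigma>. \<sigma> permutes {..<n}}"
  have "(\<Sum>\<sigma>\<in>?S. of_int (sign \<sigma>) * (of_int (sign \<pi>) * G (\<sigma> \<circ> r \<pi>))) =
      (\<Sum>\<sigma>\<in>?S. of_int (sign \<sigma>) * G \<sigma>)" if "\<pi> \<in> R" for \<pi>
  proof -
    have p: "permutation \<sigma>" if "\<sigma> permutes {..<n}" for \<sigma>
      using that permutation_permutes by blast
    have "(\<Sum>\<sigma>\<in>?S. of_int (sign \<sigma>) * G \<sigma>) =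
        (\<Sum>\<sigma>\<in>?S. of_int (sign (\<sigma> \<circ> r \<pi>)) * G (\<sigma> \<circ> r \<pi>))"
      by (rule sum_permutations_compose_right[OF assms(1)[OF that]])
    also have "\<dots> = (\<Sum>\<sigma>\<in>?S. of_int (sign \<sigma>) * (of_int (sign \<pi>) * G (\<sigma> \<circ> r \<pi>)))"
      using assms[OF that] by (intro sum.cong refl) (simp add: sign_compose p)
    finally show ?thesis by simp
  qed
  then have "(\<Sum>\<pi>\<in>R. \<Sum>\<sigma>\<in>?S. of_int (sign \<sigma>) * (of_int (sign \<pi>) * G (\<sigma> \<circ> r \<pi>))) =
      of_nat (card R) * (\<Sum>\<sigma>\<in>?S. of_int (sign \<sigma>) * G \<sigma>)" by simp
  then show ?thesis by (subst (asm) sum.swap) (simp add: sum_distrib_left)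
qed

text \<open>
  Expanding the two factors inserts permutations of the first \<open>k\<close> and of the last \<open>l\<close> positions,
  which the outer antisymmetrisation absorbs; the \<open>k! l!\<close> equal copies are the normalising factor of
  the wedge product.
\<close>

lemma wedge_e:
  assumes "length I = k" "length J = l"
  shows "wedge k l (e I) (e J) = e (I @ J)"
proof
  fix vs :: "(real^7) list"
  let ?n = "k + l"
  let ?S = "{\<sigma>. \<sigma> permutes {..<?n}}"
  define A where "A = (\<lambda>\<sigma>. \<Prod>m<k. vs ! \<sigma> m $ (I ! m))"
  define B where "B = (\<lambda>\<sigma>. \<Prod>m<l. vs ! \<sigma> (k + m) $ (J ! m))"
  define r where "r = map_permutation {..<l} (\<lambda>m. k + m)"
  show "wedge k l (e I) (e J) vs = e (I @ J) vs"
  proof (cases "length vs = ?n")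
    case len: True
    have rp: "r \<pi> permutes {k..<?n}" if "\<pi> permutes {..<l}" for \<pi>
    proof -
      have "bij_betw (\<lambda>m. k + m) {..<l} {k..<?n}"
        by (auto simp: bij_betw_def image_iff Bex_def intro: le_add_diff_inverse[symmetric])
           (metis le_add_diff_inverse nat_add_left_cancel_less)
      from map_permutation_permutes[OF this that] show ?thesis by (simp add: r_def)
    qed
    have rp': "r \<pi> permutes {..<?n}" if "\<pi> permutes {..<l}" for \<pi>
      using rp[OF that] by (rule permutes_subset) auto
    have rs: "sign (r \<pi>) = sign \<pi>" if "\<pi> permutes {..<l}" for \<pi>
      unfolding r_def by (rule sign_map_permutation) (auto simp: that inj_on_def)
    have ra: "r \<pi> (k + m) = k + \<pi> m" if "\<pi> permutes {..<l}" "m < l" for \<pi> m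
      unfolding r_def by (rule map_permutation_apply) (auto simp: that inj_on_def)
    have r0: "r \<pi> m = m" if "\<pi> permutes {..<l}" "m < k" for \<pi> m
      using rp[OF that(1)] that(2) by (simp add: permutes_not_in)
    have \<rho>p: "\<rho> permutes {..<?n}" if "\<rho> permutes {..<k}" for \<rho>
      using that by (rule permutes_subset) auto
    have eI: "e I (take k (permute_list \<sigma> vs)) = (\<Sum>\<rho> | \<rho> permutes {..<k}. of_int (sign \<rho>) * A (\<sigma> \<circ> \<rho>))"
      if "\<sigma> \<in> ?S" for \<sigma>
    proof -
      have "take k (permute_list \<sigma> vs) ! \<rho> m = vs ! \<sigma> (\<rho> m)" if "\<rho> permutes {..<k}" "m < k" for \<rho> m
        using permutes_in_image[OF that(1), of m] that len by (simp add: permute_list_def)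
      then show ?thesis using assms len by (simp add: e_def A_def)
    qed
    have eJ: "e J (drop k (permute_list \<sigma> vs)) = (\<Sum>\<pi> | \<pi> permutes {..<l}. of_int (sign \<pi>) * B (\<sigma> \<circ> r \<pi>))"
      if "\<sigma> \<in> ?S" for \<sigma>
    proof -
      have "drop k (permute_list \<sigma> vs) ! \<pi> m = vs ! \<sigma> (r \<pi> (k + m))" if "\<pi> permutes {..<l}" "m < l" for \<pi> m
        using permutes_in_image[OF that(1), of m] that len ra by (simp add: permute_list_def)
      then show ?thesis using assms len by (simp add: e_def B_def)
    qed
    have Jinv: "e J (drop k (permute_list (\<sigma> \<circ> \<rho>) vs)) = e J (drop k (permute_list \<sigma> vs))"
      if "\<rho> permutes {..<k}" for \<sigma> \<rho>
    proof -
      have "drop k (permute_list (\<sigma> \<circ> \<rho>) vs) = drop k (permute_list \<sigma> vs)"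
        using that by (intro nth_equalityI) (auto simp: permute_list_def permutes_not_in)
      then show ?thesis by simp
    qed
    have Ainv: "A (\<sigma> \<circ> r \<pi>) = A \<sigma>" if "\<pi> permutes {..<l}" for \<sigma> \<pi>
      using r0[OF that] by (simp add: A_def)
    have "(\<Sum>\<sigma>\<in>?S. of_int (sign \<sigma>) * e I (take k (permute_list \<sigma> vs)) * e J (drop k (permute_list \<sigma> vs)))
      = (\<Sum>\<sigma>\<in>?S. of_int (sign \<sigma>) * (\<Sum>\<rho> | \<rho> permutes {..<k}. of_int (sign \<rho>) *
          (\<lambda>\<sigma>. A \<sigma> * e J (drop k (permute_list \<sigma> vs))) (\<sigma> \<circ> \<rho>)))"
      by (intro sum.cong refl)
        (simp add: eI Jinv sum_distrib_left sum_distrib_right ac_simps)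
    also have "\<dots> = fact k * (\<Sum>\<sigma>\<in>?S. of_int (sign \<sigma>) * (A \<sigma> * e J (drop k (permute_list \<sigma> vs))))"
      by (subst sum_permutations_absorb) (simp_all add: \<rho>p card_permutations)
    also have "(\<Sum>\<sigma>\<in>?S. of_int (sign \<sigma>) * (A \<sigma> * e J (drop k (permute_list \<sigma> vs))))
      = (\<Sum>\<sigma>\<in>?S. of_int (sign \<sigma>) * (\<Sum>\<pi> | \<pi> permutes {..<l}. of_int (sign \<pi>) *
          (\<lambda>\<sigma>. A \<sigma> * B \<sigma>) (\<sigma> \<circ> r \<pi>)))"
      by (intro sum.cong refl)
        (simp add: eJ Ainv sum_distrib_left sum_distrib_right ac_simps)
    also have "\<dots> = fact l * (\<Sum>\<sigma>\<in>?S. of_int (sign \<sigma>) * (A \<sigma> * B \<sigma>))"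
      by (subst sum_permutations_absorb) (simp_all add: rp' rs card_permutations)
    also have "(\<Sum>\<sigma>\<in>?S. of_int (sign \<sigma>) * (A \<sigma> * B \<sigma>)) = e (I @ J) vs"
    proof -
      have "A \<sigma> * B \<sigma> = (\<Prod>m<?n. vs ! \<sigma> m $ ((I @ J) ! m))" for \<sigma>
      proof -
        have "A \<sigma> = (\<Prod>m<k. vs ! \<sigma> m $ ((I @ J) ! m))"
          using assms by (simp add: A_def nth_append)
        moreover have "B \<sigma> = (\<Prod>m<l. vs ! \<sigma> (m + k) $ ((I @ J) ! (m + k)))"
          using assms by (simp add: B_def nth_append add.commute)
        ultimately show ?thesis
          using prod.atLeastLessThan_concat[of 0 k "k + l" "\<lambda>m. vs ! \<sigma> m $ ((I @ J) ! m)"]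
            prod.shift_bounds_nat_ivl[of "\<lambda>m. vs ! \<sigma> m $ ((I @ J) ! m)" 0 k l]
          by (simp add: lessThan_atLeast0 add.commute)
      qed
      then show ?thesis using assms len by (simp add: e_def)
    qed
    finally show ?thesis
      using len by (simp add: wedge_def)
  qed (use assms in \<open>simp add: wedge_def e_def\<close>)
qed

lemma e_2: "e [i, j] [x, y] = x $ i * y $ j - y $ i * x $ j"
  unfolding e_def
  by (simp add: lessThan_Suc sum_over_permutations_insert sign_swap_id permutes_sing
      Transposition.transpose_def)

lemma e_3: "e [i, j, k] [x, y, z] = x $ i * (y $ j * z $ k - z $ j * y $ k)
  - y $ i * (x $ j * z $ k - z $ j * x $ k) + z $ i * (x $ j * y $ k - y $ j * x $ k)"
proof -
  have P: "permutation (Transposition.transpose a b)" for a b :: nat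
    by (rule permutation_swap_id)
  show ?thesis
    unfolding e_def
    by (simp add: lessThan_Suc sum_over_permutations_insert sign_swap_id permutes_sing sign_compose P
        Transposition.transpose_def algebra_simps)
qed

section \<open>Metric and volume of the model form\<close>

text \<open>
  Integer combinations of monomials, with natural numbers as indices: in this representation wedge
  products and orders of indices can be computed by rewriting.
\<close>

definition form_of :: "(int \<times> nat list) list \<Rightarrow> form" where
  "form_of cs = (\<lambda>vs. \<Sum>(c, I)\<leftarrow>cs. of_int c * e (map of_nat I) vs)"

definition g2_terms :: "(int \<times> nat list) list" where
  "g2_terms = [(1, [1,2,7]), (1, [3,4,7]), (1, [5,6,7]), (1, [1,3,5]),
     (-1, [1,4,6]), (-1, [2,3,6]), (-1, [2,4,5])]"

lemma g2_model_eq: "g2_model = form_of g2_terms"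
  by (simp add: g2_model_def form_of_def g2_terms_def fun_eq_iff)

text \<open>
  The terms of the interior product of the \<open>i\<close>-th basis vector with the model form; a line of the
  Fano plane contains \<open>i\<close> at most once.
\<close>

definition g2_contract :: "nat \<Rightarrow> (int \<times> nat list) list" where
  "g2_contract i = concat (map (\<lambda>(c, I).
     if I ! 0 = i then [(c, [I ! 1, I ! 2])]
     else if I ! 1 = i then [(- c, [I ! 0, I ! 2])]
     else if I ! 2 = i then [(c, [I ! 0, I ! 1])] else []) g2_terms)"

definition times_terms :: "(int \<times> nat list) list \<Rightarrow> (int \<times> nat list) list \<Rightarrow> (int \<times> nat list) list" where
  "times_terms cs ds = concat (map (\<lambda>(c, I). map (\<lambda>(d, J). (c * d, I @ J)) ds) cs)"

definition top_sign :: "nat list \<Rightarrow> int" where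
  "top_sign I = (if distinct I then (-1) ^ inversions I else 0)"

text \<open>
  The coefficient of the volume form in a combination of monomials of degree 7.
\<close>

definition top_coeff :: "(int \<times> nat list) list \<Rightarrow> int" where
  "top_coeff cs = (\<Sum>(c, I)\<leftarrow>cs. c * top_sign I)"

lemma interior_product_g2_model:
  assumes "i \<in> set [1..<8]"
  shows "interior_product (axis (of_nat i) 1) g2_model = form_of (g2_contract i)"
proof
  fix vs :: "(real^7) list"
  have i: "i = 1 \<or> i = 2 \<or> i = 3 \<or> i = 4 \<or> i = 5 \<or> i = 6 \<or> i = 7"
    using assms by auto
  show "interior_product (axis (of_nat i) 1) g2_model vs = form_of (g2_contract i) vs"
  proof (cases "length vs = 2")
    case True
    then obtain x y where "vs = [x, y]" by (auto simp: numeral_2_eq_2 length_Suc_conv)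
    then show ?thesis using i
      by (elim disjE; hypsubst)
        (simp_all add: interior_product_def g2_model_def form_of_def g2_contract_def g2_terms_def
          e_2 e_3 axis_def)
  next
    case False
    then show ?thesis using i
      by (elim disjE; hypsubst)
        (simp_all add: interior_product_def g2_model_def form_of_def g2_contract_def g2_terms_def e_def)
  qed
qed

lemma wedge_add_left: "wedge k l (\<lambda>vs. \<alpha> vs + \<alpha>' vs) \<beta> vs = wedge k l \<alpha> \<beta> vs + wedge k l \<alpha>' \<beta> vs"
  by (simp add: wedge_def algebra_simps sum.distrib add_divide_distrib)

lemma wedge_add_right: "wedge k l \<alpha> (\<lambda>vs. \<beta> vs + \<beta>' vs) vs = wedge k l \<alpha> \<beta> vs + wedge k l \<alpha> \<beta>' vs"
  by (simp add: wedge_def algebra_simps sum.distrib add_divide_distrib)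

lemma wedge_scale_left: "wedge k l (\<lambda>vs. c * \<alpha> vs) \<beta> vs = c * wedge k l \<alpha> \<beta> vs"
  by (simp add: wedge_def sum_distrib_left ac_simps)

lemma wedge_scale_right: "wedge k l \<alpha> (\<lambda>vs. c * \<beta> vs) vs = c * wedge k l \<alpha> \<beta> vs"
  by (simp add: wedge_def sum_distrib_left ac_simps)

lemma wedge_sum_list_left:
  "wedge k l (\<lambda>vs. \<Sum>x\<leftarrow>xs. c x * F x vs) \<beta> vs = (\<Sum>x\<leftarrow>xs. c x * wedge k l (F x) \<beta> vs)"
  by (induction xs) (simp_all add: wedge_add_left wedge_scale_left, simp add: wedge_def)

lemma wedge_sum_list_right:
  "wedge k l \<alpha> (\<lambda>vs. \<Sum>x\<leftarrow>xs. c x * F x vs) vs = (\<Sum>x\<leftarrow>xs. c x * wedge k l \<alpha> (F x) vs)"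
  by (induction xs) (simp_all add: wedge_add_right wedge_scale_right, simp add: wedge_def)

lemma form_of_append: "form_of (cs @ ds) vs = form_of cs vs + form_of ds vs"
  by (simp add: form_of_def)

lemma wedge_form_of:
  assumes "\<forall>(c, I)\<in>set cs. length I = k" "\<forall>(d, J)\<in>set ds. length J = l"
  shows "wedge k l (form_of cs) (form_of ds) = form_of (times_terms cs ds)"
proof -
  have w: "wedge k l (e (map of_nat I)) (e (map of_nat J)) = e (map of_nat (I @ J))"
    if "(c, I) \<in> set cs" "(d, J) \<in> set ds" for c I d J
    using that assms wedge_e[of "map of_nat I" k "map of_nat J" l] by fastforce
  show ?thesis
  proof
    fix vs
    have row: "c * wedge k l (e (map of_nat I)) (form_of ds) vs =
        form_of (map (\<lambda>(d, J). (c * d, I @ J)) ds) vs" if "(c, I) \<in> set cs" for c I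
    proof -
      have "wedge k l (e (map of_nat I)) (form_of ds) vs =
          (\<Sum>x\<leftarrow>ds. of_int (fst x) * wedge k l (e (map of_nat I)) (e (map of_nat (snd x))) vs)"
        unfolding form_of_def split_beta by (rule wedge_sum_list_right)
      also have "\<dots> = (\<Sum>x\<leftarrow>ds. of_int (fst x) * e (map of_nat (I @ snd x)) vs)"
        using w[OF that] by (intro arg_cong[where f = sum_list] map_cong refl) auto
      finally show ?thesis
        by (simp add: form_of_def split_beta comp_def sum_list_const_mult[symmetric] ac_simps)
    qed
    have "wedge k l (form_of cs) (form_of ds) vs =
        (\<Sum>x\<leftarrow>cs. of_int (fst x) * wedge k l (e (map of_nat (snd x))) (form_of ds) vs)"
      unfolding form_of_def[of cs] split_beta by (rule wedge_sum_list_left)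
    also have "\<dots> = (\<Sum>x\<leftarrow>cs. form_of (map (\<lambda>(d, J). (fst x * d, snd x @ J)) ds) vs)"
      using row by (intro arg_cong[where f = sum_list] map_cong refl) auto
    also have "\<dots> = form_of (times_terms cs ds) vs"
      unfolding times_terms_def
      by (induction cs) (auto simp: form_of_append split_beta, simp add: form_of_def)
    finally show "wedge k l (form_of cs) (form_of ds) vs = form_of (times_terms cs ds) vs" .
  qed
qed

lemma form_of_top:
  assumes "\<forall>(c, I)\<in>set cs. distinct I \<longrightarrow> sort I = [1,2,3,4,5,6,7]"
  shows "form_of cs vs = of_int (top_coeff cs) * e [1,2,3,4,5,6,7] vs"
proof -
  have "e (map of_nat I) vs = of_int (top_sign I) * e [1,2,3,4,5,6,7] vs" if "(c, I) \<in> set cs" for c I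
  proof -
    have alt: "alternating (\<lambda>I. e (map of_nat I) vs)"
      using alternating_map[OF e_alternating_indices] .
    show ?thesis
    proof (cases "distinct I")
      case True
      then have "map of_nat (sort I) = [1,2,3,4,5,6,7::7]" using assms that by fastforce
      then show ?thesis using alternating_sort[OF alt, of I] True by (simp add: top_sign_def)
    next
      case False
      then show ?thesis using alternating_not_distinct[OF alt False] by (simp add: top_sign_def)
    qed
  qed
  then have "form_of cs vs = (\<Sum>(c, I)\<leftarrow>cs. of_int c * (of_int (top_sign I) * e [1,2,3,4,5,6,7] vs))"
    unfolding form_of_def by (intro arg_cong[where f = sum_list] map_cong refl) auto
  also have "\<dots> = of_int (top_coeff cs) * e [1,2,3,4,5,6,7] vs"
    unfolding top_coeff_def by (induction cs) (auto simp: algebra_simps)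
  finally show ?thesis .
qed

text \<open>
  Each of the 49 products has \<open>3 \<cdot> 3 \<cdot> 7\<close> monomials of degree 7, which are added up by rewriting.
\<close>

lemma g2_wedge_table:
  "\<forall>i\<in>set [1..<8]. \<forall>j\<in>set [1..<8].
     let cs = times_terms (times_terms (g2_contract i) (g2_contract j)) g2_terms in
     (\<forall>(c, I)\<in>set cs. distinct I \<longrightarrow> sort I = [1,2,3,4,5,6,7]) \<and>
     top_coeff cs = (if i = j then 6 else 0)"
  by code_simp

abbreviation ax :: "7 \<Rightarrow> real^7" where "ax i \<equiv> axis i 1"

abbreviation std_vol :: form where "std_vol \<equiv> e [1,2,3,4,5,6,7]"

lemma is_form_g2_model: "is_form 3 g2_model"
  unfolding g2_model_def
  by (intro is_form_add is_form_diff is_form_e) simp_all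

lemma linear_wedge_left:
  assumes "\<And>us. linear (\<lambda>X. A X us)"
  shows "linear (\<lambda>X. wedge k l (A X) \<beta> vs)"
proof -
  have "A (X + Y) = (\<lambda>us. A X us + A Y us)" "A (r *\<^sub>R X) = (\<lambda>us. r * A X us)" for X Y r
    using linear_add[OF assms] linear_cmul[OF assms] by (auto simp: fun_eq_iff)
  then show ?thesis by (intro linearI) (simp_all add: wedge_add_left wedge_scale_left)
qed

lemma linear_wedge_right:
  assumes "\<And>us. linear (\<lambda>X. A X us)"
  shows "linear (\<lambda>X. wedge k l \<alpha> (A X) vs)"
proof -
  have "A (X + Y) = (\<lambda>us. A X us + A Y us)" "A (r *\<^sub>R X) = (\<lambda>us. r * A X us)" for X Y r
    using linear_add[OF assms] linear_cmul[OF assms] by (auto simp: fun_eq_iff)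
  then show ?thesis by (intro linearI) (simp_all add: wedge_add_right wedge_scale_right)
qed

lemma index_of_nat: "\<exists>n\<in>set [1..<8]. (i::7) = of_nat n"
  using exhaust_7[of i] by (elim disjE) (simp_all add: upt_rec)

lemma of_nat_index_inject:
  assumes "n \<in> set [1..<8]" "m \<in> set [1..<8]"
  shows "(of_nat n :: 7) = of_nat m \<longleftrightarrow> n = m"
proof -
  have "n = 1 \<or> n = 2 \<or> n = 3 \<or> n = 4 \<or> n = 5 \<or> n = 6 \<or> n = 7"
    "m = 1 \<or> m = 2 \<or> m = 3 \<or> m = 4 \<or> m = 5 \<or> m = 6 \<or> m = 7"
    using assms by auto
  then show ?thesis by (elim disjE) simp_all
qed

lemma g2_model_wedge_axis:
  "wedge 4 3 (wedge 2 2 (interior_product (ax i) g2_model) (interior_product (ax j) g2_model)) g2_model vs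
    = (if i = j then 6 else 0) * std_vol vs"
proof -
  obtain n m where nm: "n \<in> set [1..<8]" "m \<in> set [1..<8]" "i = of_nat n" "j = of_nat m"
    using index_of_nat by meson
  have l: "\<forall>(c, I)\<in>set (g2_contract n). length I = 2" for n
    by (auto simp: g2_contract_def g2_terms_def split: if_splits)
  have l4: "\<forall>(c, I)\<in>set (times_terms (g2_contract n) (g2_contract m)). length I = 4"
    using l[of n] l[of m] by (fastforce simp: times_terms_def)
  have l3: "\<forall>(c, I)\<in>set g2_terms. length I = 3" by (simp add: g2_terms_def)
  let ?cs = "times_terms (times_terms (g2_contract n) (g2_contract m)) g2_terms"
  have t: "\<forall>(c, I)\<in>set ?cs. distinct I \<longrightarrow> sort I = [1,2,3,4,5,6,7]"
    "top_coeff ?cs = (if n = m then 6 else 0)"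
    using g2_wedge_table nm(1,2) by (metis (no_types, lifting))+
  have "wedge 4 3 (wedge 2 2 (form_of (g2_contract n)) (form_of (g2_contract m))) (form_of g2_terms)
      = form_of ?cs"
    by (simp add: wedge_form_of[OF l l] wedge_form_of[OF l4 l3])
  then show ?thesis
    using form_of_top[OF t(1), of vs] t(2)
    unfolding nm(3,4) interior_product_g2_model[OF nm(1)] interior_product_g2_model[OF nm(2)]
      of_nat_index_inject[OF nm(1,2)] unfolding g2_model_eq by simp
qed

text \<open>
  This is the equation that defines metric and volume form of a \<open>G\<^sub>2\<close>-structure: the model form
  induces the standard inner product and the standard volume form.
\<close>

lemma g2_model_wedge:
  "wedge 4 3 (wedge 2 2 (interior_product X g2_model) (interior_product Y g2_model)) g2_model vs
    = 6 * (X \<bullet> Y) * std_vol vs" (is "?B X Y = _")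
proof -
  have lin: "linear (\<lambda>X. interior_product X g2_model us)" for us
  proof (cases "length us = 2")
    case True
    then show ?thesis
      using is_form_linear[OF is_form_g2_model, of "[]" us] by (simp add: interior_product_def)
  next
    case False
    then have "(\<lambda>X. interior_product X g2_model us) = (\<lambda>X. 0)"
      using is_form_length[OF is_form_g2_model] by (simp add: interior_product_def fun_eq_iff)
    then show ?thesis by (simp add: linear_zero)
  qed
  have lX: "linear (\<lambda>X. ?B X Y)" for Y by (intro linear_wedge_left lin)
  have lY: "linear (\<lambda>Y. ?B X Y)" for X by (intro linear_wedge_left linear_wedge_right lin)
  have "?B X Y = (\<Sum>i\<in>UNIV. X $ i * (\<Sum>j\<in>UNIV. Y $ j * ?B (ax i) (ax j)))"
    by (subst linear_axis_expand[OF lX], subst linear_axis_expand[OF lY]) (rule refl)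
  also have "\<dots> = (\<Sum>i\<in>UNIV. X $ i * (Y $ i * (6 * std_vol vs)))"
    by (simp add: g2_model_wedge_axis if_distrib[of "\<lambda>t. _ * t"] if_distrib[of "\<lambda>t. t * _"] cong: if_cong)
  also have "\<dots> = 6 * (X \<bullet> Y) * std_vol vs"
    by (simp add: inner_vec_def sum_distrib_left sum_distrib_right ac_simps)
  finally show ?thesis .
qed

section \<open>Contractions and the star operator\<close>

lemma sum_lists_Suc:
  "(\<Sum>I | length I = Suc k. f (I :: 'a::finite list)) = (\<Sum>i\<in>UNIV. \<Sum>I | length I = k. (f (i # I) :: real))"
proof -
  have "{I :: 'a list. length I = Suc k} = (\<lambda>(i, I). i # I) ` (UNIV \<times> {I. length I = k})"
    by (auto simp: length_Suc_conv)
  moreover have "inj_on (\<lambda>(i, I). i # I) (UNIV \<times> {I :: 'a list. length I = k})"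
    by (auto simp: inj_on_def)
  ultimately show ?thesis
    by (simp add: sum.reindex sum.cartesian_product case_prod_beta' comp_def)
qed

lemma orthonormal_basis_sum:
  assumes "orthonormal_basis (\<bullet>) b"
  shows "(\<Sum>i\<in>UNIV. (x \<bullet> b i) *\<^sub>R b i) = x"
proof -
  have on: "b i \<bullet> b j = (if i = j then 1 else 0)" for i j
    using assms by (simp add: orthonormal_basis_def)
  have inj: "inj b" using on by (metis injI zero_neq_one)
  have nz: "0 \<notin> range b" using on by (metis imageE inner_zero_left zero_neq_one)
  have orth: "pairwise orthogonal (range b)"
    by (auto simp: pairwise_def orthogonal_def on)
  have "independent (range b)" using pairwise_orthogonal_independent[OF orth nz] .
  moreover have "card (range b) = DIM(real^7)" using inj by (simp add: card_image)
  ultimately have "span (range b) = UNIV"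
    by (metis card_eq_dim dim_UNIV finite finite_imageI span_superset subset_UNIV dim_span span_span
        dim_eq_full independent_card_le_dim dim_eq_card_independent)
  then have "(\<Sum>v\<in>range b. (x \<bullet> v) *\<^sub>R v) = x"
    using orth on by (intro orthonormal_basis_expand) (auto simp: norm_eq_sqrt_inner)
  then show ?thesis using inj by (simp add: sum.reindex)
qed

text \<open>
  One slot at a time: for linear \<open>f\<close> and \<open>g\<close> the sum \<open>\<Sum>\<^sub>i f (b i) g (b i)\<close> is the inner product of the two
  functionals, which does not depend on the orthonormal basis.
\<close>

lemma contraction_orthonormal:
  assumes "orthonormal_basis (\<bullet>) b"
    "\<And>us ws. length us + length ws + 1 = k \<Longrightarrow> linear (\<lambda>v. F (us @ v # ws))"
    "\<And>us ws. length us + length ws + 1 = k \<Longrightarrow> linear (\<lambda>v. G (us @ v # ws))"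
  shows "(\<Sum>I | length I = k. F (map b I) * G (map b I) :: real) =
    (\<Sum>I | length I = k. F (map ax I) * G (map ax I))"
  using assms(2,3)
proof (induction k arbitrary: F G)
  case (Suc k)
  have slot: "(\<Sum>i\<in>UNIV. f (b i) * g (b i)) = (\<Sum>j\<in>UNIV. f (ax j) * g (ax j))"
    if f: "linear f" and g: "linear g" for f g :: "real^7 \<Rightarrow> real"
  proof -
    have g_ax: "(\<Sum>i\<in>UNIV. b i $ j * g (b i)) = g (ax j)" for j
    proof -
      have "g (ax j) = g (\<Sum>i\<in>UNIV. (ax j \<bullet> b i) *\<^sub>R b i)"
        by (simp add: orthonormal_basis_sum[OF assms(1)])
      also have "\<dots> = (\<Sum>i\<in>UNIV. (ax j \<bullet> b i) * g (b i))"
        by (simp add: linear_sum[OF g] linear_cmul[OF g])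
      finally show ?thesis by (simp add: inner_axis')
    qed
    have "(\<Sum>i\<in>UNIV. f (b i) * g (b i)) = (\<Sum>i\<in>UNIV. \<Sum>j\<in>UNIV. b i $ j * f (ax j) * g (b i))"
      by (subst linear_axis_expand[OF f]) (simp add: sum_distrib_right)
    also have "\<dots> = (\<Sum>j\<in>UNIV. f (ax j) * (\<Sum>i\<in>UNIV. b i $ j * g (b i)))"
      by (subst sum.swap) (simp add: sum_distrib_left ac_simps)
    finally show ?thesis by (simp only: g_ax)
  qed
  have "(\<Sum>I | length I = Suc k. F (map b I) * G (map b I)) =
      (\<Sum>i\<in>UNIV. \<Sum>I | length I = k. F (b i # map b I) * G (b i # map b I))"
    by (simp add: sum_lists_Suc)
  also have "\<dots> = (\<Sum>i\<in>UNIV. \<Sum>I | length I = k. F (b i # map ax I) * G (b i # map ax I))"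
    using Suc.prems[of "b _ # _"] by (intro sum.cong refl Suc.IH) simp_all
  also have "\<dots> = (\<Sum>I | length I = k. \<Sum>i\<in>UNIV. F (b i # map ax I) * G (b i # map ax I))"
    by (rule sum.swap)
  also have "\<dots> = (\<Sum>I | length I = k. \<Sum>i\<in>UNIV. F (ax i # map ax I) * G (ax i # map ax I))"
    using Suc.prems[of "[]"] by (intro sum.cong refl slot) simp_all
  also have "\<dots> = (\<Sum>i\<in>UNIV. \<Sum>I | length I = k. F (ax i # map ax I) * G (ax i # map ax I))"
    by (rule sum.swap)
  finally show ?case by (simp add: sum_lists_Suc)
qed simp

lemma mset_indices_iff:
  "mset (I :: 7 list) = mset [1,2,3,4,5,6,7] \<longleftrightarrow> length I = 7 \<and> distinct I"
proof
  assume m: "mset I = mset [1,2,3,4,5,6,7]"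
  then show "length I = 7 \<and> distinct I"
    using mset_eq_length[OF m] mset_eq_imp_distinct_iff[OF m] by simp
next
  assume I: "length I = 7 \<and> distinct I"
  then have "card (set I) = CARD(7)" by (simp add: distinct_card)
  then have "set I = UNIV" by (intro card_eq_UNIV_imp_eq_UNIV) simp_all
  moreover have "set [1,2,3,4,5,6,7] = (UNIV :: 7 set)" using exhaust_7 by auto
  ultimately have "set I = set [1,2,3,4,5,6,7]" by simp
  then show "mset I = mset [1,2,3,4,5,6,7]"
    using I by (intro set_eq_iff_mset_eq_distinct[THEN iffD1]) simp_all
qed

lemma std_vol_axes: "std_vol (map ax [1,2,3,4,5,6,7]) = 1"
  by (rule e_dual_basis) simp

lemma is_form_std_vol: "is_form 7 std_vol"
  by (rule is_form_e) simp

text \<open>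
  The full contraction of the volume form with itself is \<open>7!\<close> times the square of its value on an
  orthonormal basis, and the contraction does not depend on the basis.
\<close>

lemma std_vol_orthonormal:
  assumes "orthonormal_basis (\<bullet>) b"
  shows "\<bar>std_vol (map b [1,2,3,4,5,6,7])\<bar> = 1"
proof -
  let ?L = "[1,2,3,4,5,6,7] :: 7 list"
  let ?N = "{I :: 7 list. length I = 7 \<and> distinct I}"
  have fin: "finite {I :: 7 list. length I = 7}" using finite_lists_length_eq[of "UNIV :: 7 set" 7] by simp
  have sq: "(\<Sum>I | length I = 7. std_vol (map c I) * std_vol (map c I)) =
      card ?N * (std_vol (map c ?L) * std_vol (map c ?L))" for c :: "7 \<Rightarrow> real^7"
  proof -
    have alt: "alternating (\<lambda>I. std_vol (map c I))" by (rule alternating_map[OF e_alternating])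
    have "(\<Sum>I | length I = 7. std_vol (map c I) * std_vol (map c I)) =
        (\<Sum>I\<in>?N. std_vol (map c I) * std_vol (map c I))"
      using fin alternating_not_distinct[OF alt] by (intro sum.mono_neutral_right) auto
    also have "\<dots> = (\<Sum>I\<in>?N. std_vol (map c ?L) * std_vol (map c ?L))"
      by (intro sum.cong refl alternating_mset_product[OF alt alt]) (simp only: mset_indices_iff mem_Collect_eq)
    finally show ?thesis by simp
  qed
  have "(\<Sum>I | length I = 7. std_vol (map b I) * std_vol (map b I)) =
      (\<Sum>I | length I = 7. std_vol (map ax I) * std_vol (map ax I))"
    by (intro contraction_orthonormal[OF assms] is_form_linear[OF is_form_std_vol])
  then have "real (card ?N) * (std_vol (map b ?L) * std_vol (map b ?L)) = real (card ?N) * (1 * 1)"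
    unfolding sq std_vol_axes .
  moreover have "?L \<in> ?N" by simp
  then have "card ?N \<noteq> 0" using finite_subset[OF _ fin, of ?N] by (subst card_eq_0_iff) blast
  ultimately have "(std_vol (map b ?L))\<^sup>2 = 1" by (simp add: power2_eq_square)
  then show ?thesis by (simp only: abs_square_eq_1 power2_eq_1_iff)
qed

text \<open>
  The star operator of the standard metric, computed in the standard basis, whereas \<open>hodge\<close> uses an
  orthonormal basis that is chosen arbitrarily.
\<close>

definition hodge_model :: "nat \<Rightarrow> form \<Rightarrow> form" where
  "hodge_model k \<alpha> = (\<lambda>vs. (\<Sum>I | length I = k. \<alpha> (map ax I) * std_vol (map ax I @ vs)) / fact k)"

lemma is_form_hodge_model:
  assumes "k + l = 7"
  shows "is_form l (hodge_model k \<alpha>)"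
proof (rule is_formI)
  show "hodge_model k \<alpha> vs = 0" if "length vs \<noteq> l" for vs
  proof -
    have "std_vol (map ax I @ vs) = 0" if "length I = k" for I
      using is_form_length[OF is_form_std_vol, of "map ax I @ vs"] that \<open>length vs \<noteq> l\<close> assms by simp
    then show ?thesis by (simp add: hodge_model_def)
  qed
  have a: "std_vol (map ax I @ us @ x # y # ws) = - std_vol (map ax I @ us @ y # x # ws)" for I us x y ws
    using alternatingD[OF e_alternating, where us = "map ax I @ us" and x = x and y = y and ws = ws] by simp
  show "alternating (hodge_model k \<alpha>)"
    unfolding alternating_def
  proof (intro allI)
    fix us ws :: "(real^7) list" and x y
    show "hodge_model k \<alpha> (us @ x # y # ws) = - hodge_model k \<alpha> (us @ y # x # ws)"
      unfolding hodge_model_def a[of _ us x y ws] by (simp add: sum_negf)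
  qed
  show "linear (\<lambda>v. hodge_model k \<alpha> (us @ v # ws))" if "length us + length ws + 1 = l" for us ws
  proof -
    have "linear (\<lambda>v. std_vol (map ax I @ us @ v # ws))" if "length I = k" for I
      using is_form_linear[OF is_form_std_vol, of "map ax I @ us" ws] that
        \<open>length us + length ws + 1 = l\<close> assms by simp
    then have "linear (\<lambda>v. \<alpha> (map ax I) * std_vol (map ax I @ us @ v # ws))" if "length I = k" for I
      using that by (simp add: linear_iff algebra_simps)
    then have "linear (\<lambda>v. \<Sum>I | length I = k. \<alpha> (map ax I) * std_vol (map ax I @ us @ v # ws))"
      by (intro linear_compose_sum) auto
    then show ?thesis
      unfolding hodge_model_def by (simp add: linear_iff add_divide_distrib)
  qed
qed

text \<open>
  Only the \<open>k!\<close> orderings of the complementary indices contribute, all equally.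
\<close>

lemma hodge_model_axes:
  assumes "is_form k \<alpha>" "length I = k" "mset (I @ J) = mset [1,2,3,4,5,6,7]"
  shows "hodge_model k \<alpha> (map ax J) = \<alpha> (map ax I) * std_vol (map ax (I @ J))"
proof -
  have altF: "alternating (\<lambda>I. \<alpha> (map ax I))"
    by (rule alternating_map[OF is_form_alternating[OF assms(1)]])
  have altG: "alternating (\<lambda>I. std_vol (map ax I @ map ax J))"
    by (rule alternating_map_append[OF e_alternating])
  have fin: "finite {I :: 7 list. length I = k}" using finite_lists_length_eq[of "UNIV :: 7 set" k] by simp
  have IJ: "distinct (I @ J)" "length (I @ J) = 7" using assms(3) mset_indices_iff by blast+
  have d: "mset K = mset I" if "distinct (K @ J)" "length K = k" for K
  proof -
    have "mset (K @ J) = mset [1,2,3,4,5,6,7]"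
      using that IJ assms(2) unfolding mset_indices_iff by simp
    then show ?thesis using assms(3) by (metis add_right_cancel mset_append)
  qed
  have z: "std_vol (map ax K @ map ax J) = 0" if "\<not> distinct (K @ J)" for K
    using alternating_not_distinct[OF alternating_map[OF e_alternating] that, of _ ax] by simp
  have eq: "{K. mset K = mset I} = permutations_of_set (set I)"
  proof (intro equalityI subsetI)
    fix K assume "K \<in> permutations_of_set (set I)"
    then show "K \<in> {K. mset K = mset I}"
      using set_eq_iff_mset_eq_distinct[of K I] IJ(1) by (simp add: permutations_of_set_def)
  next
    fix K assume "K \<in> {K. mset K = mset I}"
    then show "K \<in> permutations_of_set (set I)"
      using mset_eq_setD[of K I] mset_eq_imp_distinct_iff[of K I] IJ(1)
      by (simp add: permutations_of_set_def)
  qed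
  have "(\<Sum>K | length K = k. \<alpha> (map ax K) * std_vol (map ax K @ map ax J)) =
      (\<Sum>K | mset K = mset I. \<alpha> (map ax K) * std_vol (map ax K @ map ax J))"
    using fin d z assms(2) by (intro sum.mono_neutral_right) (auto dest: mset_eq_length)
  also have "\<dots> = (\<Sum>K | mset K = mset I. \<alpha> (map ax I) * std_vol (map ax I @ map ax J))"
    by (intro sum.cong refl alternating_mset_product[OF altF altG]) simp
  also have "\<dots> = fact k * (\<alpha> (map ax I) * std_vol (map ax I @ map ax J))"
    using IJ(1) assms(2) by (simp add: eq distinct_card)
  finally show ?thesis by (simp add: hodge_model_def)
qed

section \<open>Uniqueness of the induced metric and pullback\<close>

lemma is_form_pullback:
  assumes "linear H" "is_form k \<alpha>"
  shows "is_form k (\<lambda>vs. \<alpha> (map H vs))"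
proof (rule is_formI)
  show "alternating (\<lambda>vs. \<alpha> (map H vs))" by (rule alternating_map[OF is_form_alternating[OF assms(2)]])
  show "linear (\<lambda>v. \<alpha> (map H (us @ v # ws)))" if "length us + length ws + 1 = k" for us ws
    using linear_compose[OF assms(1) is_form_linear[OF assms(2), of "map H us" "map H ws"]] that
    by (simp add: comp_def)
qed (simp add: is_form_length[OF assms(2)])

lemma wedge_pullback:
  "wedge k l (\<lambda>vs. \<alpha> (map H vs)) (\<lambda>vs. \<beta> (map H vs)) vs = wedge k l \<alpha> \<beta> (map H vs)"
  by (simp add: wedge_def permute_list_map take_map drop_map cong: sum.cong_simp)

lemma orthonormal_basis_pullback:
  "orthonormal_basis (\<lambda>x y. H x \<bullet> H y) b \<longleftrightarrow> orthonormal_basis (\<bullet>) (\<lambda>i. H (b i))"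
  by (simp add: orthonormal_basis_def)

lemma orthonormal_basis_pullback_axis:
  assumes "\<And>x. H (G x) = x"
  shows "orthonormal_basis (\<lambda>x y. H x \<bullet> H y) (\<lambda>i. G (ax i))"
  by (simp add: orthonormal_basis_def assms inner_axis_axis)

lemma g2_induces_pullback:
  assumes "linear H" "bij H"
  shows "g2_induces (\<lambda>vs. g2_model (map H vs)) (\<lambda>x y. H x \<bullet> H y) (\<lambda>vs. std_vol (map H vs))"
  unfolding g2_induces_def
proof (intro conjI allI)
  have "bilinear (\<lambda>x y. H x \<bullet> H y)"
    by (simp add: bilinear_def linear_iff linear_add[OF assms(1)] linear_cmul[OF assms(1)] inner_simps)
  moreover have "H x \<bullet> H x > 0" if "x \<noteq> 0" for x
    using that linear_injective_0[OF assms(1)] bij_is_inj[OF assms(2)] by (metis inner_gt_zero_iff)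
  ultimately show "inner_product (\<lambda>x y. H x \<bullet> H y)"
    by (simp add: inner_product_def inner_commute)
  have "\<bar>std_vol (map H (map b [1,2,3,4,5,6,7]))\<bar> = 1"
    if "orthonormal_basis (\<lambda>x y. H x \<bullet> H y) b" for b
    using std_vol_orthonormal[OF orthonormal_basis_pullback[THEN iffD1, OF that]] by simp
  then show "volume_form (\<lambda>x y. H x \<bullet> H y) (\<lambda>vs. std_vol (map H vs))"
    unfolding volume_form_def using is_form_pullback[OF assms(1) is_form_std_vol] by blast
  fix X Y vs
  have "interior_product X (\<lambda>vs. g2_model (map H vs)) = (\<lambda>vs. interior_product (H X) g2_model (map H vs))" for X
    by (simp add: interior_product_def)
  then show "H X \<bullet> H Y * std_vol (map H vs) = 1 / 6 * wedge 4 3 (wedge 2 2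
      (interior_product X (\<lambda>vs. g2_model (map H vs))) (interior_product Y (\<lambda>vs. g2_model (map H vs))))
      (\<lambda>vs. g2_model (map H vs)) vs"
    by (simp add: wedge_pullback[abs_def] g2_model_wedge)
qed

text \<open>
  The defining equation leaves the freedom \<open>(g, vol) \<leadsto> (g / t, t vol)\<close>. If \<open>b\<close> is orthonormal for \<open>g\<close>,
  then \<open>\<surd>t b\<close> is orthonormal for \<open>g / t\<close>, and comparing the volumes of both bases gives \<open>t = 1\<close>.
\<close>

lemma g2_induces_unique:
  assumes "g2_induces \<phi> g vol" "g2_induces \<phi> g' vol'" "orthonormal_basis g b"
  shows "g' = g \<and> vol' = vol"
proof -
  let ?L = "[1,2,3,4,5,6,7] :: 7 list"
  have eq: "g X Y * vol vs = g' X Y * vol' vs" for X Y vs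
    using assms(1,2) unfolding g2_induces_def by metis
  have vol: "\<bar>vol (map b ?L)\<bar> = 1"
    using assms(1,3) unfolding g2_induces_def volume_form_def by blast
  have ip: "inner_product g" "inner_product g'" using assms(1,2) unfolding g2_induces_def by blast+
  \<comment> \<open>The ratio of the two volume forms, and so the inverse ratio of the metrics.\<close>
  define t where "t = vol' (map b ?L) / vol (map b ?L)"
  have gt: "g X Y = t * g' X Y" for X Y
    using eq[of X Y "map b ?L"] vol unfolding t_def by (auto simp: field_simps)
  have b1: "g (b 1) (b 1) = 1" using assms(3) by (simp add: orthonormal_basis_def)
  then have "b 1 \<noteq> 0"
    using ip(1) bilinear_lzero[of g] unfolding inner_product_def by force
  then have "g' (b 1) (b 1) > 0" using ip(2) unfolding inner_product_def by blast
  then have t: "t > 0" using gt[of "b 1" "b 1"] b1 by (metis zero_less_mult_pos2 zero_less_one)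
  define r where "r = sqrt t"
  have r: "r > 0" "r * r = t" using t by (auto simp: r_def)
  have "g' (r *\<^sub>R x) (r *\<^sub>R y) = g x y" for x y
    using ip(2) unfolding inner_product_def
    by (simp add: bilinear_lmul bilinear_rmul gt r(2)[symmetric])
  then have "orthonormal_basis g' (\<lambda>i. r *\<^sub>R b i)"
    using assms(3) by (simp add: orthonormal_basis_def)
  then have v': "\<bar>vol' (map (\<lambda>i. r *\<^sub>R b i) ?L)\<bar> = 1" and f': "is_form 7 vol'"
    using assms(2) unfolding g2_induces_def volume_form_def by blast+
  have "vol' (map (\<lambda>i. r *\<^sub>R b i) ?L) = r ^ 7 * vol' (map b ?L)"
    using form_homogeneous[OF f', of r "map b ?L"] by (simp add: comp_def eval_nat_numeral)
  then have "\<bar>r ^ 7 * vol' (map b ?L)\<bar> = 1" using v' by (simp only:)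
  moreover have "vol' (map b ?L) = t * vol (map b ?L)" using vol by (auto simp: t_def)
  then have "\<bar>vol' (map b ?L)\<bar> = t" using vol t by (simp only: abs_mult)
  ultimately have "r ^ 7 * (r * r) = 1" using r by (simp only: abs_mult) simp
  then have "r ^ 9 = 1" by (simp add: eval_nat_numeral ac_simps)
  then have "r = 1" using r(1) power_eq_1_iff[of r 9] by simp
  then have "t = 1" using r(2) by simp
  then have g: "g' = g" using gt by (simp add: fun_eq_iff)
  then have "vol' vs = vol vs" for vs using eq[of "b 1" "b 1" vs] b1 by simp
  with g show ?thesis by blast
qed

lemma g2_pullback_unique:
  assumes "linear H" "bij H" "g2_induces (\<lambda>vs. g2_model (map H vs)) g vol"
  shows "g = (\<lambda>x y. H x \<bullet> H y) \<and> vol = (\<lambda>vs. std_vol (map H vs))"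
proof -
  have "H (inv H x) = x" for x using assms(2) by (simp add: bij_is_surj surj_f_inv_f)
  from g2_induces_unique[OF g2_induces_pullback[OF assms(1,2)] assms(3)
      orthonormal_basis_pullback_axis[of H "inv H", OF this]]
  show ?thesis .
qed

lemma g2_metric_pullback:
  assumes "linear H" "bij H"
  shows "g2_metric (\<lambda>vs. g2_model (map H vs)) = (\<lambda>x y. H x \<bullet> H y)"
  unfolding g2_metric_def
  using g2_induces_pullback[OF assms] g2_pullback_unique[OF assms] by (intro the_equality) blast+

lemma g2_vol_pullback:
  assumes "linear H" "bij H"
  shows "g2_vol (\<lambda>vs. g2_model (map H vs)) = (\<lambda>vs. std_vol (map H vs))"
  unfolding g2_vol_def
  using g2_induces_pullback[OF assms] g2_pullback_unique[OF assms] by (intro the_equality) blast+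

lemma hodge_pullback:
  assumes "linear H" "bij H" "is_form k \<alpha>" "k \<le> 7"
  shows "hodge (\<lambda>x y. H x \<bullet> H y) (\<lambda>vs. std_vol (map H vs)) k (\<lambda>vs. \<alpha> (map H vs)) =
    (\<lambda>vs. hodge_model k \<alpha> (map H vs))"
proof
  fix vs
  define b where "b = (SOME b. orthonormal_basis (\<lambda>x y. H x \<bullet> H y) b)"
  have "H (inv H x) = x" for x using assms(2) by (simp add: bij_is_surj surj_f_inv_f)
  from orthonormal_basis_pullback_axis[of H "inv H", OF this]
  have "orthonormal_basis (\<lambda>x y. H x \<bullet> H y) b" unfolding b_def
    by (rule someI[where P = "orthonormal_basis (\<lambda>x y. H x \<bullet> H y)"])
  then have b: "orthonormal_basis (\<bullet>) (\<lambda>i. H (b i))" by (rule orthonormal_basis_pullback[THEN iffD1])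
  have "(\<Sum>I | length I = k. \<alpha> (map (\<lambda>i. H (b i)) I) * std_vol (map (\<lambda>i. H (b i)) I @ map H vs)) =
      (\<Sum>I | length I = k. \<alpha> (map ax I) * std_vol (map ax I @ map H vs))"
  proof (cases "k + length vs = 7")
    case True
    show ?thesis
    proof (rule contraction_orthonormal[OF b, where G = "\<lambda>us. std_vol (us @ map H vs)"])
      fix us ws :: "(real^7) list" assume l: "length us + length ws + 1 = k"
      show "linear (\<lambda>v. \<alpha> (us @ v # ws))" by (rule is_form_linear[OF assms(3) l])
      show "linear (\<lambda>v. std_vol ((us @ v # ws) @ map H vs))"
        using is_form_linear[OF is_form_std_vol, of us "ws @ map H vs"] l True by simp
    qed
  next
    case False
    have "std_vol (map c I @ map H vs) = 0" if "length I = k" for I and c :: "7 \<Rightarrow> real^7"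
      using is_form_length[OF is_form_std_vol, of "map c I @ map H vs"] that False by simp
    then show ?thesis by simp
  qed
  then show "hodge (\<lambda>x y. H x \<bullet> H y) (\<lambda>vs. std_vol (map H vs)) k (\<lambda>vs. \<alpha> (map H vs)) vs =
      hodge_model k \<alpha> (map H vs)"
    by (simp add: hodge_def hodge_model_def Let_def b_def[symmetric] comp_def)
qed

section \<open>Symmetry of the second derivative\<close>

text \<open>
  The mean value theorem for \<open>s \<mapsto> u (p + s v + t w) - u (p + s v)\<close> turns the second difference into \<open>t\<close>
  times a difference of first derivatives in direction \<open>v\<close>, which the differentiability of the first
  derivative at \<open>p\<close> controls.
\<close>

lemma second_difference_estimate:
  fixes u :: "'a::real_normed_vector \<Rightarrow> real"
  assumes du: "\<And>q. (u has_derivative U q) (at q)"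
    and dU: "((\<lambda>q. U q v) has_derivative B) (at p)"
    and \<epsilon>: "\<epsilon> > 0"
  shows "\<exists>d>0. \<forall>t. 0 < t \<and> t < d \<longrightarrow>
    \<bar>u (p + t *\<^sub>R v + t *\<^sub>R w) - u (p + t *\<^sub>R v) - u (p + t *\<^sub>R w) + u p - t\<^sup>2 * B w\<bar> \<le> \<epsilon> * t\<^sup>2"
proof -
  \<comment> \<open>The two points at which the first derivative is compared are at distance at most
    \<open>t (norm v + norm w)\<close> and \<open>t norm v\<close> from \<open>p\<close>; the summand 1 keeps \<open>M\<close> positive.\<close>
  define M where "M = 2 * norm v + norm w + 1"
  have M: "M > 0" unfolding M_def by (simp add: add_nonneg_pos)
  obtain d where d: "d > 0" "\<And>q. norm (q - p) < d \<Longrightarrow> norm (U q v - U p v - B (q - p)) \<le> \<epsilon> / M * norm (q - p)"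
    using dU \<epsilon> M unfolding has_derivative_at_alt by (meson divide_pos_pos)
  have B: "linear B" using dU has_derivative_linear by blast
  show ?thesis
  proof (intro exI conjI allI impI)
    show "d / M > 0" using d M by simp
    fix t assume t: "0 < t \<and> t < d / M"
    define h where "h = (\<lambda>s. u (p + s *\<^sub>R v + t *\<^sub>R w) - u (p + s *\<^sub>R v))"
    have "(h has_real_derivative U (p + s *\<^sub>R v + t *\<^sub>R w) v - U (p + s *\<^sub>R v) v) (at s)" for s
    proof -
      have "((\<lambda>s. u (p + s *\<^sub>R v + z)) has_derivative (\<lambda>r. U (p + s *\<^sub>R v + z) (r *\<^sub>R v))) (at s)" for z
      proof -
        have "((\<lambda>s. p + s *\<^sub>R v + z) has_derivative (\<lambda>r. r *\<^sub>R v)) (at s)"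
          by (auto intro!: derivative_eq_intros)
        from has_derivative_compose[OF this du] show ?thesis .
      qed
      from has_derivative_diff[OF this[of "t *\<^sub>R w"] this[of 0]]
      moreover have "(*) (a - b) = (\<lambda>r. r * a - r * b)" for a b :: real
        by (simp add: fun_eq_iff algebra_simps)
      ultimately show ?thesis
        using linear_cmul[OF has_derivative_linear[OF du]]
        by (simp add: h_def has_field_derivative_def)
    qed
    then have "\<exists>z>0. z < t \<and> h t - h 0 = (t - 0) * (U (p + z *\<^sub>R v + t *\<^sub>R w) v - U (p + z *\<^sub>R v) v)"
      using t by (intro MVT2) auto
    then obtain z where z: "0 < z" "z < t"
      "h t - h 0 = t * (U (p + z *\<^sub>R v + t *\<^sub>R w) v - U (p + z *\<^sub>R v) v)" by auto
    have n1: "norm (z *\<^sub>R v + t *\<^sub>R w) \<le> t * (norm v + norm w)"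
    proof -
      have "norm (z *\<^sub>R v + t *\<^sub>R w) \<le> z * norm v + t * norm w"
        using norm_triangle_ineq[of "z *\<^sub>R v" "t *\<^sub>R w"] z t by simp
      also have "\<dots> \<le> t * norm v + t * norm w" using z by (simp add: mult_right_mono)
      finally show ?thesis by (simp add: algebra_simps)
    qed
    have n2: "norm (z *\<^sub>R v) \<le> t * norm v" using z by (simp add: mult_right_mono)
    have tM: "t * M < d" using t M by (simp add: field_simps)
    have "t * (norm v + norm w) \<le> t * M" "t * norm v \<le> t * M"
      using t by (auto intro!: mult_left_mono simp: M_def)
    then have "norm (z *\<^sub>R v + t *\<^sub>R w) < d" "norm (z *\<^sub>R v) < d"
      using n1 n2 tM by linarith+
    then have a: "\<bar>U (p + z *\<^sub>R v + t *\<^sub>R w) v - U p v - B (z *\<^sub>R v + t *\<^sub>R w)\<bar> \<le> \<epsilon> / M * (t * (norm v + norm w))"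
      "\<bar>U (p + z *\<^sub>R v) v - U p v - B (z *\<^sub>R v)\<bar> \<le> \<epsilon> / M * (t * norm v)"
      using d(2)[of "p + z *\<^sub>R v + t *\<^sub>R w"] d(2)[of "p + z *\<^sub>R v"] n1 n2 \<epsilon> M
      by (smt (verit) add.assoc add_diff_cancel_left' divide_nonneg_nonneg mult_left_mono real_norm_def)+
    have "\<bar>U (p + z *\<^sub>R v + t *\<^sub>R w) v - U (p + z *\<^sub>R v) v - t * B w\<bar>
        \<le> \<epsilon> / M * (t * (norm v + norm w)) + \<epsilon> / M * (t * norm v)"
      using a by (simp add: linear_add[OF B] linear_cmul[OF B])
    also have "\<dots> = \<epsilon> / M * (t * (2 * norm v + norm w))" by (simp add: algebra_simps)
    also have "\<dots> \<le> \<epsilon> / M * (t * M)"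
      using \<epsilon> M t by (intro mult_left_mono) (auto simp: M_def)
    also have "\<dots> = \<epsilon> * t" using M by simp
    finally have "\<bar>t * (U (p + z *\<^sub>R v + t *\<^sub>R w) v - U (p + z *\<^sub>R v) v - t * B w)\<bar> \<le> t * (\<epsilon> * t)"
      using t by (simp add: abs_mult)
    then show "\<bar>u (p + t *\<^sub>R v + t *\<^sub>R w) - u (p + t *\<^sub>R v) - u (p + t *\<^sub>R w) + u p - t\<^sup>2 * B w\<bar> \<le> \<epsilon> * t\<^sup>2"
      using z(3) by (simp add: h_def power2_eq_square algebra_simps)
  qed
qed

text \<open>
  The second difference is symmetric in \<open>v\<close> and \<open>w\<close>; divided by \<open>t\<^sup>2\<close> it tends to either side.
\<close>

lemma second_derivative_symmetric:
  fixes u :: "'a::real_normed_vector \<Rightarrow> real"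
  assumes du: "\<And>q. (u has_derivative U q) (at q)"
    and dU: "\<And>v. ((\<lambda>q. U q v) has_derivative B v) (at p)"
  shows "B v w = B w v"
proof (rule ccontr)
  assume ne: "B v w \<noteq> B w v"
  \<comment> \<open>Two errors of \<open>\<epsilon> t\<^sup>2\<close> are smaller than the gap \<open>3 \<epsilon> t\<^sup>2\<close>.\<close>
  define \<epsilon> where "\<epsilon> = \<bar>B v w - B w v\<bar> / 3"
  have \<epsilon>: "\<epsilon> > 0" using ne by (simp add: \<epsilon>_def)
  obtain d1 where d1: "d1 > 0" "\<And>t. 0 < t \<Longrightarrow> t < d1 \<Longrightarrow>
    \<bar>u (p + t *\<^sub>R v + t *\<^sub>R w) - u (p + t *\<^sub>R v) - u (p + t *\<^sub>R w) + u p - t\<^sup>2 * B v w\<bar> \<le> \<epsilon> * t\<^sup>2"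
    using second_difference_estimate[OF du dU \<epsilon>] by blast
  obtain d2 where d2: "d2 > 0" "\<And>t. 0 < t \<Longrightarrow> t < d2 \<Longrightarrow>
    \<bar>u (p + t *\<^sub>R w + t *\<^sub>R v) - u (p + t *\<^sub>R w) - u (p + t *\<^sub>R v) + u p - t\<^sup>2 * B w v\<bar> \<le> \<epsilon> * t\<^sup>2"
    using second_difference_estimate[OF du dU \<epsilon>] by blast
  define t where "t = min d1 d2 / 2"
  have t: "0 < t" "t < d1" "t < d2" using d1(1) d2(1) by (auto simp: t_def)
  have "p + t *\<^sub>R w + t *\<^sub>R v = p + t *\<^sub>R v + t *\<^sub>R w" by (simp add: algebra_simps)
  then have "\<bar>t\<^sup>2 * B v w - t\<^sup>2 * B w v\<bar> \<le> 2 * (\<epsilon> * t\<^sup>2)"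
    using d1(2)[OF t(1,2)] d2(2)[OF t(1,3)] by (simp only:)
  moreover have "t\<^sup>2 * B v w - t\<^sup>2 * B w v = t\<^sup>2 * (B v w - B w v)"
    by (rule right_diff_distrib[symmetric])
  ultimately have "t\<^sup>2 * \<bar>B v w - B w v\<bar> \<le> t\<^sup>2 * (2 * \<epsilon>)"
    by (simp only: abs_mult abs_power2 mult.assoc mult.commute[of \<epsilon>] mult.left_commute[of 2])
  then have "\<bar>B v w - B w v\<bar> \<le> 2 * \<epsilon>"
    by (rule mult_left_le_imp_le) (use t(1) in simp)
  then show False using \<epsilon> by (simp add: \<epsilon>_def)
qed

section \<open>Derivations and the Chevalley--Eilenberg differential\<close>

text \<open>
  The derivation of the algebra of forms induced by an endomorphism \<open>A\<close>: the sum over all slots, with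
  \<open>A\<close> applied in one of them. The recursion on the argument list is what makes inductions short and
  concrete values computable.
\<close>

primrec derivation :: "('a \<Rightarrow> 'a) \<Rightarrow> ('a list \<Rightarrow> real) \<Rightarrow> 'a list \<Rightarrow> real" where
  "derivation A F [] = 0"
| "derivation A F (v # vs) = F (A v # vs) + derivation A (\<lambda>ws. F (v # ws)) vs"

lemma derivation_append:
  "derivation A F (us @ vs) = derivation A (\<lambda>ws. F (ws @ vs)) us + derivation A (\<lambda>ws. F (us @ ws)) vs"
  by (induction us arbitrary: F) auto

lemma derivation_conv_sum:
  "derivation A F vs = (\<Sum>i<length vs. F (take i vs @ A (vs ! i) # drop (Suc i) vs))"
  by (induction vs arbitrary: F) (auto simp: sum.lessThan_Suc_shift simp del: sum.lessThan_Suc)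

lemma derivation_conv_sum_update: "derivation A F vs = (\<Sum>i<length vs. F (vs[i := A (vs ! i)]))"
  by (auto simp: derivation_conv_sum upd_conv_take_nth_drop intro!: sum.cong)

lemma derivation_cong_form: "(\<And>ws. length ws = length vs \<Longrightarrow> F ws = G ws) \<Longrightarrow> derivation A F vs = derivation A G vs"
  by (auto simp: derivation_conv_sum_update intro!: sum.cong)

lemma derivation_add: "derivation A (\<lambda>ws. F ws + G ws) vs = derivation A F vs + derivation A G vs"
  by (simp add: derivation_conv_sum sum.distrib)

lemma derivation_scale: "derivation A (\<lambda>ws. c * F ws) vs = c * derivation A F vs"
  by (simp add: derivation_conv_sum sum_distrib_left)

lemma derivation_minus: "derivation A (\<lambda>ws. - F ws) vs = - derivation A F vs"
  by (simp add: derivation_conv_sum sum_negf)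

lemma derivation_sum: "derivation A (\<lambda>ws. \<Sum>i\<in>S. c i * F i ws) vs = (\<Sum>i\<in>S. c i * derivation A (F i) vs)"
  by (simp add: derivation_conv_sum sum_distrib_left) (rule sum.swap)

lemma alternating_derivation:
  assumes "alternating F"
  shows "alternating (derivation A F)"
  unfolding alternating_def
proof (intro allI)
  fix us ws x y
  have s: "F (us' @ x' # y' # ws') = - F (us' @ y' # x' # ws')" for us' ws' x' y'
    by (rule alternatingD[OF assms])
  have "derivation A (\<lambda>l. F (l @ x # y # ws)) us = - derivation A (\<lambda>l. F (l @ y # x # ws)) us"
    by (subst derivation_minus[symmetric]) (rule derivation_cong_form, rule s)
  moreover have "derivation A (\<lambda>l. F (us @ x # y # l)) ws = - derivation A (\<lambda>l. F (us @ y # x # l)) ws"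
    by (subst derivation_minus[symmetric]) (rule derivation_cong_form, rule s)
  ultimately show "derivation A F (us @ x # y # ws) = - derivation A F (us @ y # x # ws)"
    using s[of us "A x" y ws] s[of us x "A y" ws] by (simp add: derivation_append)
qed

text \<open>
  Moving the distinguished slot to the front costs the sign with which exterior derivatives
  alternate.
\<close>

lemma derivation_move:
  assumes "alternating F"
  shows "(\<Sum>i<length vs. (-1) ^ i * F (A (vs ! i) # take i vs @ drop (Suc i) vs)) = derivation A F vs"
proof -
  have "F (take i vs @ A (vs ! i) # drop (Suc i) vs) =
      (-1) ^ i * F (A (vs ! i) # take i vs @ drop (Suc i) vs)" if "i < length vs" for i
    using alternating_move[OF assms, of "take i vs"] that by simp
  then show ?thesis by (simp add: derivation_conv_sum)
qed

lemma linear_derivation: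
  assumes "is_form k \<alpha>" "linear A"
  shows "linear (\<lambda>v. derivation A \<alpha> (us @ v # ws))"
proof -
  have "linear (\<lambda>v. derivation A (\<lambda>l. \<alpha> (l @ v # ws)) us)"
    unfolding derivation_conv_sum by (intro linear_compose_sum ballI is_form_linear_weak[OF assms(1)])
  moreover have "linear (\<lambda>v. \<alpha> (us @ A v # ws))"
    using linear_compose[OF assms(2) is_form_linear_weak[OF assms(1), of us ws]] by (simp add: comp_def)
  moreover have "linear (\<lambda>v. derivation A (\<lambda>l. \<alpha> (us @ v # l)) ws)"
    unfolding derivation_conv_sum by (intro linear_compose_sum ballI is_form_linear_weak[OF assms(1)])
  ultimately show ?thesis by (simp add: derivation_append linear_compose_add)
qed

lemma derivation_add_endo:
  assumes "is_form k \<alpha>"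
  shows "derivation (\<lambda>x. A x + B x) \<alpha> vs = derivation A \<alpha> vs + derivation B \<alpha> vs"
  by (simp add: derivation_conv_sum linear_add[OF is_form_linear_weak[OF assms]] sum.distrib)

text \<open>
  The Chevalley--Eilenberg differential, defined by Cartan's formula \<open>\<iota>\<^sub>x d = L\<^sub>x - d \<iota>\<^sub>x\<close> as a recursion
  on the list of arguments; on invariant forms \<open>L\<^sub>x\<close> is minus the derivation induced by \<open>ad x\<close>.
\<close>

primrec ce :: "bracket \<Rightarrow> form \<Rightarrow> form" where
  "ce \<nu> \<alpha> [] = 0"
| "ce \<nu> \<alpha> (x # vs) = - derivation (\<nu> x) \<alpha> vs - ce \<nu> (\<lambda>ws. \<alpha> (x # ws)) vs"

lemma ce_add: "ce \<nu> (\<lambda>ws. \<alpha> ws + \<beta> ws) vs = ce \<nu> \<alpha> vs + ce \<nu> \<beta> vs"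
  by (induction vs arbitrary: \<alpha> \<beta>) (simp_all add: derivation_add)

lemma ce_scale: "ce \<nu> (\<lambda>ws. c * \<alpha> ws) vs = c * ce \<nu> \<alpha> vs"
  by (induction vs arbitrary: \<alpha>) (simp_all add: derivation_scale algebra_simps)

lemma ce_minus: "ce \<nu> (\<lambda>ws. - \<alpha> ws) vs = - ce \<nu> \<alpha> vs"
  using ce_scale[of \<nu> "-1" \<alpha> vs] by simp

lemma ce_zero: "ce \<nu> (\<lambda>ws. 0) vs = 0"
  using ce_scale[of \<nu> 0 "\<lambda>ws. 0" vs] by simp

lemma ce_length:
  assumes "is_form k \<alpha>" "length vs \<noteq> Suc k"
  shows "ce \<nu> \<alpha> vs = 0"
  using assms
proof (induction vs arbitrary: \<alpha> k)
  case (Cons x vs)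
  have "ce \<nu> (\<lambda>ws. \<alpha> (x # ws)) vs = 0"
  proof (cases k)
    case 0
    then have "(\<lambda>ws. \<alpha> (x # ws)) = (\<lambda>ws. 0)" using is_form_length[OF Cons.prems(1)] by auto
    then show ?thesis by (simp add: ce_zero)
  next
    case (Suc m)
    then show ?thesis
      using Cons.IH[OF is_form_interior[OF Cons.prems(1), of x]] Cons.prems(2) by simp
  qed
  then show ?case
    using Cons.prems by (simp add: derivation_conv_sum_update is_form_length[OF Cons.prems(1)])
qed simp

lemma linear_ce:
  assumes "is_form k \<alpha>" "bilinear \<nu>"
  shows "linear (\<lambda>v. ce \<nu> \<alpha> (us @ v # ws))"
  using assms(1)
proof (induction us arbitrary: \<alpha> k)
  case Nil
  have "linear (\<lambda>v. derivation (\<nu> v) \<alpha> ws)"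
  proof -
    have "linear (\<lambda>v. \<alpha> (take i ws @ \<nu> v (ws ! i) # drop (Suc i) ws))" for i
      using linear_compose[of "\<lambda>v. \<nu> v (ws ! i)", OF _ is_form_linear_weak[OF Nil]] assms(2)
      by (simp add: comp_def bilinear_def)
    then show ?thesis unfolding derivation_conv_sum by (intro linear_compose_sum ballI)
  qed
  moreover have "linear (\<lambda>v. ce \<nu> (\<lambda>l. \<alpha> (v # l)) ws)"
    using linear_add[OF is_form_linear_hd[OF Nil]] linear_cmul[OF is_form_linear_hd[OF Nil]]
    by (intro linearI) (simp_all add: ce_add ce_scale)
  ultimately show ?case by (simp add: linear_compose_sub linear_compose_neg)
next
  case (Cons x us)
  have "linear (\<nu> x)" using assms(2) by (simp add: bilinear_def)
  from linear_derivation[OF Cons.prems this] Cons.IH[OF is_form_interior[OF Cons.prems, of x]]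
  show ?case by (simp add: linear_compose_sub linear_compose_neg)
qed

text \<open>
  In the first two slots, unfold the recursion twice: the two Lie derivatives are exchanged, and the
  bracket and the double interior product change sign. Deeper slots are covered by induction.
\<close>

lemma alternating_ce:
  assumes "is_form k \<alpha>" "\<And>x y. \<nu> x y = - \<nu> y x"
  shows "alternating (ce \<nu> \<alpha>)"
  unfolding alternating_def
proof (intro allI)
  fix us ws :: "(real^7) list" and x y
  show "ce \<nu> \<alpha> (us @ x # y # ws) = - ce \<nu> \<alpha> (us @ y # x # ws)"
    using assms(1)
  proof (induction us arbitrary: \<alpha> k)
    case Nil
    have a: "\<alpha> (\<nu> x y # ws) = - \<alpha> (\<nu> y x # ws)"
      using linear_neg[OF is_form_linear_hd[OF Nil]] assms(2)[of x y] by simp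
    have "(\<lambda>l. \<alpha> (x # y # l)) = (\<lambda>l. - \<alpha> (y # x # l))"
      using alternatingD[OF is_form_alternating[OF Nil], of "[]" x y] by (simp add: fun_eq_iff)
    then have "ce \<nu> (\<lambda>l. \<alpha> (x # y # l)) ws = - ce \<nu> (\<lambda>l. \<alpha> (y # x # l)) ws"
      by (simp only: ce_minus)
    then show ?case by (simp add: a)
  next
    case (Cons z us)
    show ?case
      using alternatingD[OF alternating_derivation[OF is_form_alternating[OF Cons.prems]], of "\<nu> z" us x y ws]
        Cons.IH[OF is_form_interior[OF Cons.prems, of z]] by simp
  qed
qed

lemma is_form_ce:
  assumes "is_form k \<alpha>" "bilinear \<nu>" "\<And>x y. \<nu> x y = - \<nu> y x"
  shows "is_form (Suc k) (ce \<nu> \<alpha>)"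
  using ce_length[OF assms(1)] alternating_ce[OF assms(1,3)] linear_ce[OF assms(1,2)]
  by (intro is_formI)

section \<open>Invariant calculus in a coframe\<close>

lemma ext_deriv_Cons:
  "ext_deriv \<omega> p (v # vs) =
    frechet_derivative (\<lambda>q. \<omega> q vs) (at p) v - ext_deriv (\<lambda>q ws. \<omega> q (v # ws)) p vs"
  by (simp add: ext_deriv_def sum.lessThan_Suc_shift sum_negf del: sum.lessThan_Suc)

lemma has_derivative_vecI:
  assumes "\<And>k. ((\<lambda>q. f q $ k) has_derivative (\<lambda>v. f' v $ k)) (at p)"
  shows "(f has_derivative (f' :: 'a::real_normed_vector \<Rightarrow> real^'n)) (at p)"
  using assms by (subst has_derivative_componentwise_within) (auto simp: Basis_vec_def inner_axis)

lemma smooth_fun_differentiable: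
  assumes "smooth_fun f"
  shows "f differentiable (at p)" "(\<lambda>p. frechet_derivative f (at p) (ax i)) differentiable (at p)"
proof -
  have "C_k (Suc (Suc 0)) f" using assms unfolding smooth_fun_def by blast
  then have "f differentiable_on UNIV" "(\<lambda>p. frechet_derivative f (at p) (ax i)) differentiable_on UNIV"
    by simp_all
  then show "f differentiable (at p)" "(\<lambda>p. frechet_derivative f (at p) (ax i)) differentiable (at p)"
    by (simp_all add: differentiable_on_def)
qed

text \<open>
  A coframe \<open>\<Phi>\<close> identifies each tangent space with the Lie algebra, \<open>\<Psi> p x\<close> is the value at \<open>p\<close> of the
  invariant field with coordinates \<open>x\<close>, and \<open>K p u v\<close> is the derivative of \<open>\<Phi> v\<close> along \<open>u\<close>. The last
  assumption is the structure equation \<open>d\<theta> = - 1/2 [\<theta>, \<theta>]\<close>.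
\<close>

locale coframe =
  fixes \<nu> :: bracket and \<Phi> \<Psi> :: "real^7 \<Rightarrow> real^7 \<Rightarrow> real^7"
    and K :: "real^7 \<Rightarrow> real^7 \<Rightarrow> real^7 \<Rightarrow> real^7"
  assumes bilinear_nu: "bilinear \<nu>"
    and nu_anti: "\<nu> x y = - \<nu> y x"
    and linear_Phi: "linear (\<Phi> p)"
    and Phi_Psi: "\<Phi> p (\<Psi> p x) = x"
    and Psi_Phi: "\<Psi> p (\<Phi> p v) = v"
    and has_derivative_Phi: "((\<lambda>q. \<Phi> q v) has_derivative (\<lambda>u. K p u v)) (at p)"
    and differentiable_Psi: "(\<lambda>q. \<Psi> q x) differentiable (at p)"
    and maurer_cartan: "K p u v - K p v u = - \<nu> (\<Phi> p u) (\<Phi> p v)"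
begin

definition invariant :: "form \<Rightarrow> real^7 \<Rightarrow> form" where
  "invariant \<alpha> = (\<lambda>p vs. \<alpha> (map (\<Phi> p) vs))"

lemma bij_Phi: "bij (\<Phi> p)"
  by (rule bijI'[of "\<Phi> p"]) (metis Phi_Psi Psi_Phi)+

lemma linear_Psi: "linear (\<Psi> p)"
proof (rule linearI)
  show "\<Psi> p (x + y) = \<Psi> p x + \<Psi> p y" for x y
    by (metis Phi_Psi Psi_Phi linear_add linear_Phi)
  show "\<Psi> p (r *\<^sub>R x) = r *\<^sub>R \<Psi> p x" for r x
    by (metis Phi_Psi Psi_Phi linear_cmul linear_Phi)
qed

lemma linear_K: "linear (K p u)"
proof (rule linearI)
  show "K p u (x + y) = K p u x + K p u y" for x y
  proof -
    have "((\<lambda>q. \<Phi> q (x + y)) has_derivative (\<lambda>u. K p u x + K p u y)) (at p)"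
      unfolding linear_add[OF linear_Phi]
      by (intro has_derivative_add has_derivative_Phi)
    from has_derivative_unique[OF this has_derivative_Phi] show ?thesis by metis
  qed
  show "K p u (r *\<^sub>R x) = r *\<^sub>R K p u x" for r x
  proof -
    have "((\<lambda>q. \<Phi> q (r *\<^sub>R x)) has_derivative (\<lambda>u. r *\<^sub>R K p u x)) (at p)"
      unfolding linear_cmul[OF linear_Phi]
      by (intro has_derivative_scaleR_right has_derivative_Phi)
    from has_derivative_unique[OF this has_derivative_Phi] show ?thesis by metis
  qed
qed

text \<open>
  The product rule: the coframe moves in each slot by \<open>K p u\<close>, which is the endomorphism \<open>K p u \<circ> \<Psi> p\<close>
  when read in the coframe.
\<close>

lemma invariant_has_derivative:
  assumes "is_form k \<alpha>"
  shows "((\<lambda>q. \<alpha> (map (\<Phi> q) vs)) has_derivative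
    (\<lambda>u. derivation (\<lambda>x. K p u (\<Psi> p x)) \<alpha> (map (\<Phi> p) vs))) (at p)"
  using assms
proof (induction vs arbitrary: \<alpha> k)
  case (Cons v vs)
  note exp = linear_axis_expand[OF is_form_linear_hd[OF Cons.prems]]
  have "((\<lambda>q. \<Sum>i\<in>UNIV. \<Phi> q v $ i * \<alpha> (ax i # map (\<Phi> q) vs)) has_derivative
    (\<lambda>u. \<Sum>i\<in>UNIV. \<Phi> p v $ i * derivation (\<lambda>x. K p u (\<Psi> p x)) (\<lambda>ws. \<alpha> (ax i # ws)) (map (\<Phi> p) vs)
        + K p u v $ i * \<alpha> (ax i # map (\<Phi> p) vs))) (at p)"
    by (intro has_derivative_sum has_derivative_mult
        bounded_linear.has_derivative[OF bounded_linear_vec_nth has_derivative_Phi]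
        Cons.IH[OF is_form_interior[OF Cons.prems]])
  moreover have "derivation (\<lambda>x. K p u (\<Psi> p x)) \<alpha> (map (\<Phi> p) (v # vs)) =
    (\<Sum>i\<in>UNIV. \<Phi> p v $ i * derivation (\<lambda>x. K p u (\<Psi> p x)) (\<lambda>ws. \<alpha> (ax i # ws)) (map (\<Phi> p) vs)
        + K p u v $ i * \<alpha> (ax i # map (\<Phi> p) vs))" for u
  proof -
    have "derivation (\<lambda>x. K p u (\<Psi> p x)) (\<lambda>ws. \<alpha> (\<Phi> p v # ws)) (map (\<Phi> p) vs) =
        derivation (\<lambda>x. K p u (\<Psi> p x)) (\<lambda>ws. \<Sum>i\<in>UNIV. \<Phi> p v $ i * \<alpha> (ax i # ws)) (map (\<Phi> p) vs)"
      by (rule derivation_cong_form) (rule exp)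
    then show ?thesis
      using exp[of "K p u v" "map (\<Phi> p) vs"] by (simp add: Psi_Phi derivation_sum sum.distrib)
  qed
  moreover have "\<alpha> (map (\<Phi> q) (v # vs)) = (\<Sum>i\<in>UNIV. \<Phi> q v $ i * \<alpha> (ax i # map (\<Phi> q) vs))" for q
    using exp[of "\<Phi> q v" "map (\<Phi> q) vs"] by simp
  ultimately show ?case by presburger
qed simp

lemma frechet_derivative_invariant:
  "is_form k \<alpha> \<Longrightarrow> frechet_derivative (\<lambda>q. \<alpha> (map (\<Phi> q) vs)) (at p) =
    (\<lambda>u. derivation (\<lambda>x. K p u (\<Psi> p x)) \<alpha> (map (\<Phi> p) vs))"
  using frechet_derivative_at[OF invariant_has_derivative] by metis

text \<open>
  Cartan's recursion again: splitting off the first vector \<open>v\<close> leaves the derivative of the coframe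
  along \<open>v\<close>, and differentiating \<open>\<Phi> q v\<close> itself leaves the same terms with the two arguments of \<open>K\<close>
  exchanged. By the structure equation their difference is \<open>ad (\<Phi> p v)\<close>.
\<close>

lemma ext_deriv_invariant:
  assumes "is_form k \<alpha>"
  shows "ext_deriv (invariant \<alpha>) = invariant (ce \<nu> \<alpha>)"
proof -
  have "ext_deriv (\<lambda>q ws. \<alpha> (map (\<Phi> q) ws)) p vs = ce \<nu> \<alpha> (map (\<Phi> p) vs)" for p vs
    using assms
  proof (induction vs arbitrary: \<alpha> k)
    case (Cons v vs)
    define A where "A = (\<lambda>u x. K p u (\<Psi> p x))"
    let ?W = "map (\<Phi> p) vs"
    let ?rem = "\<lambda>i. take i vs @ drop (Suc i) vs"
    have i: "is_form (k - 1) (\<lambda>ws. \<alpha> (\<Phi> p v # ws))" by (rule is_form_interior[OF Cons.prems])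
    have slot: "K p (vs ! i) v = A v (?W ! i) + \<nu> (\<Phi> p v) (?W ! i)" if "i < length vs" for i
      using maurer_cartan[of p "vs ! i" v] nu_anti[of "\<Phi> p v" "\<Phi> p (vs ! i)"] that
      by (simp add: A_def Psi_Phi diff_eq_eq)
    have D: "frechet_derivative (\<lambda>q. \<alpha> (\<Phi> q v # map (\<Phi> q) ws)) (at p) u =
        \<alpha> (K p u v # map (\<Phi> p) ws) +
        frechet_derivative (\<lambda>q. \<alpha> (\<Phi> p v # map (\<Phi> q) ws)) (at p) u" for u ws
      using frechet_derivative_invariant[OF Cons.prems, of "v # ws" p]
        frechet_derivative_invariant[OF i, of ws p] by (simp add: Psi_Phi)
    have "ext_deriv (\<lambda>q ws. \<alpha> (map (\<Phi> q) (v # ws))) p vs =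
        (\<Sum>i<length vs. (-1) ^ i * \<alpha> (K p (vs ! i) v # map (\<Phi> p) (?rem i))) +
        ext_deriv (\<lambda>q ws. \<alpha> (\<Phi> p v # map (\<Phi> q) ws)) p vs"
      unfolding ext_deriv_def list.map D by (simp only: distrib_left sum.distrib)
    also have "(\<Sum>i<length vs. (-1) ^ i * \<alpha> (K p (vs ! i) v # map (\<Phi> p) (?rem i))) =
        (\<Sum>i<length ?W. (-1) ^ i * \<alpha> ((A v (?W ! i) + \<nu> (\<Phi> p v) (?W ! i)) # take i ?W @ drop (Suc i) ?W))"
      by (intro sum.cong) (simp_all add: slot take_map drop_map)
    also have "\<dots> = derivation (\<lambda>x. A v x + \<nu> (\<Phi> p v) x) \<alpha> ?W"
      by (rule derivation_move[OF is_form_alternating[OF Cons.prems]])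
    also have "\<dots> = derivation (A v) \<alpha> ?W + derivation (\<nu> (\<Phi> p v)) \<alpha> ?W"
      by (rule derivation_add_endo[OF Cons.prems])
    also have "ext_deriv (\<lambda>q ws. \<alpha> (\<Phi> p v # map (\<Phi> q) ws)) p vs = ce \<nu> (\<lambda>ws. \<alpha> (\<Phi> p v # ws)) ?W"
      by (rule Cons.IH[OF i])
    finally show ?case
      by (simp add: ext_deriv_Cons frechet_derivative_invariant[OF Cons.prems] A_def)
  qed (simp add: ext_deriv_def)
  then show ?thesis by (simp add: invariant_def fun_eq_iff)
qed

lemma g2_metric_invariant: "g2_metric (invariant g2_model p) = (\<lambda>x y. \<Phi> p x \<bullet> \<Phi> p y)"
  unfolding invariant_def by (rule g2_metric_pullback[OF linear_Phi bij_Phi])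

lemma star_invariant:
  assumes "is_form k \<alpha>" "k \<le> 7"
  shows "star (invariant g2_model) k (invariant \<alpha>) = invariant (hodge_model k \<alpha>)"
  unfolding star_def g2_metric_invariant
  unfolding invariant_def g2_vol_pullback[OF linear_Phi bij_Phi]
    hodge_pullback[OF linear_Phi bij_Phi assms] ..

text \<open>
  The form \<open>*d*\<phi>\<close>, which is minus the torsion form \<open>\<tau>\<close>.
\<close>

definition torsion :: form where
  "torsion = hodge_model 5 (ce \<nu> (hodge_model 3 g2_model))"

lemma is_form_torsion: "is_form 2 torsion"
  unfolding torsion_def by (rule is_form_hodge_model) simp

lemma hodge_laplacian_invariant:
  assumes "ce \<nu> g2_model = (\<lambda>vs. 0)"
  shows "hodge_laplacian (invariant g2_model) (invariant g2_model) p vs =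
    - ce \<nu> torsion (map (\<Phi> p) vs)"
proof -
  have z: "ce \<nu> (\<lambda>vs. 0) = (\<lambda>vs. 0)" by (simp add: fun_eq_iff ce_zero)
  have h: "hodge_model k (\<lambda>vs. 0) = (\<lambda>vs. 0)" for k by (simp add: hodge_model_def)
  have f4: "is_form 4 (hodge_model 3 g2_model)" by (rule is_form_hodge_model) simp
  have f5: "is_form 5 (ce \<nu> (hodge_model 3 g2_model))"
    using is_form_ce[OF f4 bilinear_nu nu_anti] by simp
  have "ext_deriv (star (invariant g2_model) 5 (ext_deriv (star (invariant g2_model) 3 (invariant g2_model))))
      = invariant (ce \<nu> torsion)"
    by (simp add: star_invariant is_form_g2_model ext_deriv_invariant[OF f4] star_invariant[OF f5]
        torsion_def[symmetric] ext_deriv_invariant[OF is_form_torsion])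
  moreover have "star (invariant g2_model) 4 (ext_deriv (star (invariant g2_model) 4
      (ext_deriv (invariant g2_model)))) = invariant (\<lambda>vs. 0)"
    by (simp add: ext_deriv_invariant[OF is_form_g2_model] assms star_invariant is_form_zero h
        ext_deriv_invariant[OF is_form_zero] z)
  ultimately show ?thesis by (simp add: hodge_laplacian_def invariant_def)
qed

text \<open>
  The derivatives of \<open>f\<close> along the frame, which are also the coordinates of its gradient.
\<close>

definition frame_gradient :: "(real^7 \<Rightarrow> real) \<Rightarrow> real^7 \<Rightarrow> real^7" where
  "frame_gradient f p = (\<chi> k. frechet_derivative f (at p) (\<Psi> p (ax k)))"

lemma frechet_derivative_frame_gradient: "frechet_derivative f (at p) v = frame_gradient f p \<bullet> \<Phi> p v"
  if "f differentiable (at p)"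
proof -
  have l: "linear (frechet_derivative f (at p))" by (rule linear_frechet_derivative[OF that])
  have "frechet_derivative f (at p) (\<Psi> p (\<Phi> p v)) =
      (\<Sum>k\<in>UNIV. \<Phi> p v $ k * frechet_derivative f (at p) (\<Psi> p (ax k)))"
    using linear_axis_expand[OF linear_compose[OF linear_Psi l], of p "\<Phi> p v"] by (simp add: comp_def)
  then show ?thesis by (simp add: Psi_Phi inner_vec_def frame_gradient_def ac_simps)
qed

lemma gradient_invariant:
  assumes "f differentiable (at p)"
  shows "gradient (invariant g2_model) f p = \<Psi> p (frame_gradient f p)"
  unfolding gradient_def g2_metric_invariant
proof (rule the_equality)
  show "\<forall>v. \<Phi> p (\<Psi> p (frame_gradient f p)) \<bullet> \<Phi> p v = frechet_derivative f (at p) v"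
    by (simp add: Phi_Psi frechet_derivative_frame_gradient[OF assms])
  fix u assume u: "\<forall>v. \<Phi> p u \<bullet> \<Phi> p v = frechet_derivative f (at p) v"
  have "\<Phi> p u \<bullet> x = frame_gradient f p \<bullet> x" for x
    using u[rule_format, of "\<Psi> p x"] by (simp add: Phi_Psi frechet_derivative_frame_gradient[OF assms])
  then have "\<Phi> p u = frame_gradient f p" by (metis vector_eq_rdot)
  then show "u = \<Psi> p (frame_gradient f p)" by (metis Psi_Phi)
qed

lemma frame_gradient_differentiable:
  assumes "smooth_fun f"
  shows "frame_gradient f differentiable (at p)"
proof -
  have c: "frame_gradient f q $ k = (\<Sum>i\<in>UNIV. \<Psi> q (ax k) $ i * frechet_derivative f (at q) (ax i))" for q k
    unfolding frame_gradient_def vec_lambda_beta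
    by (rule linear_axis_expand[OF linear_frechet_derivative[OF smooth_fun_differentiable(1)[OF assms]]])
  have "(\<lambda>q. frame_gradient f q $ k) differentiable (at p)" for k
  proof -
    have P: "(\<lambda>q. \<Psi> q (ax k) $ i) differentiable (at p)" for i
    proof -
      obtain D where "((\<lambda>q. \<Psi> q (ax k)) has_derivative D) (at p)"
        using differentiable_Psi unfolding differentiable_def by blast
      from bounded_linear.has_derivative[OF bounded_linear_vec_nth this] show ?thesis
        by (rule differentiableI)
    qed
    have "(\<lambda>q. \<Psi> q (ax k) $ i * frechet_derivative f (at q) (ax i)) differentiable (at p)" for i
      by (rule differentiable_mult[OF P smooth_fun_differentiable(2)[OF assms]])
    then show ?thesis unfolding c by (intro differentiable_sum) simp_all
  qed
  then obtain D where D: "((\<lambda>q. frame_gradient f q $ k) has_derivative D k) (at p)" for k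
    unfolding differentiable_def by metis
  have "(frame_gradient f has_derivative (\<lambda>v. \<chi> k. D k v)) (at p)"
    using D by (intro has_derivative_vecI) simp
  then show ?thesis by (rule differentiableI)
qed

text \<open>
  For \<open>du = U \<circ> \<Phi>\<close>, the symmetry of the second derivative of \<open>u\<close> combined with the structure equation:
  \<open>E\<^sub>x E\<^sub>y u - E\<^sub>y E\<^sub>x u = E\<^bsub>[x, y]\<^esub> u\<close>.
\<close>

lemma commutator:
  assumes "\<And>q. (u has_derivative (\<lambda>v. U q \<bullet> \<Phi> q v)) (at q)" "(U has_derivative U') (at p)"
  shows "U' (\<Psi> p x) \<bullet> y - U' (\<Psi> p y) \<bullet> x = U p \<bullet> \<nu> x y"
proof -
  have d: "((\<lambda>q. U q \<bullet> \<Phi> q v) has_derivative (\<lambda>w. U p \<bullet> K p w v + U' w \<bullet> \<Phi> p v)) (at p)" for v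
    by (rule has_derivative_inner[OF assms(2) has_derivative_Phi])
  from second_derivative_symmetric[OF assms(1) d, of "\<Psi> p y" "\<Psi> p x"]
  have "U p \<bullet> K p (\<Psi> p x) (\<Psi> p y) + U' (\<Psi> p x) \<bullet> y =
      U p \<bullet> K p (\<Psi> p y) (\<Psi> p x) + U' (\<Psi> p y) \<bullet> x"
    by (simp add: Phi_Psi)
  moreover have "U p \<bullet> (K p (\<Psi> p x) (\<Psi> p y) - K p (\<Psi> p y) (\<Psi> p x)) = - (U p \<bullet> \<nu> x y)"
    unfolding maurer_cartan by (simp add: Phi_Psi)
  ultimately show ?thesis by (simp add: inner_diff_right)
qed

text \<open>
  Differentiating \<open>\<Phi> X = F\<close>, where \<open>X\<close> is the gradient and \<open>F\<close> its coordinates, expresses the derivative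
  of \<open>X\<close> through that of \<open>F\<close>; the derivatives of the coframe combine to \<open>- ad F\<close> by the structure
  equation.
\<close>

lemma lie_deriv_invariant:
  assumes "smooth_fun f" "is_form k \<alpha>"
  shows "lie_deriv (gradient (invariant g2_model) f) (invariant \<alpha>) p vs =
    derivation (\<lambda>x. frechet_derivative (frame_gradient f) (at p) (\<Psi> p x) - \<nu> (frame_gradient f p) x)
      \<alpha> (map (\<Phi> p) vs)"
proof -
  define F where "F = frame_gradient f"
  define F' where "F' = frechet_derivative F (at p)"
  define X where "X = gradient (invariant g2_model) f"
  define X' where "X' = frechet_derivative X (at p)"
  have X: "X q = \<Psi> q (F q)" for q
    unfolding X_def F_def by (rule gradient_invariant[OF smooth_fun_differentiable(1)[OF assms(1)]])
  have dF: "(F has_derivative F') (at p)"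
    using frame_gradient_differentiable[OF assms(1)] unfolding F_def F'_def frechet_derivative_works .
  have "X = (\<lambda>q. \<Sum>k\<in>UNIV. F q $ k *\<^sub>R \<Psi> q (ax k))"
    unfolding X[abs_def] by (intro ext linear_vec_expand linear_Psi)
  moreover have "(\<lambda>q. F q $ k *\<^sub>R \<Psi> q (ax k)) differentiable (at p)" for k
  proof -
    obtain D where "((\<lambda>q. \<Psi> q (ax k)) has_derivative D) (at p)"
      using differentiable_Psi unfolding differentiable_def by blast
    from has_derivative_scaleR[OF bounded_linear.has_derivative[OF bounded_linear_vec_nth dF] this]
    show ?thesis by (rule differentiableI)
  qed
  ultimately have "X differentiable (at p)" by (simp add: differentiable_sum)
  then have dX: "(X has_derivative X') (at p)" unfolding X'_def frechet_derivative_works .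
  have "((\<lambda>q. \<Sum>k\<in>UNIV. X q $ k *\<^sub>R \<Phi> q (ax k)) has_derivative
      (\<lambda>v. \<Sum>k\<in>UNIV. X p $ k *\<^sub>R K p v (ax k) + X' v $ k *\<^sub>R \<Phi> p (ax k))) (at p)"
    by (intro has_derivative_sum has_derivative_scaleR has_derivative_Phi
        bounded_linear.has_derivative[OF bounded_linear_vec_nth dX])
  moreover have "(\<Sum>k\<in>UNIV. X q $ k *\<^sub>R \<Phi> q (ax k)) = F q" for q
    using linear_vec_expand[OF linear_Phi, of q "X q"] by (simp add: X Phi_Psi)
  moreover have "(\<Sum>k\<in>UNIV. X p $ k *\<^sub>R K p v (ax k) + X' v $ k *\<^sub>R \<Phi> p (ax k)) =
      K p v (X p) + \<Phi> p (X' v)" for v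
    by (simp add: sum.distrib linear_vec_expand[OF linear_Phi, of p "X' v"]
        linear_vec_expand[OF linear_K, of p v "X p"])
  ultimately have "(F has_derivative (\<lambda>v. K p v (X p) + \<Phi> p (X' v))) (at p)" by simp
  from has_derivative_unique[OF this dF] have F': "F' v = K p v (X p) + \<Phi> p (X' v)" for v by metis
  have D: "K p (X p) (\<Psi> p x) + \<Phi> p (X' (\<Psi> p x)) = F' (\<Psi> p x) - \<nu> (F p) x" for x
    using maurer_cartan[of p "X p" "\<Psi> p x"]
    by (simp add: F' X Phi_Psi diff_eq_eq)
  have "(\<Sum>i<length vs. \<alpha> (map (\<Phi> p) (vs[i := X' (vs ! i)]))) =
      derivation (\<lambda>x. \<Phi> p (X' (\<Psi> p x))) \<alpha> (map (\<Phi> p) vs)"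
    unfolding derivation_conv_sum_update by (intro sum.cong) (simp_all add: map_update Psi_Phi)
  then have "lie_deriv X (invariant \<alpha>) p vs =
      derivation (\<lambda>x. K p (X p) (\<Psi> p x)) \<alpha> (map (\<Phi> p) vs) +
      derivation (\<lambda>x. \<Phi> p (X' (\<Psi> p x))) \<alpha> (map (\<Phi> p) vs)"
    by (simp add: lie_deriv_def invariant_def frechet_derivative_invariant[OF assms(2)] X'_def)
  also have "\<dots> = derivation (\<lambda>x. F' (\<Psi> p x) - \<nu> (F p) x) \<alpha> (map (\<Phi> p) vs)"
    by (simp only: derivation_add_endo[OF assms(2), symmetric] D)
  finally show ?thesis unfolding X_def F'_def F_def .
qed

end

section \<open>Gradient solitons in an adapted coframe\<close>

lemma g2_model_explicit: "g2_model [x, y, z] = e [1,2,7] [x, y, z] + e [3,4,7] [x, y, z] + e [5,6,7] [x, y, z]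
    + e [1,3,5] [x, y, z] - e [1,4,6] [x, y, z] - e [2,3,6] [x, y, z] - e [2,4,5] [x, y, z]"
  by (simp add: g2_model_def)

lemmas g2_model_simps = g2_model_explicit e_3 axis_def

text \<open>
  The Lie algebra of the stabilizer \<open>G\<^sub>2\<close> of the model form lies in \<open>so(7)\<close>. The seven equations on the lines of
  the Fano plane determine the diagonal entries, and the other 28 the sums \<open>d i j + d j i\<close>.
\<close>

lemma g2_stabilizer_skew:
  fixes D :: "real^7 \<Rightarrow> real^7"
  assumes "\<And>i j k. derivation D g2_model [ax i, ax j, ax k] = 0"
  shows "D (ax i) $ j + D (ax j) $ i = 0"
proof -
  define d where "d = (\<lambda>i j. D (ax i) $ j)"
  have "- d 1 6 - d 2 5 + d 3 7 = 0"
    using assms[of 1 2 3] by (simp add: g2_model_simps d_def)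
  moreover have "- d 1 5 + d 2 6 + d 4 7 = 0"
    using assms[of 1 2 4] by (simp add: g2_model_simps d_def)
  moreover have "d 1 4 + d 2 3 + d 5 7 = 0"
    using assms[of 1 2 5] by (simp add: g2_model_simps d_def)
  moreover have "d 1 3 - d 2 4 + d 6 7 = 0"
    using assms[of 1 2 6] by (simp add: g2_model_simps d_def)
  moreover have "d 1 1 + d 2 2 + d 7 7 = 0"
    using assms[of 1 2 7] by (simp add: g2_model_simps d_def)
  moreover have "d 1 7 + d 3 6 + d 4 5 = 0"
    using assms[of 1 3 4] by (simp add: g2_model_simps d_def)
  moreover have "d 1 1 + d 3 3 + d 5 5 = 0"
    using assms[of 1 3 5] by (simp add: g2_model_simps d_def)
  moreover have "- d 1 2 - d 3 4 + d 6 5 = 0"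
    using assms[of 1 3 6] by (simp add: g2_model_simps d_def)
  moreover have "- d 1 4 + d 3 2 + d 7 5 = 0"
    using assms[of 1 3 7] by (simp add: g2_model_simps d_def)
  moreover have "- d 1 2 + d 4 3 - d 5 6 = 0"
    using assms[of 1 4 5] by (simp add: g2_model_simps d_def)
  moreover have "- d 1 1 - d 4 4 - d 6 6 = 0"
    using assms[of 1 4 6] by (simp add: g2_model_simps d_def)
  moreover have "d 1 3 + d 4 2 - d 7 6 = 0"
    using assms[of 1 4 7] by (simp add: g2_model_simps d_def)
  moreover have "d 1 7 - d 5 4 - d 6 3 = 0"
    using assms[of 1 5 6] by (simp add: g2_model_simps d_def)
  moreover have "- d 1 6 + d 5 2 - d 7 3 = 0"
    using assms[of 1 5 7] by (simp add: g2_model_simps d_def)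
  moreover have "d 1 5 + d 6 2 + d 7 4 = 0"
    using assms[of 1 6 7] by (simp add: g2_model_simps d_def)
  moreover have "d 2 7 + d 3 5 - d 4 6 = 0"
    using assms[of 2 3 4] by (simp add: g2_model_simps d_def)
  moreover have "d 2 1 - d 3 4 - d 5 6 = 0"
    using assms[of 2 3 5] by (simp add: g2_model_simps d_def)
  moreover have "- d 2 2 - d 3 3 - d 6 6 = 0"
    using assms[of 2 3 6] by (simp add: g2_model_simps d_def)
  moreover have "- d 2 4 - d 3 1 - d 7 6 = 0"
    using assms[of 2 3 7] by (simp add: g2_model_simps d_def)
  moreover have "- d 2 2 - d 4 4 - d 5 5 = 0"
    using assms[of 2 4 5] by (simp add: g2_model_simps d_def)
  moreover have "- d 2 1 - d 4 3 - d 6 5 = 0"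
    using assms[of 2 4 6] by (simp add: g2_model_simps d_def)
  moreover have "d 2 3 - d 4 1 - d 7 5 = 0"
    using assms[of 2 4 7] by (simp add: g2_model_simps d_def)
  moreover have "d 2 7 - d 5 3 + d 6 4 = 0"
    using assms[of 2 5 6] by (simp add: g2_model_simps d_def)
  moreover have "- d 2 6 - d 5 1 + d 7 4 = 0"
    using assms[of 2 5 7] by (simp add: g2_model_simps d_def)
  moreover have "d 2 5 - d 6 1 + d 7 3 = 0"
    using assms[of 2 6 7] by (simp add: g2_model_simps d_def)
  moreover have "- d 3 2 - d 4 1 + d 5 7 = 0"
    using assms[of 3 4 5] by (simp add: g2_model_simps d_def)
  moreover have "- d 3 1 + d 4 2 + d 6 7 = 0"
    using assms[of 3 4 6] by (simp add: g2_model_simps d_def)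
  moreover have "d 3 3 + d 4 4 + d 7 7 = 0"
    using assms[of 3 4 7] by (simp add: g2_model_simps d_def)
  moreover have "d 3 7 + d 5 2 + d 6 1 = 0"
    using assms[of 3 5 6] by (simp add: g2_model_simps d_def)
  moreover have "- d 3 6 + d 5 4 + d 7 1 = 0"
    using assms[of 3 5 7] by (simp add: g2_model_simps d_def)
  moreover have "d 3 5 + d 6 4 - d 7 2 = 0"
    using assms[of 3 6 7] by (simp add: g2_model_simps d_def)
  moreover have "d 4 7 + d 5 1 - d 6 2 = 0"
    using assms[of 4 5 6] by (simp add: g2_model_simps d_def)
  moreover have "- d 4 6 - d 5 3 - d 7 2 = 0"
    using assms[of 4 5 7] by (simp add: g2_model_simps d_def)
  moreover have "d 4 5 - d 6 3 - d 7 1 = 0"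
    using assms[of 4 6 7] by (simp add: g2_model_simps d_def)
  moreover have "d 5 5 + d 6 6 + d 7 7 = 0"
    using assms[of 5 6 7] by (simp add: g2_model_simps d_def)
  ultimately have "\<forall>i j. d i j + d j i = 0"
    unfolding forall_7 by (intro conjI; linarith)
  then show ?thesis by (simp add: d_def)
qed

lemma derivation_diff_endo:
  assumes "is_form k \<alpha>"
  shows "derivation (\<lambda>x. A x - B x) \<alpha> vs = derivation A \<alpha> vs - derivation B \<alpha> vs"
  by (simp add: derivation_conv_sum linear_diff[OF is_form_linear_weak[OF assms]] sum_subtractf)

context coframe
begin

text \<open>
  The endomorphism through which the gradient field acts on invariant forms. Its symmetric part is the
  Hessian of \<open>f\<close>, since it is half the Lie derivative of the metric.
\<close>

definition deformation :: "(real^7 \<Rightarrow> real) \<Rightarrow> real^7 \<Rightarrow> real^7 \<Rightarrow> real^7" where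
  "deformation f p x =
    frechet_derivative (frame_gradient f) (at p) (\<Psi> p x) - \<nu> (frame_gradient f p) x"

lemma soliton_equation:
  assumes "ce \<nu> g2_model = (\<lambda>vs. 0)" "gradient_laplacian_soliton (invariant g2_model) f lam"
  shows "derivation (deformation f p) g2_model ws = - ce \<nu> torsion ws - lam * g2_model ws"
proof -
  have s: "smooth_fun f" and eq: "hodge_laplacian (invariant g2_model) (invariant g2_model) p vs =
      lam * invariant g2_model p vs + lie_deriv (gradient (invariant g2_model) f) (invariant g2_model) p vs" for vs
    using assms(2) unfolding gradient_laplacian_soliton_def by blast+
  have m: "map (\<Phi> p) (map (\<Psi> p) ws) = ws" by (simp add: comp_def Phi_Psi)
  have "hodge_laplacian (invariant g2_model) (invariant g2_model) p (map (\<Psi> p) ws) = - ce \<nu> torsion ws"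
    by (simp only: hodge_laplacian_invariant[OF assms(1)] m)
  moreover have "lie_deriv (gradient (invariant g2_model) f) (invariant g2_model) p (map (\<Psi> p) ws)
      = derivation (deformation f p) g2_model ws"
    unfolding lie_deriv_invariant[OF s is_form_g2_model] m deformation_def[symmetric] ..
  moreover have "invariant g2_model p (map (\<Psi> p) ws) = g2_model ws"
    by (simp only: invariant_def m)
  ultimately show ?thesis using eq[of "map (\<Psi> p) ws"] by simp
qed

lemma frame_gradient_has_derivative:
  assumes "smooth_fun f"
  shows "(frame_gradient f has_derivative frechet_derivative (frame_gradient f) (at p)) (at p)"
  using frame_gradient_differentiable[OF assms] unfolding frechet_derivative_works .

lemma frame_gradient_commutator:
  assumes "smooth_fun f"
  shows "frechet_derivative (frame_gradient f) (at p) (\<Psi> p x) \<bullet> y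
    - frechet_derivative (frame_gradient f) (at p) (\<Psi> p y) \<bullet> x = frame_gradient f p \<bullet> \<nu> x y"
proof (rule commutator[OF _ frame_gradient_has_derivative[OF assms]])
  fix q
  have "(f has_derivative frechet_derivative f (at q)) (at q)"
    using smooth_fun_differentiable(1)[OF assms] unfolding frechet_derivative_works .
  then show "(f has_derivative (\<lambda>v. frame_gradient f q \<bullet> \<Phi> q v)) (at q)"
    using frechet_derivative_frame_gradient[OF smooth_fun_differentiable(1)[OF assms]] by (metis (no_types, lifting) ext)
qed

text \<open>
  The Laplacian and the form itself have constant coefficients, so the difference of two deformations
  annihilates the model form.
\<close>

lemma deformation_symmetric_part_constant:
  assumes "ce \<nu> g2_model = (\<lambda>vs. 0)" "gradient_laplacian_soliton (invariant g2_model) f lam"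
  shows "deformation f p (ax i) $ j + deformation f p (ax j) $ i =
    deformation f 0 (ax i) $ j + deformation f 0 (ax j) $ i"
proof -
  have "derivation (\<lambda>x. deformation f p x - deformation f 0 x) g2_model [ax i, ax j, ax k] = 0" for i j k
    by (simp only: derivation_diff_endo[OF is_form_g2_model] soliton_equation[OF assms] cancel_comm_monoid_add_class.diff_cancel)
  from g2_stabilizer_skew[of "\<lambda>x. deformation f p x - deformation f 0 x", OF this, of i j]
  show ?thesis by simp
qed

lemma frame_derivative_zero:
  assumes "smooth_fun f" "\<And>p. frame_gradient f p $ k = c"
  shows "frechet_derivative (frame_gradient f) (at p) v $ k = 0"
proof -
  have "((\<lambda>q. frame_gradient f q $ k) has_derivative
      (\<lambda>v. frechet_derivative (frame_gradient f) (at p) v $ k)) (at p)"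
    by (rule bounded_linear.has_derivative[OF bounded_linear_vec_nth frame_gradient_has_derivative[OF assms(1)]])
  then have "((\<lambda>q. c) has_derivative (\<lambda>v. frechet_derivative (frame_gradient f) (at p) v $ k)) (at p)"
    by (simp only: assms(2))
  from has_derivative_unique[OF this has_derivative_const] show ?thesis by metis
qed

text \<open>
  Write \<open>E\<^sub>a\<close> for the frame and \<open>F\<^sub>a = E\<^sub>a f\<close>. Since \<open>e\<^sub>z\<close> is central, the constancy of \<open>Hess f (E\<^sub>a, E\<^sub>z)\<close>
  expresses \<open>E\<^sub>a F\<^sub>z = E\<^sub>z F\<^sub>a\<close> as a constant plus half the \<open>z\<close>-component of \<open>[F, e\<^sub>a]\<close>. In particular \<open>E\<^sub>z F\<^sub>z\<close>
  is constant, so \<open>E\<^sub>z E\<^sub>y F\<^sub>z = E\<^sub>y E\<^sub>z F\<^sub>z = 0\<close>; as \<open>E\<^sub>y F\<^sub>z\<close> is a constant plus a multiple of \<open>F\<^sub>x\<close>, this says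
  \<open>E\<^sub>z F\<^sub>x = 0\<close>. But \<open>E\<^sub>z F\<^sub>x\<close> is a constant plus a multiple of \<open>F\<^sub>y\<close>.
\<close>

lemma frame_gradient_constant:
  assumes "ce \<nu> g2_model = (\<lambda>vs. 0)" and sol: "gradient_laplacian_soliton (invariant g2_model) f lam"
    and central: "\<And>v. \<nu> v (ax z) = 0"
    and pair: "\<And>v. \<nu> v (ax y) $ z = r * v $ x" "\<And>v. \<nu> v (ax x) $ z = - r * v $ y" "r \<noteq> 0"
  shows "\<exists>c. \<forall>p. frame_gradient f p $ y = c"
proof -
  have s: "smooth_fun f" using sol unfolding gradient_laplacian_soliton_def by blast
  define F where "F = frame_gradient f"
  define F' where "F' = (\<lambda>p. frechet_derivative F (at p))"
  define C where "C = (\<lambda>a. deformation f 0 (ax a) $ z + deformation f 0 (ax z) $ a)"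
  have dF: "(F has_derivative F' p) (at p)" for p
    unfolding F_def F'_def by (rule frame_gradient_has_derivative[OF s])
  have linF: "linear (\<lambda>x. F' p (\<Psi> p x))" for p
    using linear_compose[OF linear_Psi has_derivative_linear[OF dF]] by (simp add: comp_def)
  have comm: "F' p (\<Psi> p x) \<bullet> w - F' p (\<Psi> p w) \<bullet> x = F p \<bullet> \<nu> x w" for p x w
    unfolding F_def F'_def by (rule frame_gradient_commutator[OF s])
  \<comment> \<open>The frame derivatives of the component \<open>F\<^sub>z\<close>.\<close>
  define U where "U = (\<lambda>q. \<chi> a. (C a + \<nu> (F q) (ax a) $ z) / 2)"
  have Uz: "F' q (\<Psi> q (ax a)) $ z = U q $ a" and Uz': "F' q (\<Psi> q (ax z)) $ a = U q $ a" for q a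
  proof -
    have "F' q (\<Psi> q (ax a)) $ z = F' q (\<Psi> q (ax z)) $ a"
      using comm[of q "ax a" "ax z"] by (simp add: central inner_axis)
    moreover have "F' q (\<Psi> q (ax a)) $ z - \<nu> (F q) (ax a) $ z + F' q (\<Psi> q (ax z)) $ a = C a"
      using deformation_symmetric_part_constant[OF assms(1) sol, of q a z]
      by (simp add: C_def deformation_def F_def F'_def central)
    ultimately show "F' q (\<Psi> q (ax a)) $ z = U q $ a" "F' q (\<Psi> q (ax z)) $ a = U q $ a"
      by (simp_all add: U_def)
  qed
  have du: "((\<lambda>q. F q $ z) has_derivative (\<lambda>v. U q \<bullet> \<Phi> q v)) (at q)" for q
  proof -
    have "F' q v $ z = U q \<bullet> \<Phi> q v" for v
    proof -
      have "linear (\<lambda>x. F' q (\<Psi> q x) $ z)"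
        using linear_compose[OF linF bounded_linear.linear[OF bounded_linear_vec_nth]] by (simp add: comp_def)
      from linear_axis_expand[OF this, of "\<Phi> q v"] show ?thesis
        by (simp add: Psi_Phi Uz inner_vec_def ac_simps)
    qed
    then show ?thesis
      using bounded_linear.has_derivative[OF bounded_linear_vec_nth dF, of z q] by simp
  qed
  have lnu: "bounded_linear (\<lambda>v. \<nu> v w $ a)" for w a
    using linear_compose[OF _ bounded_linear.linear[OF bounded_linear_vec_nth], of "\<lambda>v. \<nu> v w"] bilinear_nu
    unfolding linear_conv_bounded_linear[symmetric] by (simp add: bilinear_def comp_def)
  have dU: "(U has_derivative (\<lambda>v. \<chi> a. \<nu> (F' p v) (ax a) $ z / 2)) (at p)" for p
    unfolding U_def
    by (intro has_derivative_vecI)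
      (auto intro!: derivative_eq_intros bounded_linear.has_derivative[OF lnu dF])
  have Fy: "F p $ y = C x / r" for p
  proof -
    have "\<nu> (F' p (\<Psi> p (ax z))) (ax y) $ z / 2 - \<nu> (F' p (\<Psi> p (ax y))) (ax z) $ z / 2 = 0"
      using commutator[OF du dU, of p "ax z" "ax y"] nu_anti[of "ax z" "ax y"] by (simp add: central inner_axis)
    then have "F' p (\<Psi> p (ax z)) $ x = 0" by (simp add: central pair)
    then show ?thesis using pair(3) by (simp add: Uz' U_def pair(2) field_simps)
  qed
  then show ?thesis unfolding F_def by blast
qed

lemma frame_gradient_pair_constant:
  assumes "ce \<nu> g2_model = (\<lambda>vs. 0)" "gradient_laplacian_soliton (invariant g2_model) f lam"
    and "\<And>v. \<nu> v (ax z) = 0" "\<And>v. \<nu> v (ax y) $ z = r * v $ x" "\<And>v. \<nu> v (ax x) $ z = - r * v $ y" "r \<noteq> 0"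
  shows "\<exists>c. \<forall>p. frame_gradient f p $ x = c" "\<exists>c. \<forall>p. frame_gradient f p $ y = c"
  using frame_gradient_constant[OF assms(1-3), of x "- r" y] frame_gradient_constant[OF assms(1-3), of y r x]
    assms(4-6) by simp_all

lemma frame_gradient_bracket_zero:
  assumes "smooth_fun f" "\<exists>c. \<forall>p. frame_gradient f p $ x = c" "\<exists>c. \<forall>p. frame_gradient f p $ y = c"
    and "\<nu> (ax x) (ax y) = r *\<^sub>R ax z" "r \<noteq> 0"
  shows "\<exists>c. \<forall>p. frame_gradient f p $ z = c"
proof -
  have "frame_gradient f p $ z = 0" for p
    using frame_gradient_commutator[OF assms(1), of p "ax x" "ax y"] frame_derivative_zero[OF assms(1)]
      assms(2-5) by (auto simp: inner_axis)
  then show ?thesis by blast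
qed

text \<open>
  Replacing one vector of a line leaves only its own coefficient, because two points determine the
  line. So the form sees only the diagonal of the deformation, which is zero here.
\<close>

lemma laplacian_on_line:
  assumes "ce \<nu> g2_model = (\<lambda>vs. 0)" "gradient_laplacian_soliton (invariant g2_model) f lam"
    and const: "\<And>i. i \<in> {a, b, c} \<Longrightarrow> \<exists>c. \<forall>p. frame_gradient f p $ i = c"
    and diag: "\<And>i v. i \<in> {a, b, c} \<Longrightarrow> \<nu> v (ax i) $ i = 0"
    and line: "\<And>v. g2_model [v, ax b, ax c] = s * v $ a" "\<And>v. g2_model [ax a, v, ax c] = s * v $ b"
      "\<And>v. g2_model [ax a, ax b, v] = s * v $ c"
  shows "- ce \<nu> torsion [ax a, ax b, ax c] = lam * s"
proof -
  have sm: "smooth_fun f" using assms(2) unfolding gradient_laplacian_soliton_def by blast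
  have "deformation f p (ax i) $ i = 0" if "i \<in> {a, b, c}" for p i
    using const[OF that] diag[OF that] frame_derivative_zero[OF sm] unfolding deformation_def by auto
  then have "derivation (deformation f 0) g2_model [ax a, ax b, ax c] = 0" by (simp add: line)
  moreover have "g2_model [ax a, ax b, ax c] = s" by (simp add: line)
  ultimately show ?thesis using soliton_equation[OF assms(1,2), of 0 "[ax a, ax b, ax c]"] by simp
qed

end

section \<open>Evaluation on basis vectors\<close>

lemma ax_nth: "ax i $ j = (if i = j then 1 else 0)"
  by (simp add: axis_def)

text \<open>
  The numerals of the type \<open>7\<close> as natural numbers, whose order the simplifier can decide.
\<close>

definition index :: "7 \<Rightarrow> nat" where
  "index i = (if i = 1 then 1 else if i = 2 then 2 else if i = 3 then 3 else if i = 4 then 4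
     else if i = 5 then 5 else if i = 6 then 6 else 7)"

lemma of_nat_index: "of_nat (index i) = i"
  using exhaust_7[of i] by (elim disjE) (simp_all add: index_def)

lemma set_indices: "set [1,2,3,4,5,6,7] = (UNIV :: 7 set)"
  using exhaust_7 by auto

text \<open>
  The complementary indices in increasing order, so that the star operator on basis vectors becomes
  computable.
\<close>

definition complement :: "7 list \<Rightarrow> 7 list" where
  "complement J = filter (\<lambda>i. i \<notin> set J) [1,2,3,4,5,6,7]"

lemma std_vol_permuted_axes:
  assumes "mset L = mset [1,2,3,4,5,6,7]"
  shows "std_vol (map ax L) = (-1) ^ inversions (map index L)"
proof -
  have "mset (map index L) = mset [1,2,3,4,5,6,7]"
    using arg_cong[OF assms, of "image_mset index"] by (simp add: index_def)
  then have "sort (map index L) = sort [1,2,3,4,5,6,7]"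
    by (metis mset_sort properties_for_sort sorted_sort)
  then have "map (\<lambda>n. ax (of_nat n)) (sort (map index L)) = map ax [1,2,3,4,5,6,7]" by simp
  then have "std_vol (map (\<lambda>n. ax (of_nat n)) (sort (map index L))) = 1"
    by (simp only: std_vol_axes)
  moreover have "std_vol (map (\<lambda>n. ax (of_nat n)) (map index L)) =
      (-1) ^ inversions (map index L) * std_vol (map (\<lambda>n. ax (of_nat n)) (sort (map index L)))"
    by (rule alternating_sort[OF alternating_map[OF e_alternating]])
  moreover have "map (\<lambda>n. ax (of_nat n)) (map index L) = map ax L"
    by (simp add: of_nat_index)
  ultimately show ?thesis by (simp only: mult_1_right)
qed

lemma hodge_model_complement:
  assumes "is_form k \<alpha>" "distinct J" "length J + k = 7"
  shows "hodge_model k \<alpha> (map ax J) =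
    (-1) ^ inversions (map index (complement J @ J)) * \<alpha> (map ax (complement J))"
proof -
  have "set (complement J) = - set J" unfolding complement_def set_filter set_indices by auto
  moreover have d: "distinct (complement J)" by (simp add: complement_def)
  ultimately have "length (complement J) = 7 - length J"
    using distinct_card[OF d] distinct_card[OF assms(2)] by (simp add: Compl_eq_Diff_UNIV card_Diff_subset)
  then have l: "length (complement J) = k" using assms(3) by simp
  moreover have "distinct (complement J @ J)" using d assms(2) by (auto simp: complement_def)
  ultimately have m: "mset (complement J @ J) = mset [1,2,3,4,5,6,7]"
    unfolding mset_indices_iff using assms(3) by simp
  show ?thesis
    using hodge_model_axes[OF assms(1) l m] std_vol_permuted_axes[OF m] by simp
qed

lemma form_zeroI_increasing:
  assumes "is_form k \<alpha>"
    and "\<And>I. I \<in> set (subseqs [1,2,3,4,5,6,7]) \<Longrightarrow> length I = k \<Longrightarrow> \<alpha> (map ax I) = 0"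
  shows "\<alpha> = (\<lambda>vs. 0)"
proof (rule form_eqI_axis[OF assms(1) is_form_zero])
  fix J :: "7 list" assume J: "length J = k"
  have alt: "alternating (\<lambda>I. \<alpha> (map ax I))" by (rule alternating_map[OF is_form_alternating[OF assms(1)]])
  show "\<alpha> (map ax J) = 0"
  proof (cases "distinct J")
    case True
    obtain L :: "7 list" where L: "L = [1,2,3,4,5,6,7]" by blast
    have "set J \<in> set ` set (subseqs L)"
      by (rule subset_subseqs) (simp only: L set_indices subset_UNIV)
    then obtain I where I: "I \<in> set (subseqs L)" "set I = set J" by auto
    have "distinct I" by (rule subseqs_distinctD[OF I(1)]) (simp add: L)
    then have m: "mset J = mset I"
      using True I(2) by (intro set_eq_iff_mset_eq_distinct[THEN iffD1]) simp_all
    have "\<alpha> (map ax I) = 0" using assms(2)[OF I(1)[unfolded L]] mset_eq_length[OF m] J by simp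
    then show ?thesis using alternating_mset_product[OF alt alt m] by simp
  next
    case False
    then show ?thesis by (rule alternating_not_distinct[OF alt])
  qed
qed

text \<open>
  The 4-form \<open>*\<phi>\<close> of the model form \<open>\<phi>\<close>.
\<close>

abbreviation psi :: form where "psi \<equiv> hodge_model 3 g2_model"

lemma is_form_psi: "is_form 4 psi"
  by (rule is_form_hodge_model) simp

lemma psi_axes:
  "psi [ax a, ax b, ax c, ax d] = (if distinct [a, b, c, d]
    then (-1) ^ inversions (map index (complement [a, b, c, d] @ [a, b, c, d])) *
      g2_model (map ax (complement [a, b, c, d])) else 0)"
  using hodge_model_complement[OF is_form_g2_model, of "[a, b, c, d]"]
    alternating_not_distinct[OF alternating_map[OF is_form_alternating[OF is_form_psi]], of "[a, b, c, d]" ax]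
  by simp

lemma hodge_5_axes:
  assumes "is_form 5 \<alpha>"
  shows "hodge_model 5 \<alpha> [ax a, ax b] = (if a = b then 0
    else (-1) ^ inversions (map index (complement [a, b] @ [a, b])) * \<alpha> (map ax (complement [a, b])))"
  using hodge_model_complement[OF assms, of "[a, b]"]
    alternating_not_distinct[OF alternating_map[OF is_form_alternating[OF is_form_hodge_model[of 5 2]]], of "[a, b]" _ ax]
  by simp

lemma psi_scale:
  "psi [r *\<^sub>R v, x, y, z] = r * psi [v, x, y, z]" "psi [x, r *\<^sub>R v, y, z] = r * psi [x, v, y, z]"
  "psi [x, y, r *\<^sub>R v, z] = r * psi [x, y, v, z]" "psi [x, y, z, r *\<^sub>R v] = r * psi [x, y, z, v]"
  "psi [- v, x, y, z] = - psi [v, x, y, z]" "psi [x, - v, y, z] = - psi [x, v, y, z]"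
  "psi [x, y, - v, z] = - psi [x, y, v, z]" "psi [x, y, z, - v] = - psi [x, y, z, v]"
  "psi [0, x, y, z] = 0" "psi [x, 0, y, z] = 0" "psi [x, y, 0, z] = 0" "psi [x, y, z, 0] = 0"
proof -
  note l = is_form_linear_weak[OF is_form_psi, of "[]" "[x, y, z]"]
    is_form_linear_weak[OF is_form_psi, of "[x]" "[y, z]"]
    is_form_linear_weak[OF is_form_psi, of "[x, y]" "[z]"]
    is_form_linear_weak[OF is_form_psi, of "[x, y, z]" "[]"]
  show "psi [r *\<^sub>R v, x, y, z] = r * psi [v, x, y, z]" "psi [x, r *\<^sub>R v, y, z] = r * psi [x, v, y, z]"
    "psi [x, y, r *\<^sub>R v, z] = r * psi [x, y, v, z]" "psi [x, y, z, r *\<^sub>R v] = r * psi [x, y, z, v]"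
    using l[THEN linear_cmul] by simp_all
  show "psi [- v, x, y, z] = - psi [v, x, y, z]" "psi [x, - v, y, z] = - psi [x, v, y, z]"
    "psi [x, y, - v, z] = - psi [x, y, v, z]" "psi [x, y, z, - v] = - psi [x, y, z, v]"
    using l[THEN linear_neg] by simp_all
  show "psi [0, x, y, z] = 0" "psi [x, 0, y, z] = 0" "psi [x, y, 0, z] = 0" "psi [x, y, z, 0] = 0"
    using l[THEN linear_0] by simp_all
qed

lemma g2_model_scale:
  "g2_model [r *\<^sub>R v, x, y] = r * g2_model [v, x, y]" "g2_model [x, r *\<^sub>R v, y] = r * g2_model [x, v, y]"
  "g2_model [x, y, r *\<^sub>R v] = r * g2_model [x, y, v]"
  "g2_model [- v, x, y] = - g2_model [v, x, y]" "g2_model [x, - v, y] = - g2_model [x, v, y]"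
  "g2_model [x, y, - v] = - g2_model [x, y, v]"
  "g2_model [0, x, y] = 0" "g2_model [x, 0, y] = 0" "g2_model [x, y, 0] = 0"
proof -
  note l = is_form_linear_weak[OF is_form_g2_model, of "[]" "[x, y]"]
    is_form_linear_weak[OF is_form_g2_model, of "[x]" "[y]"]
    is_form_linear_weak[OF is_form_g2_model, of "[x, y]" "[]"]
  show "g2_model [r *\<^sub>R v, x, y] = r * g2_model [v, x, y]" "g2_model [x, r *\<^sub>R v, y] = r * g2_model [x, v, y]"
    "g2_model [x, y, r *\<^sub>R v] = r * g2_model [x, y, v]"
    using l[THEN linear_cmul] by simp_all
  show "g2_model [- v, x, y] = - g2_model [v, x, y]" "g2_model [x, - v, y] = - g2_model [x, v, y]"
    "g2_model [x, y, - v] = - g2_model [x, y, v]"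
    using l[THEN linear_neg] by simp_all
  show "g2_model [0, x, y] = 0" "g2_model [x, 0, y] = 0" "g2_model [x, y, 0] = 0"
    using l[THEN linear_0] by simp_all
qed

lemmas g2_model_axes = g2_model_explicit[of "ax a" "ax b" "ax c" for a b c]

lemma sqrt_mult_left: "0 \<le> a \<Longrightarrow> sqrt a * (sqrt a * x) = a * x"
  by (simp add: mult.assoc[symmetric])

context coframe
begin

lemma is_form_ce_psi: "is_form 5 (ce \<nu> psi)"
  using is_form_ce[OF is_form_psi bilinear_nu nu_anti] by simp

lemma torsion_axes:
  "torsion [ax a, ax b] = (if a = b then 0
    else (-1) ^ inversions (map index (complement [a, b] @ [a, b])) * ce \<nu> psi (map ax (complement [a, b])))"
  unfolding torsion_def by (rule hodge_5_axes[OF is_form_ce_psi])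

lemma torsion_scale:
  "torsion [r *\<^sub>R v, x] = r * torsion [v, x]" "torsion [x, r *\<^sub>R v] = r * torsion [x, v]"
  "torsion [- v, x] = - torsion [v, x]" "torsion [x, - v] = - torsion [x, v]"
  "torsion [0, x] = 0" "torsion [x, 0] = 0"
proof -
  note l = is_form_linear_weak[OF is_form_torsion, of "[]" "[x]"]
    is_form_linear_weak[OF is_form_torsion, of "[x]" "[]"]
  show "torsion [r *\<^sub>R v, x] = r * torsion [v, x]" "torsion [x, r *\<^sub>R v] = r * torsion [x, v]"
    using l[THEN linear_cmul] by simp_all
  show "torsion [- v, x] = - torsion [v, x]" "torsion [x, - v] = - torsion [x, v]"
    using l[THEN linear_neg] by simp_all
  show "torsion [0, x] = 0" "torsion [x, 0] = 0"
    using l[THEN linear_0] by simp_all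
qed

lemma closedI:
  assumes "list_all (\<lambda>I. ce \<nu> g2_model (map ax I) = 0)
    (filter (\<lambda>I. length I = 4) (subseqs [1,2,3,4,5,6,7]))"
  shows "ce \<nu> g2_model = (\<lambda>vs. 0)"
proof (rule form_zeroI_increasing[where k = 4])
  show "is_form 4 (ce \<nu> g2_model)"
    using is_form_ce[OF is_form_g2_model bilinear_nu nu_anti] by simp
  show "ce \<nu> g2_model (map ax I) = 0"
    if "I \<in> set (subseqs [1,2,3,4,5,6,7])" "length I = 4" for I
    using assms that unfolding list_all_iff set_filter by blast
qed

end

section \<open>The six non-abelian algebras in adapted coframes\<close>

text \<open>
  In each algebra the frame derivatives of \<open>f\<close> are shown to be constant along the points of two lines
  of the Fano plane: first for pairs whose bracket has a component along a central direction, then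
  for brackets of such pairs. On the first line the Laplacian is a positive multiple of \<open>s\<^sup>2\<close>; the
  vectors of the second line commute.
\<close>

context coframe
begin

definition fano_line :: "7 \<Rightarrow> 7 \<Rightarrow> 7 \<Rightarrow> real \<Rightarrow> bool" where
  "fano_line a b c s \<longleftrightarrow> (\<forall>v. g2_model [v, ax b, ax c] = s * v $ a \<and>
     g2_model [ax a, v, ax c] = s * v $ b \<and> g2_model [ax a, ax b, v] = s * v $ c)"

abbreviation constant_component :: "(real^7 \<Rightarrow> real) \<Rightarrow> 7 \<Rightarrow> bool" where
  "constant_component f k \<equiv> \<exists>c. \<forall>p. frame_gradient f p $ k = c"

lemma two_lines_contradiction:
  assumes "ce \<nu> g2_model = (\<lambda>vs. 0)" "gradient_laplacian_soliton (invariant g2_model) f lam"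
    and "\<And>i. i \<in> {a, b, c} \<union> {a', b', c'} \<Longrightarrow> constant_component f i"
    and "\<And>i v. \<nu> v (ax i) $ i = 0"
    and "fano_line a b c s" "fano_line a' b' c' s'" "s' \<noteq> 0"
    and "ce \<nu> torsion [ax a, ax b, ax c] \<noteq> 0" "ce \<nu> torsion [ax a', ax b', ax c'] = 0"
  shows False
proof -
  have "- ce \<nu> torsion [ax a', ax b', ax c'] = lam * s'"
    by (rule laplacian_on_line[OF assms(1,2)]) (use assms(3,4,6) in \<open>auto simp: fano_line_def\<close>)
  then have "lam = 0" using assms(7,9) by (simp del: ce.simps)
  moreover have "- ce \<nu> torsion [ax a, ax b, ax c] = lam * s"
    by (rule laplacian_on_line[OF assms(1,2)]) (use assms(3,4,5) in \<open>auto simp: fano_line_def\<close>)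
  ultimately show False using assms(8) by (simp del: ce.simps)
qed

lemmas torsion_rules = torsion_scale torsion_axes psi_scale psi_axes complement_def index_def
  g2_model_axes e_3 ax_nth

lemma not_gradient_n2:
  assumes nu: "\<And>x y. \<nu> x y = s *\<^sub>R bracket_of [(1,2,3,-1), (1,7,5,-1)] x y" and s: "s \<noteq> 0"
  shows "\<not> gradient_laplacian_soliton (invariant g2_model) f lam"
proof
  assume sol: "gradient_laplacian_soliton (invariant g2_model) f lam"
  then have smooth: "smooth_fun f" unfolding gradient_laplacian_soliton_def by blast
  note br = nu bracket_of_def ax_nth
  have closed: "ce \<nu> g2_model = (\<lambda>vs. 0)"
    by (rule closedI) (simp add: Let_def br g2_model_scale g2_model_axes e_3; simp add: algebra_simps)
  have c312: "constant_component f 1" "constant_component f 2"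
    by (rule frame_gradient_pair_constant[OF closed sol, where z = 3 and x = 1 and y = 2 and r = "- s"];
        use s in \<open>simp add: br algebra_simps\<close>)+
  have c517: "constant_component f 1" "constant_component f 7"
    by (rule frame_gradient_pair_constant[OF closed sol, where z = 5 and x = 1 and y = 7 and r = "- s"];
        use s in \<open>simp add: br algebra_simps\<close>)+
  have z3: "constant_component f 3"
    by (rule frame_gradient_bracket_zero[OF smooth c312(1) c312(2), where r = "- s"])
      (use s in \<open>simp_all add: br algebra_simps\<close>)
  have z5: "constant_component f 5"
    by (rule frame_gradient_bracket_zero[OF smooth c312(1) c517(2), where r = "- s"])
      (use s in \<open>simp_all add: br algebra_simps\<close>)
  have "- ce \<nu> torsion [ax 1, ax 2, ax 7] = 2 * s\<^sup>2"
    by (simp add: torsion_rules br; simp add: power2_eq_square algebra_simps sqrt_mult_left)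
  moreover have "2 > (0::real)" by simp
  ultimately have "ce \<nu> torsion [ax 1, ax 2, ax 7] \<noteq> 0" using s by (auto simp del: ce.simps)
  moreover have "ce \<nu> torsion [ax 1, ax 3, ax 5] = 0" by (simp add: torsion_rules br)
  moreover have "fano_line 1 2 7 (1)" "fano_line 1 3 5 (1)"
    by (simp_all add: fano_line_def g2_model_explicit e_3 ax_nth)
  moreover have "\<nu> v (ax i) $ i = 0" for i v
  proof -
    have "\<forall>i. \<nu> v (ax i) $ i = 0" unfolding forall_7 by (simp add: br)
    then show ?thesis ..
  qed
  ultimately show False
    using two_lines_contradiction[OF closed sol, of 1 2 7 1 3 5 "1" "1"] c312 c517 z3 z5 by auto
qed

lemma not_gradient_n3:
  assumes nu: "\<And>x y. \<nu> x y = s *\<^sub>R bracket_of [(1,2,6,-1), (1,7,4,-(1-c)), (2,7,3,-c)] x y" and s: "s \<noteq> 0"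
    and c: "0 < c" "c < 1/2"
  shows "\<not> gradient_laplacian_soliton (invariant g2_model) f lam"
proof
  assume sol: "gradient_laplacian_soliton (invariant g2_model) f lam"
  then have smooth: "smooth_fun f" unfolding gradient_laplacian_soliton_def by blast
  note br = nu bracket_of_def ax_nth
  have closed: "ce \<nu> g2_model = (\<lambda>vs. 0)"
    by (rule closedI) (simp add: Let_def br g2_model_scale g2_model_axes e_3; simp add: algebra_simps)
  have c612: "constant_component f 1" "constant_component f 2"
    by (rule frame_gradient_pair_constant[OF closed sol, where z = 6 and x = 1 and y = 2 and r = "- s"];
        use s c in \<open>simp add: br algebra_simps\<close>)+
  have c417: "constant_component f 1" "constant_component f 7"
    by (rule frame_gradient_pair_constant[OF closed sol, where z = 4 and x = 1 and y = 7 and r = "- s * (1 - c)"];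
        use s c in \<open>simp add: br algebra_simps\<close>)+
  have z6: "constant_component f 6"
    by (rule frame_gradient_bracket_zero[OF smooth c612(1) c612(2), where r = "- s"])
      (use s c in \<open>simp_all add: br algebra_simps\<close>)
  have z4: "constant_component f 4"
    by (rule frame_gradient_bracket_zero[OF smooth c612(1) c417(2), where r = "- s * (1 - c)"])
      (use s c in \<open>simp_all add: br algebra_simps\<close>)
  have "- ce \<nu> torsion [ax 1, ax 2, ax 7] = (1 + (1 - c)\<^sup>2 + c\<^sup>2) * s\<^sup>2"
    by (simp add: torsion_rules br; simp add: power2_eq_square algebra_simps sqrt_mult_left)
  moreover have "(1 + (1 - c)\<^sup>2 + c\<^sup>2) > (0::real)" by (simp add: add_pos_nonneg)
  ultimately have "ce \<nu> torsion [ax 1, ax 2, ax 7] \<noteq> 0" using s by (auto simp del: ce.simps)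
  moreover have "ce \<nu> torsion [ax 1, ax 4, ax 6] = 0" by (simp add: torsion_rules br)
  moreover have "fano_line 1 2 7 (1)" "fano_line 1 4 6 (- 1)"
    by (simp_all add: fano_line_def g2_model_explicit e_3 ax_nth)
  moreover have "\<nu> v (ax i) $ i = 0" for i v
  proof -
    have "\<forall>i. \<nu> v (ax i) $ i = 0" unfolding forall_7 by (simp add: br)
    then show ?thesis ..
  qed
  ultimately show False
    using two_lines_contradiction[OF closed sol, of 1 2 7 1 4 6 "1" "- 1"] c612 c417 z6 z4 by auto
qed

lemma not_gradient_n4:
  assumes nu: "\<And>x y. \<nu> x y = s *\<^sub>R bracket_of [(1,2,3,-sqrt 2), (1,3,6,-1), (2,7,6,sqrt 2), (1,5,4,-1)] x y" and s: "s \<noteq> 0"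
  shows "\<not> gradient_laplacian_soliton (invariant g2_model) f lam"
proof
  assume sol: "gradient_laplacian_soliton (invariant g2_model) f lam"
  then have smooth: "smooth_fun f" unfolding gradient_laplacian_soliton_def by blast
  note br = nu bracket_of_def ax_nth
  have closed: "ce \<nu> g2_model = (\<lambda>vs. 0)"
    by (rule closedI) (simp add: Let_def br g2_model_scale g2_model_axes e_3; simp add: algebra_simps)
  have c613: "constant_component f 1" "constant_component f 3"
    by (rule frame_gradient_pair_constant[OF closed sol, where z = 6 and x = 1 and y = 3 and r = "- s"];
        use s in \<open>simp add: br algebra_simps\<close>)+
  have c627: "constant_component f 2" "constant_component f 7"
    by (rule frame_gradient_pair_constant[OF closed sol, where z = 6 and x = 2 and y = 7 and r = "s * sqrt 2"];
        use s in \<open>simp add: br algebra_simps\<close>)+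
  have z6: "constant_component f 6"
    by (rule frame_gradient_bracket_zero[OF smooth c613(1) c613(2), where r = "- s"])
      (use s in \<open>simp_all add: br algebra_simps\<close>)
  have "- ce \<nu> torsion [ax 1, ax 2, ax 7] = 4 * s\<^sup>2"
    by (simp add: torsion_rules br; simp add: power2_eq_square algebra_simps sqrt_mult_left)
  moreover have "4 > (0::real)" by simp
  ultimately have "ce \<nu> torsion [ax 1, ax 2, ax 7] \<noteq> 0" using s by (auto simp del: ce.simps)
  moreover have "ce \<nu> torsion [ax 2, ax 3, ax 6] = 0" by (simp add: torsion_rules br)
  moreover have "fano_line 1 2 7 (1)" "fano_line 2 3 6 (- 1)"
    by (simp_all add: fano_line_def g2_model_explicit e_3 ax_nth)
  moreover have "\<nu> v (ax i) $ i = 0" for i v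
  proof -
    have "\<forall>i. \<nu> v (ax i) $ i = 0" unfolding forall_7 by (simp add: br)
    then show ?thesis ..
  qed
  ultimately show False
    using two_lines_contradiction[OF closed sol, of 1 2 7 2 3 6 "1" "- 1"] c613 c627 z6 by auto
qed

lemma not_gradient_n5:
  assumes nu: "\<And>x y. \<nu> x y = s *\<^sub>R bracket_of [(1,5,2,-sqrt 2), (1,2,6,-1), (1,7,4,-1), (5,3,4,-sqrt 2)] x y" and s: "s \<noteq> 0"
  shows "\<not> gradient_laplacian_soliton (invariant g2_model) f lam"
proof
  assume sol: "gradient_laplacian_soliton (invariant g2_model) f lam"
  then have smooth: "smooth_fun f" unfolding gradient_laplacian_soliton_def by blast
  note br = nu bracket_of_def ax_nth
  have closed: "ce \<nu> g2_model = (\<lambda>vs. 0)"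
    by (rule closedI) (simp add: Let_def br g2_model_scale g2_model_axes e_3; simp add: algebra_simps)
  have c612: "constant_component f 1" "constant_component f 2"
    by (rule frame_gradient_pair_constant[OF closed sol, where z = 6 and x = 1 and y = 2 and r = "- s"];
        use s in \<open>simp add: br algebra_simps\<close>)+
  have c417: "constant_component f 1" "constant_component f 7"
    by (rule frame_gradient_pair_constant[OF closed sol, where z = 4 and x = 1 and y = 7 and r = "- s"];
        use s in \<open>simp add: br algebra_simps\<close>)+
  have c453: "constant_component f 5" "constant_component f 3"
    by (rule frame_gradient_pair_constant[OF closed sol, where z = 4 and x = 5 and y = 3 and r = "- s * sqrt 2"];
        use s in \<open>simp add: br algebra_simps\<close>)+
  have z6: "constant_component f 6"
    by (rule frame_gradient_bracket_zero[OF smooth c612(1) c612(2), where r = "- s"])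
      (use s in \<open>simp_all add: br algebra_simps\<close>)
  have "- ce \<nu> torsion [ax 1, ax 2, ax 7] = 2 * s\<^sup>2"
    by (simp add: torsion_rules br; simp add: power2_eq_square algebra_simps sqrt_mult_left)
  moreover have "2 > (0::real)" by simp
  ultimately have "ce \<nu> torsion [ax 1, ax 2, ax 7] \<noteq> 0" using s by (auto simp del: ce.simps)
  moreover have "ce \<nu> torsion [ax 2, ax 3, ax 6] = 0" by (simp add: torsion_rules br)
  moreover have "fano_line 1 2 7 (1)" "fano_line 2 3 6 (- 1)"
    by (simp_all add: fano_line_def g2_model_explicit e_3 ax_nth)
  moreover have "\<nu> v (ax i) $ i = 0" for i v
  proof -
    have "\<forall>i. \<nu> v (ax i) $ i = 0" unfolding forall_7 by (simp add: br)
    then show ?thesis ..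
  qed
  ultimately show False
    using two_lines_contradiction[OF closed sol, of 1 2 7 2 3 6 "1" "- 1"] c612 c417 c453 z6 by auto
qed

lemma not_gradient_n6:
  assumes nu: "\<And>x y. \<nu> x y = s *\<^sub>R bracket_of [(1,2,3,-sqrt 2), (1,7,5,-sqrt 2), (1,3,6,-1), (1,5,4,-1)] x y" and s: "s \<noteq> 0"
  shows "\<not> gradient_laplacian_soliton (invariant g2_model) f lam"
proof
  assume sol: "gradient_laplacian_soliton (invariant g2_model) f lam"
  then have smooth: "smooth_fun f" unfolding gradient_laplacian_soliton_def by blast
  note br = nu bracket_of_def ax_nth
  have closed: "ce \<nu> g2_model = (\<lambda>vs. 0)"
    by (rule closedI) (simp add: Let_def br g2_model_scale g2_model_axes e_3; simp add: algebra_simps)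
  have c613: "constant_component f 1" "constant_component f 3"
    by (rule frame_gradient_pair_constant[OF closed sol, where z = 6 and x = 1 and y = 3 and r = "- s"];
        use s in \<open>simp add: br algebra_simps\<close>)+
  have c415: "constant_component f 1" "constant_component f 5"
    by (rule frame_gradient_pair_constant[OF closed sol, where z = 4 and x = 1 and y = 5 and r = "- s"];
        use s in \<open>simp add: br algebra_simps\<close>)+
  have z6: "constant_component f 6"
    by (rule frame_gradient_bracket_zero[OF smooth c613(1) c613(2), where r = "- s"])
      (use s in \<open>simp_all add: br algebra_simps\<close>)
  have z4: "constant_component f 4"
    by (rule frame_gradient_bracket_zero[OF smooth c613(1) c415(2), where r = "- s"])
      (use s in \<open>simp_all add: br algebra_simps\<close>)
  have "- ce \<nu> torsion [ax 1, ax 3, ax 5] = 2 * s\<^sup>2"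
    by (simp add: torsion_rules br; simp add: power2_eq_square algebra_simps sqrt_mult_left)
  moreover have "2 > (0::real)" by simp
  ultimately have "ce \<nu> torsion [ax 1, ax 3, ax 5] \<noteq> 0" using s by (auto simp del: ce.simps)
  moreover have "ce \<nu> torsion [ax 1, ax 4, ax 6] = 0" by (simp add: torsion_rules br)
  moreover have "fano_line 1 3 5 (1)" "fano_line 1 4 6 (- 1)"
    by (simp_all add: fano_line_def g2_model_explicit e_3 ax_nth)
  moreover have "\<nu> v (ax i) $ i = 0" for i v
  proof -
    have "\<forall>i. \<nu> v (ax i) $ i = 0" unfolding forall_7 by (simp add: br)
    then show ?thesis ..
  qed
  ultimately show False
    using two_lines_contradiction[OF closed sol, of 1 3 5 1 4 6 "1" "- 1"] c613 c415 z6 z4 by auto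
qed

lemma not_gradient_n7:
  assumes nu: "\<And>x y. \<nu> x y = s *\<^sub>R bracket_of [(1,2,4,4), (2,7,5,-2), (1,7,6,-2), (5,7,3,-sqrt 6), (6,7,4,-sqrt 6)] x y" and s: "s \<noteq> 0"
  shows "\<not> gradient_laplacian_soliton (invariant g2_model) f lam"
proof
  assume sol: "gradient_laplacian_soliton (invariant g2_model) f lam"
  then have smooth: "smooth_fun f" unfolding gradient_laplacian_soliton_def by blast
  note br = nu bracket_of_def ax_nth
  have closed: "ce \<nu> g2_model = (\<lambda>vs. 0)"
    by (rule closedI) (simp add: Let_def br g2_model_scale g2_model_axes e_3; simp add: algebra_simps)
  have c412: "constant_component f 1" "constant_component f 2"
    by (rule frame_gradient_pair_constant[OF closed sol, where z = 4 and x = 1 and y = 2 and r = "s * 4"];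
        use s in \<open>simp add: br algebra_simps\<close>)+
  have c467: "constant_component f 6" "constant_component f 7"
    by (rule frame_gradient_pair_constant[OF closed sol, where z = 4 and x = 6 and y = 7 and r = "- s * sqrt 6"];
        use s in \<open>simp add: br algebra_simps\<close>)+
  have c357: "constant_component f 5" "constant_component f 7"
    by (rule frame_gradient_pair_constant[OF closed sol, where z = 3 and x = 5 and y = 7 and r = "- s * sqrt 6"];
        use s in \<open>simp add: br algebra_simps\<close>)+
  have z3: "constant_component f 3"
    by (rule frame_gradient_bracket_zero[OF smooth c357(1) c467(2), where r = "- s * sqrt 6"])
      (use s in \<open>simp_all add: br algebra_simps\<close>)
  have "- ce \<nu> torsion [ax 1, ax 2, ax 7] = 24 * s\<^sup>2"
    by (simp add: torsion_rules br; simp add: power2_eq_square algebra_simps sqrt_mult_left)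
  moreover have "24 > (0::real)" by simp
  ultimately have "ce \<nu> torsion [ax 1, ax 2, ax 7] \<noteq> 0" using s by (auto simp del: ce.simps)
  moreover have "ce \<nu> torsion [ax 2, ax 3, ax 6] = 0" by (simp add: torsion_rules br)
  moreover have "fano_line 1 2 7 (1)" "fano_line 2 3 6 (- 1)"
    by (simp_all add: fano_line_def g2_model_explicit e_3 ax_nth)
  moreover have "\<nu> v (ax i) $ i = 0" for i v
  proof -
    have "\<forall>i. \<nu> v (ax i) $ i = 0" unfolding forall_7 by (simp add: br)
    then show ?thesis ..
  qed
  ultimately show False
    using two_lines_contradiction[OF closed sol, of 1 2 7 2 3 6 "1" "- 1"] c412 c467 c357 z3 by auto
qed

end

section \<open>From the group to the coframe\<close>

context three_step
begin

text \<open>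
  The derivative at \<open>p\<close> of left translation by \<open>- p\<close>, that is, the left Maurer--Cartan form in the
  exponential chart.
\<close>

definition coframe_at :: "real^7 \<Rightarrow> real^7 \<Rightarrow> real^7" where
  "coframe_at p v = v - (1/2) *\<^sub>R \<mu> p v + (1/6) *\<^sub>R \<mu> p (\<mu> p v)"

lemma linear_coframe_at: "linear (coframe_at p)"
  by (rule linearI) (simp_all add: coframe_at_def bil_simps algebra_simps)

lemma frechet_derivative_bch: "frechet_derivative (bch \<mu> (- p)) (at p) = coframe_at p"
proof -
  have "(bch \<mu> (- p) has_derivative coframe_at p) (at p)"
    unfolding bch_def coframe_at_def[abs_def]
    by (auto intro!: derivative_eq_intros simp: bil_simps alt anti[of _ p] scaleR_add_left[symmetric])
  then show ?thesis by (simp add: frechet_derivative_at[symmetric])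
qed

lemma left_invariant_coframe: "left_invariant \<mu> \<psi> = (\<lambda>p vs. \<psi> (map (coframe_at p) vs))"
  unfolding left_invariant_def frechet_derivative_bch ..

lemma coframe_at_left_field: "coframe_at p (left_field x p) = x"
  unfolding coframe_at_def left_field by (simp add: bil_simps nil vec_eq_iff field_simps)

lemma left_field_coframe_at: "left_field (coframe_at p v) p = v"
  unfolding coframe_at_def left_field by (simp add: bil_simps nil vec_eq_iff field_simps)

definition coframe_deriv :: "real^7 \<Rightarrow> real^7 \<Rightarrow> real^7 \<Rightarrow> real^7" where
  "coframe_deriv p u v = (1/6) *\<^sub>R (\<mu> p (\<mu> u v) + \<mu> u (\<mu> p v)) - (1/2) *\<^sub>R \<mu> u v"

lemma coframe_at_has_derivative: "((\<lambda>q. coframe_at q v) has_derivative (\<lambda>u. coframe_deriv p u v)) (at p)"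
  unfolding coframe_at_def coframe_deriv_def
  by (auto intro!: derivative_eq_intros simp: bil_simps)

text \<open>
  By the Jacobi identity the terms of third order are \<open>\<mu> p (\<mu> u v) / 2\<close> on both sides, and all higher
  terms vanish.
\<close>

lemma coframe_maurer_cartan:
  "coframe_deriv p u v - coframe_deriv p v u = - \<mu> (coframe_at p u) (coframe_at p v)"
proof -
  have nil3: "\<mu> (\<mu> a (\<mu> b c)) d = 0" for a b c d
    using anti[of "\<mu> a (\<mu> b c)" d] nil by simp
  have J: "\<mu> p (\<mu> u v) = \<mu> u (\<mu> p v) - \<mu> v (\<mu> p u)"
    using jacobi[of p u v] anti[of v p]
    by (simp add: bilinear_rneg[OF bil] add_eq_0_iff algebra_simps)
  have L: "\<mu> (\<mu> p u) v = - \<mu> v (\<mu> p u)" by (rule anti)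
  show ?thesis
    unfolding coframe_deriv_def coframe_at_def
    by (simp add: vec_eq_iff bil_simps nil nil2 nil3 L J anti[of v u] field_simps)
qed

lemma coframe_of_isomorphism:
  assumes "linear H" "bij H" "\<And>x y. H (\<mu> x y) = \<nu> (H x) (H y)"
  shows "coframe \<nu> (\<lambda>p v. H (coframe_at p v)) (\<lambda>p x. left_field (inv H x) p)
    (\<lambda>p u v. H (coframe_deriv p u v))"
proof (rule coframe.intro)
  have H: "inv H (H v) = v" "H (inv H x) = x" for v x
    using assms(2) by (simp_all add: bij_is_inj bij_is_surj surj_f_inv_f)
  have Hb: "bounded_linear H" using assms(1) by (simp add: linear_conv_bounded_linear)
  have iH: "linear (inv H)"
  proof (rule linearI)
    show "inv H (x + y) = inv H x + inv H y" for x y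
      using H(1)[of "inv H x + inv H y"] by (simp add: linear_add[OF assms(1)] H(2))
    show "inv H (r *\<^sub>R x) = r *\<^sub>R inv H x" for r x
      using H(1)[of "r *\<^sub>R inv H x"] by (simp add: linear_cmul[OF assms(1)] H(2))
  qed
  have \<nu>: "\<nu> x y = H (\<mu> (inv H x) (inv H y))" for x y
    by (simp add: assms(3) H)
  show "bilinear \<nu>"
    unfolding bilinear_def linear_iff \<nu>
    by (simp add: linear_add[OF iH] linear_cmul[OF iH] linear_add[OF assms(1)] linear_cmul[OF assms(1)] bil_simps)
  show "\<nu> x y = - \<nu> y x" for x y
    unfolding \<nu> using anti[of "inv H x" "inv H y"] linear_neg[OF assms(1)] by simp
  show "linear (\<lambda>v. H (coframe_at p v))" for p
    using linear_compose[OF linear_coframe_at assms(1)] by (simp add: comp_def)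
  show "H (coframe_at p (left_field (inv H x) p)) = x" for p x
    by (simp add: coframe_at_left_field H)
  show "left_field (inv H (H (coframe_at p v))) p = v" for p v
    by (simp add: left_field_coframe_at H)
  show "((\<lambda>q. H (coframe_at q v)) has_derivative (\<lambda>u. H (coframe_deriv p u v))) (at p)" for p v
    by (rule bounded_linear.has_derivative[OF Hb coframe_at_has_derivative])
  show "left_field (inv H x) differentiable (at p)" for p x
  proof -
    have "((\<lambda>q. left_field z q) has_derivative
        (\<lambda>v. (1/2) *\<^sub>R \<mu> v z + (1/12) *\<^sub>R (\<mu> p (\<mu> v z) + \<mu> v (\<mu> p z)))) (at p)" for z
      unfolding left_field by (auto intro!: derivative_eq_intros simp: bil_simps)
    then show ?thesis by (rule differentiableI)
  qed
  show "H (coframe_deriv p u v) - H (coframe_deriv p v u) = - \<nu> (H (coframe_at p u)) (H (coframe_at p v))" for p u v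
    by (simp add: linear_diff[OF assms(1), symmetric] coframe_maurer_cartan linear_neg[OF assms(1)] assms(3))
qed

end

text \<open>
  Let \<open>h\<close> be the automorphism with \<open>h \<cdot> \<psi> = c \<phi>\<close>. As \<open>\<phi>\<close> is cubic, a cube root \<open>r\<close> of \<open>c\<close> absorbs the
  factor into \<open>H = r P h\<close>; the bracket is then rescaled by \<open>1 / r\<close>.
\<close>

lemma homothetic_adapted:
  assumes hom: "homothetic \<mu> \<psi> \<mu> \<phi>"
    and P: "linear P" "bij P" "\<And>x y. P (\<mu> x y) = \<nu> (P x) (P y)" "\<phi> = (\<lambda>vs. g2_model (map P vs))"
    and bil: "bilinear \<nu>"
  shows "\<exists>s H. s \<noteq> 0 \<and> linear H \<and> bij H \<and> (\<forall>x y. H (\<mu> x y) = s *\<^sub>R \<nu> (H x) (H y)) \<and>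
    \<psi> = (\<lambda>vs. g2_model (map H vs))"
proof -
  obtain c h where c: "c \<noteq> 0" and h: "linear h" "bij h" "\<And>x y. h (\<mu> x y) = \<mu> (h x) (h y)"
    and act: "act h \<psi> = (\<lambda>vs. c * \<phi> vs)"
    using hom unfolding homothetic_def equivalent_def by blast
  define r where "r = root 3 c"
  have r: "r ^ 3 = c" "r \<noteq> 0" unfolding r_def using c by (simp_all add: odd_real_root_pow)
  define H where "H = (\<lambda>v. r *\<^sub>R P (h v))"
  have "\<psi> vs = g2_model (map H vs)" for vs
  proof -
    have "\<psi> vs = act h \<psi> (map h vs)"
      using h(2) by (simp add: act_def comp_def bij_is_inj)
    also have "\<dots> = c * g2_model (map P (map h vs))" by (simp add: act P(4))
    also have "\<dots> = g2_model (map (\<lambda>v. r *\<^sub>R v) (map P (map h vs)))"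
    proof (cases "length vs = 3")
      case True
      then show ?thesis using form_homogeneous[OF is_form_g2_model, of r "map P (map h vs)"] r(1) by simp
    qed (simp add: is_form_length[OF is_form_g2_model])
    finally show ?thesis by (simp add: H_def comp_def)
  qed
  moreover have "H (\<mu> x y) = (1 / r) *\<^sub>R \<nu> (H x) (H y)" for x y
    using r(2) by (simp add: H_def h(3) P(3) bilinear_lmul[OF bil] bilinear_rmul[OF bil])
  moreover have "linear H"
    unfolding H_def using linear_compose[OF h(1) P(1)] by (simp add: linear_compose_scale_right comp_def)
  moreover have "bij H"
  proof -
    have "bij (\<lambda>v::real^7. r *\<^sub>R v)"
      using r(2) by (intro bij_betwI[where g = "\<lambda>v. (1 / r) *\<^sub>R v"]) auto
    from bij_comp[OF bij_comp[OF h(2) P(2)] this] show ?thesis by (simp add: H_def comp_def)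
  qed
  ultimately show ?thesis using r(2) by (intro exI[of _ "1 / r"] exI[of _ H]) auto
qed

lemma not_gradient_homothetic:
  assumes "three_step \<mu>" "homothetic \<mu> \<psi> \<mu> \<phi>"
    and "linear P" "bij P" "\<And>x y. P (\<mu> x y) = \<nu> (P x) (P y)" "\<phi> = (\<lambda>vs. g2_model (map P vs))" "bilinear \<nu>"
    and no: "\<And>s \<Phi> \<Psi> K f lam. s \<noteq> 0 \<Longrightarrow> coframe (\<lambda>x y. s *\<^sub>R \<nu> x y) \<Phi> \<Psi> K \<Longrightarrow>
      \<not> gradient_laplacian_soliton (coframe.invariant \<Phi> g2_model) f lam"
  shows "\<not> gradient_laplacian_soliton (left_invariant \<mu> \<psi>) f lam"
proof -
  interpret three_step \<mu> by fact
  obtain s H where s: "s \<noteq> 0" and H: "linear H" "bij H" "\<And>x y. H (\<mu> x y) = s *\<^sub>R \<nu> (H x) (H y)"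
    and \<psi>: "\<psi> = (\<lambda>vs. g2_model (map H vs))"
    using homothetic_adapted[OF assms(2-7)] by blast
  have cf: "coframe (\<lambda>x y. s *\<^sub>R \<nu> x y) (\<lambda>p v. H (coframe_at p v)) (\<lambda>p x. left_field (inv H x) p)
      (\<lambda>p u v. H (coframe_deriv p u v))"
    by (rule coframe_of_isomorphism[OF H])
  have "left_invariant \<mu> \<psi> = coframe.invariant (\<lambda>p v. H (coframe_at p v)) g2_model"
    unfolding coframe.invariant_def[OF cf] left_invariant_coframe \<psi> by (simp add: comp_def)
  then show ?thesis using no[OF s cf] by simp
qed

section \<open>The abelian algebra\<close>

lemma ce_abelian:
  assumes "is_form k \<alpha>" "\<And>x y. \<nu> x y = 0"
  shows "ce \<nu> \<alpha> vs = 0"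
  using assms(1)
proof (induction vs arbitrary: \<alpha> k)
  case (Cons x vs)
  have "derivation (\<nu> x) \<alpha> vs = 0"
    unfolding derivation_conv_sum assms(2) by (simp add: linear_0[OF is_form_linear_weak[OF Cons.prems]])
  then show ?case using Cons.IH[OF is_form_interior[OF Cons.prems, of x]] by simp
qed simp

text \<open>
  Without bracket, the soliton equation says that the deformation acts on the model form like
  \<open>- \<lambda>/3\<close> times the identity, and the deformation is symmetric because the frame fields commute.
\<close>

lemma (in coframe) abelian_soliton_hessian:
  assumes nu: "\<And>x y. \<nu> x y = 0" and sol: "gradient_laplacian_soliton (invariant g2_model) f lam"
  shows "frechet_derivative (frame_gradient f) (at p) v = - (lam / 3) *\<^sub>R \<Phi> p v"
proof -
  have s: "smooth_fun f" using sol unfolding gradient_laplacian_soliton_def by blast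
  have closed: "ce \<nu> g2_model = (\<lambda>vs. 0)" using ce_abelian[of 3 g2_model \<nu>, OF is_form_g2_model nu] by blast
  let ?B = "\<lambda>x. deformation f p x - (- (lam / 3)) *\<^sub>R x"
  have sc: "derivation (\<lambda>x. r *\<^sub>R x) g2_model [x, y, z] = 3 * r * g2_model [x, y, z]" for r x y z
    using form_homogeneous[OF is_form_g2_model]
    by (simp add: linear_cmul[OF is_form_linear_weak[OF is_form_g2_model, of "[]" "[y, z]", simplified]]
        linear_cmul[OF is_form_linear_weak[OF is_form_g2_model, of "[x]" "[z]", simplified]]
        linear_cmul[OF is_form_linear_weak[OF is_form_g2_model, of "[x, y]" "[]", simplified]])
  have "derivation ?B g2_model [ax i, ax j, ax k] = 0" for i j k
    unfolding derivation_diff_endo[OF is_form_g2_model] soliton_equation[OF closed sol]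
      ce_abelian[of 2 torsion \<nu>, OF is_form_torsion nu] sc by simp
  note skew = g2_stabilizer_skew[of ?B, OF this]
  have sym: "deformation f p (ax i) $ j + deformation f p (ax j) $ i = (if i = j then - 2 * lam / 3 else 0)" for i j
    using skew[of i j] by (cases "i = j") (simp_all add: ax_nth field_simps)
  have D: "deformation f p x = frechet_derivative (frame_gradient f) (at p) (\<Psi> p x)" for x
    by (simp add: deformation_def nu)
  have com: "deformation f p (ax i) $ j = deformation f p (ax j) $ i" for i j
    using frame_gradient_commutator[OF s, of p "ax i" "ax j"] by (simp add: D nu inner_axis)
  have entries: "deformation f p (ax i) $ j = (if i = j then - lam / 3 else 0)" for i j
  proof (cases "i = j")
    case True
    then show ?thesis using sym[of i i] by (simp add: field_simps)
  next
    case False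
    then show ?thesis using sym[of i j] com[of i j] by simp
  qed
  have lin: "linear (deformation f p)"
    unfolding D using linear_compose[OF linear_Psi has_derivative_linear[OF frame_gradient_has_derivative[OF s]]]
    by (simp add: comp_def)
  have "deformation f p x = - (lam / 3) *\<^sub>R x" for x
  proof -
    have "deformation f p x $ j = - (lam / 3) * x $ j" for j
      by (subst linear_vec_expand[OF lin])
        (simp add: entries if_distrib[of "\<lambda>t. _ * t"] cong: if_cong)
    then show ?thesis by (simp add: vec_eq_iff)
  qed
  from this[of "\<Phi> p v"] show ?thesis by (simp add: D Psi_Phi)
qed

lemma abelian_soliton_gaussian:
  assumes "is_g2_form \<phi>" and sol: "gradient_laplacian_soliton (left_invariant n1 \<phi>) f lam"
  shows "gaussian (g2_metric \<phi>) f lam"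
proof -
  interpret three_step n1 by (rule three_step_algebras(1))
  \<comment> \<open>The bracket vanishes, so the coframe is the constant map \<open>H\<close>, and \<open>f\<close> is found by integrating twice.\<close>
  have n1: "n1 x y = 0" for x y by (simp add: n1_def bracket_of_def)
  obtain h where h: "linear h" "bij h" "\<phi> = act h g2_model"
    using assms(1) unfolding is_g2_form_def by blast
  define H where "H = inv h"
  have H: "linear H" "bij H"
    unfolding H_def using h inj_linear_imp_inv_linear bij_is_inj bij_imp_bij_inv by blast+
  have \<phi>: "\<phi> = (\<lambda>vs. g2_model (map H vs))" by (simp add: h(3) act_def H_def)
  have at: "coframe_at p = (\<lambda>v. v)" for p by (simp add: coframe_at_def fun_eq_iff n1)
  have "coframe n1 (\<lambda>p v. H (coframe_at p v)) (\<lambda>p x. left_field (inv H x) p)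
      (\<lambda>p u v. H (coframe_deriv p u v))"
    by (rule coframe_of_isomorphism[OF H]) (simp add: n1 linear_0[OF H(1)])
  then interpret cf: coframe n1 "\<lambda>p v. H v" "\<lambda>p x. left_field (inv H x) p" "\<lambda>p u v. H (coframe_deriv p u v)"
    by (simp only: at)
  have "left_invariant n1 \<phi> = cf.invariant g2_model"
    unfolding cf.invariant_def left_invariant_coframe at \<phi> by simp
  with sol have sol': "gradient_laplacian_soliton (cf.invariant g2_model) f lam" by simp
  then have smooth: "smooth_fun f" unfolding gradient_laplacian_soliton_def by blast
  have dH: "(H has_derivative H) (at p)" for p
    using H(1) by (simp add: linear_conv_bounded_linear bounded_linear_imp_has_derivative)
  define F where "F = cf.frame_gradient f"
  have dF: "(F has_derivative (\<lambda>v. - (lam / 3) *\<^sub>R H v)) (at p)" for p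
    using cf.frame_gradient_has_derivative[OF smooth, of p]
    unfolding F_def cf.abelian_soliton_hessian[OF n1 sol', abs_def] .
  have "((\<lambda>p. F p + (lam / 3) *\<^sub>R H p) has_derivative (\<lambda>v. 0)) (at p)" for p
    by (auto intro!: derivative_eq_intros dF dH)
  then obtain k where "\<forall>p\<in>UNIV. F p + (lam / 3) *\<^sub>R H p = k"
    using has_derivative_zero_constant[OF convex_UNIV] by blast
  then have k: "F p = k - (lam / 3) *\<^sub>R H p" for p by (simp add: eq_diff_eq)
  have df: "(f has_derivative (\<lambda>v. F p \<bullet> H v)) (at p)" for p
  proof -
    have d: "f differentiable (at p)" by (rule smooth_fun_differentiable(1)[OF smooth])
    then have "(f has_derivative frechet_derivative f (at p)) (at p)"
      unfolding frechet_derivative_works .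
    then show ?thesis unfolding cf.frechet_derivative_frame_gradient[OF d, abs_def] F_def .
  qed
  have "((\<lambda>p. f p + (lam / 6) * (H p \<bullet> H p) - k \<bullet> H p) has_derivative (\<lambda>v. 0)) (at p)" for p
  proof -
    have "((\<lambda>p. f p + (lam / 6) * (H p \<bullet> H p) - k \<bullet> H p) has_derivative
        (\<lambda>v. F p \<bullet> H v + (lam / 6) * (H p \<bullet> H v + H v \<bullet> H p) - k \<bullet> H v)) (at p)"
      by (intro has_derivative_diff has_derivative_add has_derivative_mult_right has_derivative_inner
          has_derivative_inner_right df dH)
    moreover have "F p \<bullet> H v + (lam / 6) * (H p \<bullet> H v + H v \<bullet> H p) - k \<bullet> H v = 0" for v
      unfolding inner_commute[of "H v" "H p"] by (simp add: k inner_diff_left)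
    ultimately show ?thesis by simp
  qed
  then obtain c where "\<forall>p\<in>UNIV. f p + (lam / 6) * (H p \<bullet> H p) - k \<bullet> H p = c"
    using has_derivative_zero_constant[OF convex_UNIV] by blast
  then have f: "f p = c - (lam / 6) * (H p \<bullet> H p) + k \<bullet> H p" for p
    by (simp add: algebra_simps)
  have HI: "H (inv H x) = x" for x using H(2) by (simp add: bij_is_surj surj_f_inv_f)
  have HS: "H (\<Sum>i\<in>UNIV. x $ i *\<^sub>R inv H (ax i)) = x" for x
    by (simp add: linear_sum[OF H(1)] linear_cmul[OF H(1)] HI sum_axis)
  have "f (\<Sum>i\<in>UNIV. x $ i *\<^sub>R inv H (ax i)) =
      - (lam / 6) * (norm x)\<^sup>2 - (\<Sum>i\<in>UNIV. - (k $ i) * x $ i) - (- c)" for x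
  proof -
    have "(\<Sum>i\<in>UNIV. - (k $ i) * x $ i) = - (k \<bullet> x)" by (simp add: inner_vec_def sum_negf)
    then show ?thesis
      using f[of "\<Sum>i\<in>UNIV. x $ i *\<^sub>R inv H (ax i)"] unfolding HS power2_norm_eq_inner by linarith
  qed
  moreover have "orthonormal_basis (g2_metric \<phi>) (\<lambda>i. inv H (ax i))"
    unfolding \<phi> g2_metric_pullback[OF H] by (rule orthonormal_basis_pullback_axis[of H "inv H", OF HI])
  ultimately show ?thesis
    unfolding gaussian_def
    by (intro exI[of _ "\<lambda>i. inv H (ax i)"] exI[of _ "\<lambda>i. - (k $ i)"] exI[of _ "- c"] conjI allI)
qed

section \<open>The theorem\<close>

text \<open>
  The signed permutations of the coordinates by which the given forms are brought to the model form.
\<close>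

definition reindex :: "(7 \<Rightarrow> real) \<Rightarrow> 7 list \<Rightarrow> real^7 \<Rightarrow> real^7" where
  "reindex \<sigma> js x = (\<chi> i. \<sigma> i * x $ (js ! (index i - 1)))"

lemma linear_reindex: "linear (reindex \<sigma> js)"
  by (rule linearI) (simp_all add: reindex_def vec_eq_iff algebra_simps)

lemma bij_reindex:
  assumes "\<And>i. \<sigma> i \<noteq> 0" "length js = 7" "distinct js"
  shows "bij (reindex \<sigma> js)"
proof -
  have "x = 0" if "reindex \<sigma> js x = 0" for x
  proof -
    have z: "x $ (js ! (index i - 1)) = 0" for i
    proof -
      have "reindex \<sigma> js x $ i = 0" using that by simp
      then show ?thesis by (simp add: reindex_def assms(1))
    qed
    have "mset js = mset [1,2,3,4,5,6,7]"
      by (intro mset_indices_iff[THEN iffD2] conjI assms)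
    from mset_eq_setD[OF this] have js: "set js = UNIV" by (simp only: set_indices)
    have "x $ j = 0" for j
    proof -
      obtain n where n: "n < 7" "js ! n = j" using js assms(2) by (metis UNIV_I in_set_conv_nth)
      have "n = 0 \<or> n = 1 \<or> n = 2 \<or> n = 3 \<or> n = 4 \<or> n = 5 \<or> n = 6" using n(1) by auto
      then have "index (of_nat (n + 1)) = n + 1"
        by (elim disjE) (simp_all add: index_def)
      then show ?thesis using z[of "of_nat (n + 1)"] n(2) by simp
    qed
    then show ?thesis by (simp add: vec_eq_iff)
  qed
  then have "inj (reindex \<sigma> js)" using linear_injective_0[OF linear_reindex] by blast
  then show ?thesis
    using linear_injective_imp_surjective[OF linear_reindex] by (simp add: bij_def)
qed

text \<open>
  A comparison on triples suffices, where both sides are explicit polynomials.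
\<close>

lemma eq_g2_modelI:
  assumes "is_form 3 \<phi>" "linear P" "\<And>x y z. \<phi> [x, y, z] = g2_model [P x, P y, P z]"
  shows "\<phi> = (\<lambda>vs. g2_model (map P vs))"
proof
  fix vs
  show "\<phi> vs = g2_model (map P vs)"
  proof (cases "length vs = 3")
    case True
    then obtain x y z where "vs = [x, y, z]" by (auto simp: numeral_3_eq_3 length_Suc_conv)
    then show ?thesis using assms(3) by simp
  qed (simp add: is_form_length[OF assms(1)] is_form_length[OF is_form_g2_model])
qed

lemma not_gradient_homothetic_n2:
  assumes "homothetic n2 \<psi> n2 phi2"
  shows "\<not> gradient_laplacian_soliton (left_invariant n2 \<psi>) f lam"
proof (rule not_gradient_homothetic[OF three_step_algebras(2) assms(1) linear_reindex bij_reindex])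
  let ?P = "reindex (\<lambda>i. 1) [1,2,5,7,6,4,3]"
  show "?P (n2 x y) = bracket_of [(1,2,3,-1), (1,7,5,-1)] (?P x) (?P y)" for x y
    by (simp add: vec_eq_iff forall_7 n2_def bracket_of_def axis_def reindex_def index_def algebra_simps)
  show "phi2 = (\<lambda>vs. g2_model (map ?P vs))"
  proof (rule eq_g2_modelI[OF _ linear_reindex])
    show "is_form 3 phi2"
      unfolding phi2_def by (intro is_form_add is_form_diff is_form_minus is_form_e) simp_all
    show "phi2 [x, y, z] = g2_model [?P x, ?P y, ?P z]" for x y z
      by (simp add: phi2_def g2_model_explicit e_3 reindex_def index_def algebra_simps)
  qed
  show "bilinear (bracket_of [(1,2,3,-1), (1,7,5,-1)])" by (rule bilinear_bracket_of)
  show "\<not> gradient_laplacian_soliton (coframe.invariant \<Phi> g2_model) f lam"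
    if "s \<noteq> 0" "coframe (\<lambda>x y. s *\<^sub>R bracket_of [(1,2,3,-1), (1,7,5,-1)] x y) \<Phi> \<Psi> K" for s \<Phi> \<Psi> K f lam
    by (rule coframe.not_gradient_n2[OF that(2) refl that(1)])
qed simp_all

lemma not_gradient_homothetic_n3:
  assumes "0 < c" "c < 1/2" and "homothetic (n3 c) \<psi> (n3 c) phi3"
  shows "\<not> gradient_laplacian_soliton (left_invariant (n3 c) \<psi>) f lam"
proof (rule not_gradient_homothetic[OF three_step_algebras(3) assms(3) linear_reindex bij_reindex])
  let ?P = "reindex (\<lambda>i. 1) [1,2,6,5,7,4,3]"
  show "?P ((n3 c) x y) = bracket_of [(1,2,6,-1), (1,7,4,-(1-c)), (2,7,3,-c)] (?P x) (?P y)" for x y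
    by (simp add: vec_eq_iff forall_7 n3_def bracket_of_def axis_def reindex_def index_def algebra_simps)
  show "phi3 = (\<lambda>vs. g2_model (map ?P vs))"
  proof (rule eq_g2_modelI[OF _ linear_reindex])
    show "is_form 3 phi3"
      unfolding phi3_def by (intro is_form_add is_form_diff is_form_minus is_form_e) simp_all
    show "phi3 [x, y, z] = g2_model [?P x, ?P y, ?P z]" for x y z
      by (simp add: phi3_def g2_model_explicit e_3 reindex_def index_def algebra_simps)
  qed
  show "bilinear (bracket_of [(1,2,6,-1), (1,7,4,-(1-c)), (2,7,3,-c)])" by (rule bilinear_bracket_of)
  show "\<not> gradient_laplacian_soliton (coframe.invariant \<Phi> g2_model) f lam"
    if "s \<noteq> 0" "coframe (\<lambda>x y. s *\<^sub>R bracket_of [(1,2,6,-1), (1,7,4,-(1-c)), (2,7,3,-c)] x y) \<Phi> \<Psi> K" for s \<Phi> \<Psi> K f lam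
    by (rule coframe.not_gradient_n3[OF that(2) refl that(1) assms(1,2)])
qed simp_all

lemma not_gradient_homothetic_n4:
  assumes "homothetic n4 \<psi> n4 phi4"
  shows "\<not> gradient_laplacian_soliton (left_invariant n4 \<psi>) f lam"
proof (rule not_gradient_homothetic[OF three_step_algebras(4) assms(1) linear_reindex bij_reindex])
  let ?P = "reindex (\<lambda>i. if i = 7 then - 1 else 1) [1,2,3,7,5,6,4]"
  show "?P (n4 x y) = bracket_of [(1,2,3,-sqrt 2), (1,3,6,-1), (2,7,6,sqrt 2), (1,5,4,-1)] (?P x) (?P y)" for x y
    by (simp add: vec_eq_iff forall_7 n4_def bracket_of_def axis_def reindex_def index_def algebra_simps)
  show "phi4 = (\<lambda>vs. g2_model (map ?P vs))"
  proof (rule eq_g2_modelI[OF _ linear_reindex])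
    show "is_form 3 phi4"
      unfolding phi4_def by (intro is_form_add is_form_diff is_form_minus is_form_e) simp_all
    show "phi4 [x, y, z] = g2_model [?P x, ?P y, ?P z]" for x y z
      by (simp add: phi4_def g2_model_explicit e_3 reindex_def index_def algebra_simps)
  qed
  show "bilinear (bracket_of [(1,2,3,-sqrt 2), (1,3,6,-1), (2,7,6,sqrt 2), (1,5,4,-1)])" by (rule bilinear_bracket_of)
  show "\<not> gradient_laplacian_soliton (coframe.invariant \<Phi> g2_model) f lam"
    if "s \<noteq> 0" "coframe (\<lambda>x y. s *\<^sub>R bracket_of [(1,2,3,-sqrt 2), (1,3,6,-1), (2,7,6,sqrt 2), (1,5,4,-1)] x y) \<Phi> \<Psi> K" for s \<Phi> \<Psi> K f lam
    by (rule coframe.not_gradient_n4[OF that(2) refl that(1)])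
qed simp_all

lemma not_gradient_homothetic_n5:
  assumes "homothetic n5 \<psi> n5 phi5"
  shows "\<not> gradient_laplacian_soliton (left_invariant n5 \<psi>) f lam"
proof (rule not_gradient_homothetic[OF three_step_algebras(5) assms(1) linear_reindex bij_reindex])
  let ?P = "reindex (\<lambda>i. 1) [1,3,5,7,2,6,4]"
  show "?P (n5 x y) = bracket_of [(1,5,2,-sqrt 2), (1,2,6,-1), (1,7,4,-1), (5,3,4,-sqrt 2)] (?P x) (?P y)" for x y
    by (simp add: vec_eq_iff forall_7 n5_def bracket_of_def axis_def reindex_def index_def algebra_simps)
  show "phi5 = (\<lambda>vs. g2_model (map ?P vs))"
  proof (rule eq_g2_modelI[OF _ linear_reindex])
    show "is_form 3 phi5"
      unfolding phi5_def by (intro is_form_add is_form_diff is_form_minus is_form_e) simp_all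
    show "phi5 [x, y, z] = g2_model [?P x, ?P y, ?P z]" for x y z
      by (simp add: phi5_def g2_model_explicit e_3 reindex_def index_def algebra_simps)
  qed
  show "bilinear (bracket_of [(1,5,2,-sqrt 2), (1,2,6,-1), (1,7,4,-1), (5,3,4,-sqrt 2)])" by (rule bilinear_bracket_of)
  show "\<not> gradient_laplacian_soliton (coframe.invariant \<Phi> g2_model) f lam"
    if "s \<noteq> 0" "coframe (\<lambda>x y. s *\<^sub>R bracket_of [(1,5,2,-sqrt 2), (1,2,6,-1), (1,7,4,-1), (5,3,4,-sqrt 2)] x y) \<Phi> \<Psi> K" for s \<Phi> \<Psi> K f lam
    by (rule coframe.not_gradient_n5[OF that(2) refl that(1)])
qed simp_all

lemma not_gradient_homothetic_n6:
  assumes "homothetic n6 \<psi> n6 phi6"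
  shows "\<not> gradient_laplacian_soliton (left_invariant n6 \<psi>) f lam"
proof (rule not_gradient_homothetic[OF three_step_algebras(6) assms(1) linear_reindex bij_reindex])
  let ?P = "reindex (\<lambda>i. 1) [1,2,4,7,5,6,3]"
  show "?P (n6 x y) = bracket_of [(1,2,3,-sqrt 2), (1,7,5,-sqrt 2), (1,3,6,-1), (1,5,4,-1)] (?P x) (?P y)" for x y
    by (simp add: vec_eq_iff forall_7 n6_def bracket_of_def axis_def reindex_def index_def algebra_simps)
  show "phi6 = (\<lambda>vs. g2_model (map ?P vs))"
  proof (rule eq_g2_modelI[OF _ linear_reindex])
    show "is_form 3 phi6"
      unfolding phi6_def by (intro is_form_add is_form_diff is_form_minus is_form_e) simp_all
    show "phi6 [x, y, z] = g2_model [?P x, ?P y, ?P z]" for x y z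
      by (simp add: phi6_def g2_model_explicit e_3 reindex_def index_def algebra_simps)
  qed
  show "bilinear (bracket_of [(1,2,3,-sqrt 2), (1,7,5,-sqrt 2), (1,3,6,-1), (1,5,4,-1)])" by (rule bilinear_bracket_of)
  show "\<not> gradient_laplacian_soliton (coframe.invariant \<Phi> g2_model) f lam"
    if "s \<noteq> 0" "coframe (\<lambda>x y. s *\<^sub>R bracket_of [(1,2,3,-sqrt 2), (1,7,5,-sqrt 2), (1,3,6,-1), (1,5,4,-1)] x y) \<Phi> \<Psi> K" for s \<Phi> \<Psi> K f lam
    by (rule coframe.not_gradient_n6[OF that(2) refl that(1)])
qed simp_all

lemma not_gradient_homothetic_n7:
  assumes "homothetic n7 \<psi> n7 phi7"
  shows "\<not> gradient_laplacian_soliton (left_invariant n7 \<psi>) f lam"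
proof (rule not_gradient_homothetic[OF three_step_algebras(7) assms(1) linear_reindex bij_reindex])
  let ?P = "reindex (\<lambda>i. 1) [1,2,3,4,5,6,7]"
  show "?P (n7 x y) = bracket_of [(1,2,4,4), (2,7,5,-2), (1,7,6,-2), (5,7,3,-sqrt 6), (6,7,4,-sqrt 6)] (?P x) (?P y)" for x y
    by (simp add: vec_eq_iff forall_7 n7_def bracket_of_def axis_def reindex_def index_def algebra_simps)
  show "phi7 = (\<lambda>vs. g2_model (map ?P vs))"
  proof (rule eq_g2_modelI[OF _ linear_reindex])
    show "is_form 3 phi7"
      unfolding phi7_def by (intro is_form_add is_form_diff is_form_minus is_form_e) simp_all
    show "phi7 [x, y, z] = g2_model [?P x, ?P y, ?P z]" for x y z
      by (simp add: phi7_def g2_model_explicit e_3 reindex_def index_def algebra_simps)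
  qed
  show "bilinear (bracket_of [(1,2,4,4), (2,7,5,-2), (1,7,6,-2), (5,7,3,-sqrt 6), (6,7,4,-sqrt 6)])" by (rule bilinear_bracket_of)
  show "\<not> gradient_laplacian_soliton (coframe.invariant \<Phi> g2_model) f lam"
    if "s \<noteq> 0" "coframe (\<lambda>x y. s *\<^sub>R bracket_of [(1,2,4,4), (2,7,5,-2), (1,7,6,-2), (5,7,3,-sqrt 6), (6,7,4,-sqrt 6)] x y) \<Phi> \<Psi> K" for s \<Phi> \<Psi> K f lam
    by (rule coframe.not_gradient_n7[OF that(2) refl that(1)])
qed simp_all

theorem theorem1p6:
  shows "(\<forall>(\<mu>, \<phi>) \<in> {(n2, phi2), (n4, phi4), (n5, phi5), (n6, phi6), (n7, phi7)} \<union>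
                     {(n3 c, phi3) | c. 0 < c \<and> c < 1/2}.
           \<forall>\<psi>. is_g2_form \<psi> \<and> homothetic \<mu> \<psi> \<mu> \<phi> \<longrightarrow>
             \<not> (\<exists>f lam. gradient_laplacian_soliton (left_invariant \<mu> \<psi>) f lam)) \<and>
         (\<forall>\<phi> f lam. is_g2_form \<phi> \<and> gradient_laplacian_soliton (left_invariant n1 \<phi>) f lam \<longrightarrow>
           gaussian (g2_metric \<phi>) f lam)"
proof (intro conjI allI impI)
  have "\<not> gradient_laplacian_soliton (left_invariant \<mu> \<psi>) f lam"
    if "(\<mu>, \<phi>) \<in> {(n2, phi2), (n4, phi4), (n5, phi5), (n6, phi6), (n7, phi7)} \<union>
      {(n3 c, phi3) | c. 0 < c \<and> c < 1/2}" "homothetic \<mu> \<psi> \<mu> \<phi>" for \<mu> \<phi> \<psi> f lam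
    using that not_gradient_homothetic_n2 not_gradient_homothetic_n3 not_gradient_homothetic_n4
      not_gradient_homothetic_n5 not_gradient_homothetic_n6 not_gradient_homothetic_n7 by auto
  then show "\<forall>(\<mu>, \<phi>) \<in> {(n2, phi2), (n4, phi4), (n5, phi5), (n6, phi6), (n7, phi7)} \<union>
                     {(n3 c, phi3) | c. 0 < c \<and> c < 1/2}.
           \<forall>\<psi>. is_g2_form \<psi> \<and> homothetic \<mu> \<psi> \<mu> \<phi> \<longrightarrow>
             \<not> (\<exists>f lam. gradient_laplacian_soliton (left_invariant \<mu> \<psi>) f lam)"
    by blast
qed (blast intro: abelian_soliton_gaussian)

end
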